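(* Let $n\ge 1$ and let $X\subset\mathbb R^{2n}=\mathbb R^n\times\mathbb R^n$ be the convex body $$X=\{(p,q)\mid H(p,q)=\|p\|_1^2+\|q\|_\infty^2\le 1\},\qquad \|p\|_1=\sum_{i=1}^n|p_i|,\quad \|q\|_\infty=\max_{1\le i\le n}|q_i|.$$ Then Viterbo's conjecture holds for $X$: $$\operatorname{vol}X\ \ge\ \frac{c_{EHZ}(X)^n}{n!}.$$
   Context: $\mathbb R^{2n}$ has coordinates $(p,q)=(p_1,\dots,p_n,q_1,\dots,q_n)$ and symplectic form $\omega=\sum_{i=1}^n dp_i\wedge dq_i$; $\operatorname{vol}$ is Lebesgue measure on $\mathbb R^{2n}$. For a convex body $X\subset\mathbb R^{2n}$ with smooth boundary, a closed characteristic on $\partial X$ is a closed curve $\gamma$ in $\partial X$ whose velocity $\dot\gamma$ is nonzero and always lies in the one-dimensional kernel of the restriction of $\omega$ to $T\partial X$, oriented in the direction of the Hamiltonian flow $\dot q_i=\partial H/\partial p_i$, $\dot p_i=-\partial H/\partial q_i$ of a function $H$ having $X$ as a sublevel set with regular boundary level. Its action is $\int_\gamma\sum_{i=1}^n p_i\,dq_i$. The Ekeland--Hofer--Zehnder capacity $c_{EHZ}(X)$ is the smallest action of a closed characteristic on $\partial X$ for smooth convex $X$, and is extended to non-smooth convex bodies by continuity in the Hausdorff metric. *)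

theory Defs
  imports "HOL-Analysis.Analysis"
begin

text \<open>
  The space \<open>(real ^ 'n) \<times> (real ^ 'n)\<close> is the symplectic space of dimension \<open>2n\<close> with
  \<open>n = CARD('n)\<close>; a point is the pair \<open>(p, q)\<close>.
\<close>

definition symplectic_form :: "(real ^ 'n) \<times> (real ^ 'n) \<Rightarrow> (real ^ 'n) \<times> (real ^ 'n) \<Rightarrow> real" where
  "symplectic_form u v = (\<Sum>i\<in>UNIV. fst u $ i * snd v $ i - snd u $ i * fst v $ i)"

definition hamiltonian_field ::
  "((real ^ 'n) \<times> (real ^ 'n) \<Rightarrow> real) \<Rightarrow> (real ^ 'n) \<times> (real ^ 'n) \<Rightarrow> (real ^ 'n) \<times> (real ^ 'n)" where
  "hamiltonian_field H x =
     ((\<chi> i. - frechet_derivative H (at x) (0, axis i 1)),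
      (\<chi> i. frechet_derivative H (at x) (axis i 1, 0)))"

primrec k_times_cont_differentiable :: "nat \<Rightarrow> ('a::euclidean_space \<Rightarrow> real) \<Rightarrow> bool" where
  "k_times_cont_differentiable 0 f \<longleftrightarrow> continuous_on UNIV f"
| "k_times_cont_differentiable (Suc k) f \<longleftrightarrow>
     (\<forall>x. f differentiable (at x)) \<and>
     (\<forall>v. k_times_cont_differentiable k (\<lambda>x. frechet_derivative f (at x) v))"

definition smooth :: "('a::euclidean_space \<Rightarrow> real) \<Rightarrow> bool" where
  "smooth f \<longleftrightarrow> (\<forall>k. k_times_cont_differentiable k f)"

definition convex_body :: "'a::euclidean_space set \<Rightarrow> bool" where
  "convex_body X \<longleftrightarrow> compact X \<and> convex X \<and> interior X \<noteq> {}"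

text \<open>
  \<open>X\<close> is the sublevel set of the smooth function \<open>H\<close> at the regular value \<open>c\<close>. The boundary
  of \<open>X\<close> is then the level set of \<open>H\<close> at \<open>c\<close>.
\<close>

definition regular_sublevel :: "('a::euclidean_space \<Rightarrow> real) \<Rightarrow> real \<Rightarrow> 'a set \<Rightarrow> bool" where
  "regular_sublevel H c X \<longleftrightarrow>
     smooth H \<and> X = {x. H x \<le> c} \<and> (\<forall>x. H x = c \<longrightarrow> (\<exists>v. frechet_derivative H (at x) v \<noteq> 0))"

definition smooth_convex_body :: "'a::euclidean_space set \<Rightarrow> bool" where
  "smooth_convex_body X \<longleftrightarrow> convex_body X \<and> (\<exists>H c. regular_sublevel H c X)"

text \<open>The tangent space at \<open>x\<close> of the regular level set of \<open>H\<close> through \<open>x\<close>.\<close>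

definition level_tangent_space :: "('a::euclidean_space \<Rightarrow> real) \<Rightarrow> 'a \<Rightarrow> 'a set" where
  "level_tangent_space H x = {v. frechet_derivative H (at x) v = 0}"

definition characteristic_line ::
  "((real ^ 'n) \<times> (real ^ 'n) \<Rightarrow> real) \<Rightarrow> (real ^ 'n) \<times> (real ^ 'n) \<Rightarrow> ((real ^ 'n) \<times> (real ^ 'n)) set" where
  "characteristic_line H x =
     {v \<in> level_tangent_space H x. \<forall>w \<in> level_tangent_space H x. symplectic_form v w = 0}"

text \<open>
  A closed curve is given by a periodic parametrization with period \<open>T\<close>. The last condition below
  fixes the orientation; neither it nor the tangent space depends on the choice of \<open>H\<close> and \<open>c\<close>.
\<close>

definition closed_characteristic ::
  "((real ^ 'n) \<times> (real ^ 'n)) set \<Rightarrow> real \<Rightarrow> (real \<Rightarrow> (real ^ 'n) \<times> (real ^ 'n)) \<Rightarrow> bool" where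
  "closed_characteristic X T \<gamma> \<longleftrightarrow>
     T > 0 \<and> (\<forall>t. \<gamma> (t + T) = \<gamma> t) \<and> \<gamma> C1_differentiable_on UNIV \<and>
     (\<forall>t. \<gamma> t \<in> frontier X) \<and>
     (\<exists>H c. regular_sublevel H c X \<and>
        (\<forall>t. vector_derivative \<gamma> (at t) \<noteq> 0 \<and>
             vector_derivative \<gamma> (at t) \<in> characteristic_line H (\<gamma> t) \<and>
             (\<exists>r>0. vector_derivative \<gamma> (at t) = r *\<^sub>R hamiltonian_field H (\<gamma> t))))"

definition action :: "real \<Rightarrow> (real \<Rightarrow> (real ^ 'n) \<times> (real ^ 'n)) \<Rightarrow> real" where
  "action T \<gamma> =
     integral {0..T} (\<lambda>t. \<Sum>i\<in>UNIV. fst (\<gamma> t) $ i * snd (vector_derivative \<gamma> (at t)) $ i)"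

text \<open>For a smooth convex body the set of actions has a smallest element, so \<open>Inf\<close> is a minimum.\<close>

definition min_action :: "((real ^ 'n) \<times> (real ^ 'n)) set \<Rightarrow> real" where
  "min_action X = Inf {action T \<gamma> | T \<gamma>. closed_characteristic X T \<gamma>}"

definition hausdorff_distance :: "'a::metric_space set \<Rightarrow> 'a set \<Rightarrow> real" where
  "hausdorff_distance A B = max (SUP a\<in>A. infdist a B) (SUP b\<in>B. infdist b A)"

text \<open>The filter of smooth convex bodies that tend to \<open>X\<close> in the Hausdorff metric.\<close>

definition smooth_bodies_near :: "'a::euclidean_space set \<Rightarrow> 'a set filter" where
  "smooth_bodies_near X =
     inf (filtercomap (\<lambda>K. hausdorff_distance K X) (nhds 0)) (principal {K. smooth_convex_body K})"

text \<open>
  The Ekeland--Hofer--Zehnder capacity: the smallest action for smooth convex bodies, extended to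
  other convex bodies by continuity. The limit exists for every convex body; the value \<open>0\<close> in the
  last branch only makes the function total.
\<close>

definition c_EHZ :: "((real ^ 'n) \<times> (real ^ 'n)) set \<Rightarrow> real" where
  "c_EHZ X =
     (if smooth_convex_body X then min_action X
      else if \<exists>l. (min_action \<longlongrightarrow> l) (smooth_bodies_near X) then Lim (smooth_bodies_near X) min_action
      else 0)"

definition norm_1 :: "real ^ 'n \<Rightarrow> real" where
  "norm_1 p = (\<Sum>i\<in>UNIV. \<bar>p $ i\<bar>)"

definition norm_inf :: "real ^ 'n \<Rightarrow> real" where
  "norm_inf q = Max (range (\<lambda>i. \<bar>q $ i\<bar>))"

end

theory Submission
  imports Defs
begin

text \<open>
  Let \<open>n\<close> be the number of degrees of freedom. The volume is computed exactly:
  \<open>exp (- N\<^sup>2)\<close> for the gauge \<open>N\<close> of \<open>X\<close> is the product of a function of \<open>p\<close> and a function of \<open>q\<close>,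
  and comparing integrals gives \<open>vol X = 4\<^sup>n \<Gamma>(n/2 + 1)\<^sup>2 / (n!)\<^sup>2\<close>
  (\<open>measure_square_sum_ball\<close>), which is at least \<open>2 \<cdot> 2\<^sup>n / n!\<close> for \<open>n \<ge> 2\<close>.
  Because \<open>(2n / (2n - 1))\<^sup>n \<le> 2\<close> by Bernoulli's inequality, the claim for \<open>n \<ge> 2\<close> follows from
  \<open>c_EHZ X \<le> 4n / (2n - 1)\<close>. For \<open>n = 1\<close> the body is the unit disc, whose boundary circle has
  action \<open>\<pi>\<close>, the area of the disc.
  
  For \<open>n \<ge> 2\<close> the body has corners, so its capacity is a limit of minimal actions of smooth bodies.
  A limit can be tested on one sequence, and a minimal action is at most the action of any closed
  characteristic. So smooth bodies near \<open>X\<close> are needed that carry a closed characteristic of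
  action at most \<open>4n / (2n - 1)\<close> up to a small error (\<open>short_closed_characteristic\<close>).
  
  The orbit is best described on \<open>X\<close> itself. Only a coordinate with the largest \<open>|q\<^sub>i|\<close> feels a force.
  Time is measured such that every \<open>q\<^sub>i\<close> moves with speed \<open>1\<close> in the direction of the sign of \<open>p\<^sub>i\<close>.
  While coordinate \<open>i\<close> leads and \<open>q\<^sub>i > 0\<close>, its momentum decreases; when \<open>p\<^sub>i\<close> passes through \<open>0\<close>,
  \<open>q\<^sub>i\<close> turns round and \<open>\<parallel>q\<parallel>\<^sub>\<infinity>\<close> decreases, until the next coordinate, which is still growing, has the
  same absolute value and takes the lead. So the point \<open>(\<parallel>p\<parallel>\<^sub>1, \<parallel>q\<parallel>\<^sub>\<infinity>)\<close> oscillates on a short arc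
  of the unit circle instead of running round it. If the momenta of the waiting coordinates all have
  one absolute value \<open>m\<close>, then all coordinates follow one profile \<open>(f, g)\<close>: \<open>f\<close> is a triangle wave of
  half period \<open>2nD\<close>, and coordinate \<open>j\<close> is delayed by \<open>2Dj\<close>. The density of the action is at most
  \<open>\<parallel>p\<parallel>\<^sub>1 \<le> \<surd>2 - \<parallel>q\<parallel>\<^sub>\<infinity>\<close>, the mean of \<open>\<parallel>q\<parallel>\<^sub>\<infinity>\<close> is \<open>(n - 1/2) D\<close>, and the period is \<open>4nD\<close>.
  Hence the action is at most \<open>4nD (\<surd>2 - (n - 1/2) D)\<close>, and this is at most \<open>4n / (2n - 1)\<close> for
  every \<open>D\<close> by the inequality between the arithmetic and the geometric mean.
  
  The smooth bodies are sublevel sets of the same expression with \<open>|x|\<close> replaced by a smooth even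
  convex function \<open>a\<close> that equals \<open>|x|\<close> outside \<open>(-\<epsilon>, \<epsilon>)\<close>, and with the maximum replaced by
  iterating \<open>(x + y + a (x - y)) / 2\<close>. This changes the orbit only for a short time when a momentum
  changes sign and when the lead is exchanged. In both phases conservation of energy reduces the
  equations to quadratures (\<open>lead_solution\<close>, \<open>transition_solution\<close>). Smoothing also shifts
  the lengths of the phases; the orbit closes up again after a constant \<open>\<beta> = O(\<epsilon>)\<close> has been added to
  every \<open>|q\<^sub>i|\<close> (\<open>characteristic_profile_exists\<close>).
\<close>

section \<open>Functions that are differentiable arbitrarily often\<close>

lemma k_times_cont_differentiable_SucI:
  assumes "\<And>x. (f has_derivative f' x) (at x)"
    and "\<And>v. k_times_cont_differentiable k (\<lambda>x. f' x v)"
  shows "k_times_cont_differentiable (Suc k) f"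
proof -
  have "frechet_derivative f (at x) = f' x" for x
    using frechet_derivative_at[OF assms(1)] by simp
  then show ?thesis
    using assms by (auto simp: differentiable_def)
qed

lemma k_times_cont_differentiable_imp_continuous:
  "k_times_cont_differentiable k f \<Longrightarrow> continuous_on UNIV f"
  by (cases k) (auto simp: continuous_on_eq_continuous_at intro: differentiable_imp_continuous_within)

lemma k_times_cont_differentiable_Suc_imp:
  "k_times_cont_differentiable (Suc k) f \<Longrightarrow> k_times_cont_differentiable k f"
proof (induction k arbitrary: f)
  case 0
  then show ?case
    by (metis k_times_cont_differentiable_imp_continuous k_times_cont_differentiable.simps(1))
next
  case (Suc k)
  have diff: "\<forall>x. f differentiable at x"
    using Suc.prems by simp
  have "k_times_cont_differentiable k (\<lambda>x. frechet_derivative f (at x) v)" for v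
  proof (rule Suc.IH)
    have "\<forall>v. k_times_cont_differentiable (Suc k) (\<lambda>x. frechet_derivative f (at x) v)"
      using Suc.prems by (subst (asm) k_times_cont_differentiable.simps(2)) iprover
    then show "k_times_cont_differentiable (Suc k) (\<lambda>x. frechet_derivative f (at x) v)" ..
  qed
  with diff show ?case
    by (subst k_times_cont_differentiable.simps(2)) iprover
qed

lemma k_times_cont_differentiable_SucE:
  assumes "k_times_cont_differentiable (Suc k) f"
  obtains f' where "\<And>x. (f has_derivative f' x) (at x)"
    and "\<And>v. k_times_cont_differentiable k (\<lambda>x. f' x v)"
    using assms that[of "\<lambda>x. frechet_derivative f (at x)"]
    by (auto simp: frechet_derivative_works)

lemma k_times_cont_differentiable_const: "k_times_cont_differentiable k (\<lambda>x. c)"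
proof (induction k arbitrary: c)
  case (Suc k)
  show ?case
    by (rule k_times_cont_differentiable_SucI[where f' = "\<lambda>x v. 0"]) (auto simp: Suc)
qed simp

lemma k_times_cont_differentiable_linear:
  assumes "bounded_linear f"
  shows "k_times_cont_differentiable k f"
proof (cases k)
  case 0
  then show ?thesis
    using assms by (simp add: linear_continuous_on)
next
  case (Suc k)
  show ?thesis
    unfolding Suc
    by (rule k_times_cont_differentiable_SucI[where f' = "\<lambda>x. f"])
      (auto simp: k_times_cont_differentiable_const assms bounded_linear_imp_has_derivative)
qed

lemma k_times_cont_differentiable_add:
  "k_times_cont_differentiable k f \<Longrightarrow> k_times_cont_differentiable k g \<Longrightarrow>
    k_times_cont_differentiable k (\<lambda>x. f x + g x)"
proof (induction k arbitrary: f g)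
  case 0
  then show ?case
    by (auto intro: continuous_intros)
next
  case (Suc k)
  from Suc.prems(1) obtain f' where f': "\<And>x. (f has_derivative f' x) (at x)"
    "\<And>v. k_times_cont_differentiable k (\<lambda>x. f' x v)"
    using k_times_cont_differentiable_SucE by blast
  from Suc.prems(2) obtain g' where g': "\<And>x. (g has_derivative g' x) (at x)"
    "\<And>v. k_times_cont_differentiable k (\<lambda>x. g' x v)"
    using k_times_cont_differentiable_SucE by blast
  show ?case
    by (rule k_times_cont_differentiable_SucI[where f' = "\<lambda>x v. f' x v + g' x v"])
      (auto intro!: has_derivative_add f' g' Suc.IH)
qed

lemma k_times_cont_differentiable_mult:
  "k_times_cont_differentiable k f \<Longrightarrow> k_times_cont_differentiable k g \<Longrightarrow>
    k_times_cont_differentiable k (\<lambda>x. f x * g x)"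
proof (induction k arbitrary: f g)
  case 0
  then show ?case
    by (auto intro: continuous_intros)
next
  case (Suc k)
  from Suc.prems(1) obtain f' where f': "\<And>x. (f has_derivative f' x) (at x)"
    "\<And>v. k_times_cont_differentiable k (\<lambda>x. f' x v)"
    using k_times_cont_differentiable_SucE by blast
  from Suc.prems(2) obtain g' where g': "\<And>x. (g has_derivative g' x) (at x)"
    "\<And>v. k_times_cont_differentiable k (\<lambda>x. g' x v)"
    using k_times_cont_differentiable_SucE by blast
  show ?case
    by (rule k_times_cont_differentiable_SucI[where f' = "\<lambda>x v. f x * g' x v + f' x v * g x"])
      (auto intro!: has_derivative_mult f' g' Suc.IH k_times_cont_differentiable_add
        k_times_cont_differentiable_Suc_imp[OF Suc.prems(1)]
        k_times_cont_differentiable_Suc_imp[OF Suc.prems(2)])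
qed

text \<open>
  The derivative of \<open>h \<circ> f\<close> in a fixed direction is a product of a derivative of \<open>f\<close> with
  \<open>h' \<circ> f\<close>, and \<open>h'\<close> has one derivative less; so the induction runs over all pairs \<open>f\<close>, \<open>h\<close>.
\<close>

lemma k_times_cont_differentiable_compose:
  fixes h :: "real \<Rightarrow> real"
  shows "k_times_cont_differentiable k h \<Longrightarrow> k_times_cont_differentiable k f \<Longrightarrow>
    k_times_cont_differentiable k (\<lambda>x. h (f x))"
proof (induction k arbitrary: f h)
  case 0
  then show ?case
    using continuous_on_compose2[of UNIV h UNIV f] by simp
next
  case (Suc k)
  from Suc.prems(1) obtain h' where h': "\<And>x. (h has_derivative h' x) (at x)"
    "\<And>v. k_times_cont_differentiable k (\<lambda>x. h' x v)"
    using k_times_cont_differentiable_SucE by blast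
  from Suc.prems(2) obtain f' where f': "\<And>x. (f has_derivative f' x) (at x)"
    "\<And>v. k_times_cont_differentiable k (\<lambda>x. f' x v)"
    using k_times_cont_differentiable_SucE by blast
  have lin: "h' y t = t * h' y 1" for y t
    using linear_scale[OF has_derivative_linear[OF h'(1)], of y t 1] by simp
  show ?case
  proof (rule k_times_cont_differentiable_SucI[where f' = "\<lambda>x v. f' x v * h' (f x) 1"])
    fix x
    have "((\<lambda>x. h (f x)) has_derivative (\<lambda>v. h' (f x) (f' x v))) (at x)"
      using has_derivative_compose[OF f'(1) h'(1)] .
    moreover have "(\<lambda>v. h' (f x) (f' x v)) = (\<lambda>v. f' x v * h' (f x) 1)"
      using lin by (intro ext)
    ultimately show "((\<lambda>x. h (f x)) has_derivative (\<lambda>v. f' x v * h' (f x) 1)) (at x)"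
      by simp
  next
    fix v
    have "k_times_cont_differentiable k (\<lambda>x. h' (f x) 1)"
      using Suc.IH[OF h'(2) k_times_cont_differentiable_Suc_imp[OF Suc.prems(2)], of 1] .
    then show "k_times_cont_differentiable k (\<lambda>x. f' x v * h' (f x) 1)"
      by (intro k_times_cont_differentiable_mult f')
  qed
qed

lemma smooth_const: "smooth (\<lambda>x. c)"
  by (simp add: smooth_def k_times_cont_differentiable_const)

lemma smooth_linear: "bounded_linear l \<Longrightarrow> smooth l"
  by (simp add: smooth_def k_times_cont_differentiable_linear)

lemma smooth_add: "smooth f \<Longrightarrow> smooth g \<Longrightarrow> smooth (\<lambda>x. f x + g x)"
  by (simp add: smooth_def k_times_cont_differentiable_add)

lemma smooth_mult: "smooth f \<Longrightarrow> smooth g \<Longrightarrow> smooth (\<lambda>x. f x * g x)"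
  by (simp add: smooth_def k_times_cont_differentiable_mult)

lemma smooth_compose:
  fixes h :: "real \<Rightarrow> real"
  assumes "smooth h" "smooth f"
  shows "smooth (\<lambda>x. h (f x))"
  using assms k_times_cont_differentiable_compose unfolding smooth_def by blast

lemma smooth_sum:
  assumes "finite S" "\<And>i. i \<in> S \<Longrightarrow> smooth (f i)"
  shows "smooth (\<lambda>x. \<Sum>i\<in>S. f i x)"
  using assms by (induction S rule: finite_induct) (auto intro: smooth_const smooth_add)

lemma smooth_imp_continuous: "smooth f \<Longrightarrow> continuous_on UNIV f"
  using k_times_cont_differentiable_imp_continuous smooth_def by blast

lemma smooth_antiderivative:
  assumes "\<And>x. (F has_real_derivative f x) (at x)" and "smooth f"
  shows "smooth F"
  unfolding smooth_def
proof
  fix k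
  have "k_times_cont_differentiable (Suc k) F"
    by (rule k_times_cont_differentiable_SucI[where f' = "\<lambda>x v. f x * v"])
      (use assms in \<open>auto simp: has_field_derivative_def smooth_def
        intro!: k_times_cont_differentiable_mult k_times_cont_differentiable_const\<close>)
  then show "k_times_cont_differentiable k F"
    by (rule k_times_cont_differentiable_Suc_imp)
qed

lemma antiderivative_exists:
  fixes f :: "real \<Rightarrow> real"
  assumes "continuous_on UNIV f"
  obtains F where "\<And>x. (F has_real_derivative f x) (at x)" "F x0 = 0"
proof -
  obtain G where G: "\<And>x. (G has_vector_derivative f x) (at x)"
    using einterval_antiderivative[of "-\<infinity>" "\<infinity>" f] assms
    by (auto simp: continuous_on_eq_continuous_at)
  show thesis
  proof
    show "((\<lambda>x. G x - G x0) has_real_derivative f x) (at x)" for x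
      using G[of x] by (auto intro!: derivative_eq_intros simp: has_real_derivative_iff_has_vector_derivative)
  qed simp
qed

text \<open>
  The powers of \<open>x\<close> make the family closed under differentiation up to linear combinations, so that
  smoothness of the flat function \<open>exp (- 1 / x)\<close> becomes an induction.
\<close>

definition flat_exp :: "nat \<Rightarrow> real \<Rightarrow> real" where
  "flat_exp j x = (if x > 0 then exp (- 1 / x) / x ^ j else 0)"

text \<open>
  The only analytic fact behind the smoothness at \<open>0\<close>: with exponent \<open>j + 1\<close> it is the
  differentiability of the function with exponent \<open>j\<close>.
\<close>

lemma flat_exp_tendsto_0: "(flat_exp j \<longlongrightarrow> 0) (at 0)"
proof -
  have lim: "((\<lambda>y::real. y ^ j / exp y) \<longlongrightarrow> 0) at_top"
    by (rule tendsto_power_div_exp_0)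
  have "((\<lambda>x::real. (inverse x) ^ j / exp (inverse x)) \<longlongrightarrow> 0) (at_right 0)"
    using filterlim_compose[OF lim filterlim_inverse_at_top_right] .
  then have "(flat_exp j \<longlongrightarrow> 0) (at_right 0)"
  proof (rule Lim_transform_eventually)
    have "\<forall>\<^sub>F x in at_right 0. (0::real) < x"
      by (rule eventually_at_right_less)
    then show "\<forall>\<^sub>F x in at_right 0. inverse x ^ j / exp (inverse x) = flat_exp j x"
      by (rule eventually_mono) (simp add: flat_exp_def exp_minus divide_simps)
  qed
  moreover have "(flat_exp j \<longlongrightarrow> 0) (at_left 0)"
  proof (rule tendsto_eventually)
    have "\<forall>\<^sub>F x in at_left 0. x < (0::real)"
      by (simp add: eventually_at_filter)
    then show "\<forall>\<^sub>F x in at_left 0. flat_exp j x = 0"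
      by (rule eventually_mono) (simp add: flat_exp_def)
  qed
  ultimately show ?thesis
    by (simp add: filterlim_at_split)
qed

lemma flat_exp_has_derivative_pos:
  assumes "x > 0"
  shows "((\<lambda>x. exp (- 1 / x) / x ^ j) has_real_derivative flat_exp (j + 2) x - real j * flat_exp (j + 1) x) (at x)"
proof -
  have "((\<lambda>x. inverse x ^ j) has_real_derivative
      real j * (inverse x ^ (j - Suc 0) * - (inverse x ^ Suc (Suc 0)))) (at x)"
    using DERIV_power[OF DERIV_inverse[of x], of j] assms by (simp add: mult_ac)
  moreover have "real j * (inverse x ^ (j - Suc 0) * - (inverse x ^ Suc (Suc 0))) = - (real j * inverse x ^ (j + 1))"
    by (cases j) simp_all
  ultimately have 1: "((\<lambda>x. inverse x ^ j) has_real_derivative - (real j * inverse x ^ (j + 1))) (at x)"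
    by (simp only:)
  have 2: "((\<lambda>x. exp (- inverse x)) has_real_derivative exp (- inverse x) * inverse x ^ 2) (at x)"
    using assms by (auto intro!: derivative_eq_intros simp: power2_eq_square)
  have "((\<lambda>x. exp (- inverse x) * inverse x ^ j) has_real_derivative
          exp (- inverse x) * - (real j * inverse x ^ (j + 1)) +
          exp (- inverse x) * inverse x ^ 2 * inverse x ^ j) (at x)"
    by (rule DERIV_mult'[OF 2 1])
  moreover have "(\<lambda>x::real. exp (- inverse x) * inverse x ^ j) = (\<lambda>x. exp (- 1 / x) / x ^ j)"
    by (simp add: fun_eq_iff divide_inverse power_inverse)
  moreover have "exp (- inverse x) * - (real j * inverse x ^ (j + 1)) +
          exp (- inverse x) * inverse x ^ 2 * inverse x ^ j = flat_exp (j + 2) x - real j * flat_exp (j + 1) x"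
    using assms by (simp add: flat_exp_def divide_inverse power_inverse power2_eq_square)
  ultimately show ?thesis
    by (simp only:)
qed
lemma flat_exp_has_derivative:
  "(flat_exp j has_real_derivative flat_exp (j + 2) x - real j * flat_exp (j + 1) x) (at x)"
proof (cases x "0 :: real" rule: linorder_cases)
  case less
  have "((\<lambda>x. 0) has_real_derivative 0) (at x)"
    by simp
  then have "(flat_exp j has_real_derivative 0) (at x)"
    by (rule has_field_derivative_transform_within_open[where S = "{..<0}"])
      (use less in \<open>auto simp: flat_exp_def\<close>)
  then show ?thesis
    using less by (simp add: flat_exp_def)
next
  case equal
  have "((\<lambda>h. (flat_exp j (0 + h) - flat_exp j 0) / h) \<longlongrightarrow> 0) (at 0)"
    using flat_exp_tendsto_0[of "Suc j"]
  proof (rule Lim_transform_eventually)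
    show "\<forall>\<^sub>F x in at 0. flat_exp (Suc j) x = (flat_exp j (0 + x) - flat_exp j 0) / x"
      by (rule eventuallyI) (simp add: flat_exp_def)
  qed
  then show ?thesis
    using equal by (simp add: DERIV_def flat_exp_def)
next
  case greater
  show ?thesis
    by (rule has_field_derivative_transform_within_open[OF flat_exp_has_derivative_pos, where S = "{0<..}"])
      (use greater in \<open>auto simp: flat_exp_def\<close>)
qed

lemma smooth_flat_exp: "smooth (flat_exp j)"
proof -
  have "k_times_cont_differentiable k (flat_exp j)" for k
  proof (induction k arbitrary: j)
    case 0
    then show ?case
      using DERIV_isCont[OF flat_exp_has_derivative] by (simp add: continuous_at_imp_continuous_on)
  next
    case (Suc k)
    let ?f' = "\<lambda>x v. flat_exp (j + 2) x * v + flat_exp (j + 1) x * (- real j * v)"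
    have "?f' x = (*) (flat_exp (j + 2) x - real j * flat_exp (j + 1) x)" for x
      by (rule ext) (simp add: algebra_simps)
    then have der: "(flat_exp j has_derivative ?f' x) (at x)" for x
      using flat_exp_has_derivative[of j x] by (simp only: has_field_derivative_def)
    show ?case
      by (rule k_times_cont_differentiable_SucI[OF der])
        (intro k_times_cont_differentiable_add k_times_cont_differentiable_mult
            k_times_cont_differentiable_const Suc)
  qed
  then show ?thesis
    by (simp add: smooth_def)
qed

section \<open>A smooth even approximation of the absolute value\<close>

text \<open>
  Since \<open>a\<close> is equal, and not just close, to the absolute value outside \<open>(-\<epsilon>, \<epsilon>)\<close>, the smoothed
  equations of motion coincide with the piecewise linear ones except during short intervals.
\<close>

locale smoothed_abs =
  fixes a b :: "real \<Rightarrow> real" and \<epsilon> :: real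
  assumes eps_pos: "\<epsilon> > 0"
    and smooth_a: "smooth a"
    and a_deriv: "(a has_real_derivative b x) (at x)"
    and b_cont: "continuous_on UNIV b"
    and b_mono: "x \<le> y \<Longrightarrow> b x \<le> b y"
    and b_odd: "b (- x) = - b x"
    and b_one: "x \<ge> \<epsilon> \<Longrightarrow> b x = 1"
    and a_even: "a (- x) = a x"
    and a_abs: "\<bar>x\<bar> \<ge> \<epsilon> \<Longrightarrow> a x = \<bar>x\<bar>"

text \<open>
  The integral of an even bump function, scaled to run from \<open>- 1\<close> to \<open>1\<close>, is the derivative \<open>b\<close>.
  Integrating once more gives \<open>a\<close>, where the constant of integration is fixed by \<open>a \<epsilon> = \<epsilon>\<close>.
\<close>

lemma smoothed_abs_exists:
  assumes "\<epsilon> > 0"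
  obtains a b where "smoothed_abs a b \<epsilon>"
proof -
  define bump where "bump x = flat_exp 0 (1 + x) * flat_exp 0 (1 - x)" for x
  have lin: "smooth (\<lambda>x::real. 1 + x)" "smooth (\<lambda>x::real. 1 - x)"
    using smooth_add[OF smooth_const[of 1] smooth_linear[OF bounded_linear_ident]]
      smooth_add[OF smooth_const[of 1] smooth_linear[OF bounded_linear_minus[OF bounded_linear_ident]]]
    by simp_all
  have smooth_bump: "smooth bump"
    unfolding bump_def by (intro smooth_mult smooth_compose[OF smooth_flat_exp] lin)
  have bump_nonneg: "bump x \<ge> 0" for x
    by (simp add: bump_def flat_exp_def)
  have bump_even: "bump (- x) = bump x" for x
    by (simp add: bump_def mult.commute)
  have bump_0: "bump x = 0" if "x \<ge> 1" for x
    using that by (simp add: bump_def flat_exp_def)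
  have bump_pos: "bump x > 0" if "0 < x" "x < 1" for x
    using that by (simp add: bump_def flat_exp_def)
  obtain F where F: "\<And>x. (F has_real_derivative bump x) (at x)" "F 0 = 0"
    using antiderivative_exists[OF smooth_imp_continuous[OF smooth_bump]] by blast
  have smooth_F: "smooth F"
    by (rule smooth_antiderivative[OF F(1) smooth_bump])
  have F_mono: "F x \<le> F y" if "x \<le> y" for x y
    using that F(1) bump_nonneg by (intro DERIV_nonneg_imp_nondecreasing[of x y F]) blast+
  have F_odd: "F (- x) = - F x" for x
  proof -
    have "((\<lambda>x. F x + F (- x)) has_real_derivative 0) (at y)" for y
      by (auto intro!: derivative_eq_intros F(1) DERIV_chain'[where g = F] simp: bump_even)
    then have "F x + F (- x) = F 0 + F (- 0)"
      by (intro DERIV_isconst_all) auto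
    then show ?thesis
      using F(2) by simp
  qed
  have F_const: "F x = F 1" if "x \<ge> 1" for x
  proof (cases "x = 1")
    case False
    have "F x = F 1"
    proof (rule DERIV_isconst_end[of 1 x F])
      show "continuous_on {1..x} F"
        by (rule DERIV_continuous_on[OF has_field_derivative_at_within[OF F(1)]])
      show "(F has_real_derivative 0) (at y)" if "1 < y" for y
        using F(1)[of y] bump_0[of y] that by simp
    qed (use that False in simp)
    then show ?thesis .
  qed simp
  have F1: "F 1 > 0"
  proof -
    have "F 0 < F 1"
    proof (rule DERIV_pos_imp_increasing_open[of 0 1 F])
      show "\<exists>y. (F has_real_derivative y) (at x) \<and> 0 < y" if "0 < x" "x < 1" for x
        using F(1) bump_pos that by blast
      show "continuous_on {0..1} F"
        by (rule DERIV_continuous_on[OF has_field_derivative_at_within[OF F(1)]])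
    qed simp
    then show ?thesis
      using F(2) by simp
  qed
  define B where "B x = F (x / \<epsilon>) / F 1" for x
  have sm: "smooth (\<lambda>x. x / \<epsilon>)"
    using smooth_linear[OF bounded_linear_divide[of \<epsilon>]] .
  have "smooth (\<lambda>x. F (x / \<epsilon>) * (1 / F 1))"
    by (intro smooth_mult smooth_const smooth_compose[OF smooth_F sm])
  then have smooth_B: "smooth B"
    unfolding B_def by simp
  have B_mono: "B x \<le> B y" if "x \<le> y" for x y
    using that assms F1 F_mono by (simp add: B_def divide_right_mono)
  have B_odd: "B (- x) = - B x" for x
    by (simp add: B_def F_odd)
  have B_one: "B x = 1" if "x \<ge> \<epsilon>" for x
    using F_const[of "x / \<epsilon>"] that assms F1 by (simp add: B_def)
  obtain G where G: "\<And>x. (G has_real_derivative B x) (at x)" "G \<epsilon> = 0"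
    using antiderivative_exists[OF smooth_imp_continuous[OF smooth_B]] by blast
  define A where "A x = G x + \<epsilon>" for x
  have A: "(A has_real_derivative B x) (at x)" for x
    unfolding A_def by (auto intro!: derivative_eq_intros G)
  have A_even: "A (- x) = A x" for x
  proof -
    have "((\<lambda>x. A x - A (- x)) has_real_derivative 0) (at y)" for y
      by (auto intro!: derivative_eq_intros A DERIV_chain'[where g = A] simp: B_odd)
    then have "A x - A (- x) = A 0 - A (- 0)"
      by (intro DERIV_isconst_all) auto
    then show ?thesis
      by simp
  qed
  have A_id: "A x = x" if "x \<ge> \<epsilon>" for x
  proof (cases "x = \<epsilon>")
    case False
    have "A x - x = A \<epsilon> - \<epsilon>"
    proof (rule DERIV_isconst_end[of \<epsilon> x "\<lambda>x. A x - x"])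
      show "((\<lambda>x. A x - x) has_real_derivative 0) (at y)" if "\<epsilon> < y" "y < x" for y
        using that by (auto intro!: derivative_eq_intros A simp: B_one)
      show "continuous_on {\<epsilon>..x} (\<lambda>x. A x - x)"
        by (intro continuous_intros DERIV_continuous_on[OF has_field_derivative_at_within[OF A]])
    qed (use that False in simp)
    then show ?thesis
      by (simp add: A_def G)
  qed (simp add: A_def G)
  have "smoothed_abs A B \<epsilon>"
  proof
    show "smooth A"
      by (rule smooth_antiderivative[OF A smooth_B])
    show "A x = \<bar>x\<bar>" if "\<bar>x\<bar> \<ge> \<epsilon>" for x
      using A_id[of "\<bar>x\<bar>"] that A_even[of x] by (auto simp: abs_if split: if_splits)
  qed (use assms A smooth_B B_mono B_odd B_one A_even in \<open>auto intro: smooth_imp_continuous\<close>)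
  then show thesis
    by (rule that)
qed

context smoothed_abs
begin

lemma b_zero: "b 0 = 0"
  using b_odd[of 0] by simp

lemma b_minus_one: "x \<le> - \<epsilon> \<Longrightarrow> b x = - 1"
  using b_one[of "- x"] b_odd[of x] by simp

lemma b_bounds: "- 1 \<le> b x" "b x \<le> 1"
proof -
  have "b (min x (- \<epsilon>)) \<le> b x" "b x \<le> b (max x \<epsilon>)"
    by (auto intro: b_mono)
  then show "- 1 \<le> b x" "b x \<le> 1"
    using b_minus_one[of "min x (- \<epsilon>)"] b_one[of "max x \<epsilon>"] by auto
qed

lemma b_nonneg: "x \<ge> 0 \<Longrightarrow> b x \<ge> 0"
  using b_mono[of 0 x] b_zero by simp

lemma a_cont: "continuous_on S a"
  by (rule DERIV_continuous_on[OF has_field_derivative_at_within[OF a_deriv]])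

lemma a_mono: "0 \<le> x \<Longrightarrow> x \<le> y \<Longrightarrow> a x \<le> a y"
  by (rule DERIV_nonneg_imp_nondecreasing[of x y a]) (use a_deriv b_nonneg in force)+

lemma a_le_of_abs_le: "\<bar>x\<bar> \<le> y \<Longrightarrow> a x \<le> a y"
  using a_mono[of "\<bar>x\<bar>" y] a_even[of x] by (auto simp: abs_if split: if_splits)

lemma a_ge_abs: "a x \<ge> \<bar>x\<bar>"
proof (cases "\<bar>x\<bar> \<ge> \<epsilon>")
  case False
  have "a \<epsilon> - \<epsilon> \<le> a \<bar>x\<bar> - \<bar>x\<bar>"
  proof (rule DERIV_nonpos_imp_nonincreasing[of _ _ "\<lambda>x. a x - x"])
    show "\<exists>z. ((\<lambda>x. a x - x) has_real_derivative z) (at y) \<and> z \<le> 0" for y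
      by (rule exI[of _ "b y - 1"]) (auto intro!: derivative_eq_intros a_deriv simp: b_bounds)
  qed (use False in simp)
  then show ?thesis
    using a_abs[of \<epsilon>] eps_pos a_even[of x] by (auto simp: abs_if split: if_splits)
qed (simp add: a_abs)

lemma a_le: "a x \<le> \<bar>x\<bar> + \<epsilon>"
proof (cases "\<bar>x\<bar> \<ge> \<epsilon>")
  case False
  then have "a x \<le> a \<epsilon>"
    by (intro a_le_of_abs_le) simp
  then show ?thesis
    using a_abs[of \<epsilon>] eps_pos by simp
qed (use eps_pos in \<open>simp add: a_abs\<close>)

lemma a_lipschitz: "\<bar>a x - a y\<bar> \<le> \<bar>x - y\<bar>"
proof -
  have *: "\<bar>a x - a y\<bar> \<le> y - x" if xy: "x < y" for x y
  proof -
    obtain z where z: "a y - a x = (y - x) * b z"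
      using MVT2[OF xy a_deriv] by blast
    have "\<bar>a x - a y\<bar> = (y - x) * \<bar>b z\<bar>"
      using xy z by (simp add: abs_minus_commute[of "a x"] abs_mult)
    also have "\<dots> \<le> (y - x) * 1"
      using b_bounds[of z] xy by (intro mult_left_mono) auto
    finally show ?thesis
      by simp
  qed
  show ?thesis
    using *[of x y] *[of y x] by (cases x y rule: linorder_cases) auto
qed

lemma convex_a: "convex_on UNIV a"
  by (rule convex_on_realI[of UNIV a b]) (auto intro: a_deriv b_mono)

end

section \<open>Closed characteristics and the capacity\<close>

lemma linear_pair_expansion:
  fixes D :: "(real ^ 'n) \<times> (real ^ 'n) \<Rightarrow> real"
  assumes "linear D"
  shows "D z = (\<Sum>i\<in>UNIV. fst z $ i * D (axis i 1, 0) + snd z $ i * D (0, axis i 1))"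
proof -
  have "(\<Sum>i\<in>UNIV. (fst z $ i) *\<^sub>R (axis i 1 :: real ^ 'n, 0 :: real ^ 'n) + (snd z $ i) *\<^sub>R (0, axis i 1)) = z"
    by (rule prod_eqI)
      (simp_all add: fst_sum snd_sum vec_eq_iff axis_def if_distrib sum.delta cong: if_cong)
  then have "D z = D (\<Sum>i\<in>UNIV. (fst z $ i) *\<^sub>R (axis i 1 :: real ^ 'n, 0 :: real ^ 'n) + (snd z $ i) *\<^sub>R (0, axis i 1))"
    by simp
  then show ?thesis
    by (simp only: linear_sum[OF assms] linear_add[OF assms] linear_scale[OF assms] real_scaleR_def)
qed

lemma regular_sublevel_has_derivative:
  assumes "regular_sublevel H c X"
  shows "(H has_derivative frechet_derivative H (at x)) (at x)"
proof -
  have "k_times_cont_differentiable (Suc 0) H"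
    using assms by (simp only: regular_sublevel_def smooth_def)
  then show ?thesis
    by (simp add: frechet_derivative_works)
qed

lemma regular_sublevel_linear:
  "regular_sublevel H c X \<Longrightarrow> linear (frechet_derivative H (at x))"
  using regular_sublevel_has_derivative has_derivative_linear by blast

lemma symplectic_form_hamiltonian_field:
  assumes "regular_sublevel H c X"
  shows "symplectic_form (hamiltonian_field H x) w = - frechet_derivative H (at x) w"
  unfolding linear_pair_expansion[OF regular_sublevel_linear[OF assms], of x w]
  unfolding symplectic_form_def hamiltonian_field_def sum_negf[symmetric]
  by (rule sum.cong) (simp_all add: algebra_simps)

lemma symplectic_form_scaleR: "symplectic_form (r *\<^sub>R u) w = r * symplectic_form u w"
  by (simp add: symplectic_form_def sum_distrib_left algebra_simps)

lemma hamiltonian_field_in_characteristic_line: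
  assumes "regular_sublevel H c X"
  shows "r *\<^sub>R hamiltonian_field H x \<in> characteristic_line H x"
proof -
  have "frechet_derivative H (at x) (hamiltonian_field H x) = 0"
    unfolding linear_pair_expansion[OF regular_sublevel_linear[OF assms], of x "hamiltonian_field H x"]
    by (simp add: hamiltonian_field_def)
  then show ?thesis
    using linear_scale[OF regular_sublevel_linear[OF assms], of x r "hamiltonian_field H x"]
    by (simp add: characteristic_line_def level_tangent_space_def symplectic_form_scaleR
      symplectic_form_hamiltonian_field[OF assms])
qed

text \<open>
  A point of the level \<open>c\<close> in the interior of \<open>X\<close> would be a local maximum of \<open>H\<close>, where the
  derivative vanishes.
\<close>

lemma frontier_regular_sublevel:
  assumes reg: "regular_sublevel H c X"
  shows "frontier X = {x. H x = c}"
proof -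
  have cont: "continuous_on UNIV H"
    using reg by (simp add: regular_sublevel_def smooth_imp_continuous)
  have X: "X = {x. H x \<le> c}"
    using reg by (simp add: regular_sublevel_def)
  have closed: "closed X"
    unfolding X by (rule closed_Collect_le[OF cont continuous_on_const])
  have open_less: "open {x. H x < c}"
    by (rule open_Collect_less[OF cont continuous_on_const])
  have "interior X = {x. H x < c}"
  proof
    show "{x. H x < c} \<subseteq> interior X"
      by (rule interior_maximal[OF _ open_less]) (auto simp: X)
    show "interior X \<subseteq> {x. H x < c}"
    proof
      fix x assume x: "x \<in> interior X"
      show "x \<in> {x. H x < c}"
      proof (rule ccontr)
        assume "x \<notin> {x. H x < c}"
        then have Hx: "H x = c"
          using interior_subset[of X] x by (auto simp: X)
        then have "\<exists>v. frechet_derivative H (at x) v \<noteq> 0"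
          using reg by (simp add: regular_sublevel_def)
        moreover have "frechet_derivative H (at x) = (\<lambda>v. 0)"
          by (rule differential_zero_maxmin[OF x open_interior regular_sublevel_has_derivative[OF reg]])
            (use interior_subset[of X] Hx in \<open>auto simp: X\<close>)
        ultimately show False
          by simp
      qed
    qed
  qed
  then show ?thesis
    using closed by (auto simp: frontier_def X)
qed

text \<open>
  A periodic reparametrized solution of Hamilton's equations is a closed characteristic: the
  Hamiltonian field is dual to the derivative of \<open>H\<close> under the symplectic form, hence nonzero on a
  regular level and orthogonal to its tangent space.
\<close>

lemma closed_characteristicI:
  assumes reg: "regular_sublevel H c X" and T: "T > 0" and per: "\<And>t. \<gamma> (t + T) = \<gamma> t"
    and der: "\<And>t. (\<gamma> has_vector_derivative \<gamma>' t) (at t)" and cont: "continuous_on UNIV \<gamma>'"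
    and level: "\<And>t. H (\<gamma> t) = c"
    and vel: "\<And>t. \<exists>r>0. \<gamma>' t = r *\<^sub>R hamiltonian_field H (\<gamma> t)"
  shows "closed_characteristic X T \<gamma>"
proof -
  have vd: "vector_derivative \<gamma> (at t) = \<gamma>' t" for t
    using der by (rule vector_derivative_at)
  have "\<gamma>' t \<noteq> 0" for t
  proof
    assume "\<gamma>' t = 0"
    then have "hamiltonian_field H (\<gamma> t) = 0"
      using vel[of t] by auto
    then have "frechet_derivative H (at (\<gamma> t)) w = 0" for w
      using symplectic_form_hamiltonian_field[OF reg, of "\<gamma> t" w] by (simp add: symplectic_form_def)
    moreover obtain w where "frechet_derivative H (at (\<gamma> t)) w \<noteq> 0"
      using reg level[of t] unfolding regular_sublevel_def by blast
    ultimately show False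
      by blast
  qed
  moreover have "\<gamma> C1_differentiable_on UNIV"
    using der cont by (auto simp: C1_differentiable_on_def)
  moreover have "\<gamma>' t \<in> characteristic_line H (\<gamma> t)" for t
    using vel[of t] hamiltonian_field_in_characteristic_line[OF reg] by metis
  ultimately have "\<exists>H c. regular_sublevel H c X \<and>
      (\<forall>t. \<gamma>' t \<noteq> 0 \<and> \<gamma>' t \<in> characteristic_line H (\<gamma> t) \<and>
        (\<exists>r>0. \<gamma>' t = r *\<^sub>R hamiltonian_field H (\<gamma> t)))" "\<gamma> C1_differentiable_on UNIV"
    using reg vel by blast+
  then show ?thesis
    unfolding closed_characteristic_def frontier_regular_sublevel[OF reg] vd
    using T per level by simp
qed

lemma has_real_derivative_along_line:
  fixes H :: "'a::euclidean_space \<Rightarrow> real"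
  assumes der: "(H has_derivative D) (at x)"
  shows "((\<lambda>t. H (x + t *\<^sub>R v)) has_real_derivative D v) (at 0)"
proof -
  have "((\<lambda>t. H (x + t *\<^sub>R v)) has_derivative (\<lambda>t. D (t *\<^sub>R v))) (at 0)"
    by (rule has_derivative_compose[where g = H and f = "\<lambda>t. x + t *\<^sub>R v", simplified])
      (auto intro!: derivative_eq_intros der)
  moreover have "(\<lambda>t. D (t *\<^sub>R v)) = (*) (D v)"
    using linear_scale[OF has_derivative_linear[OF der]] by (auto simp: fun_eq_iff)
  ultimately show ?thesis
    by (simp add: has_field_derivative_def)
qed

lemma derivative_le_0_if_nonincreasing_direction:
  fixes H :: "'a::euclidean_space \<Rightarrow> real"
  assumes der: "(H has_derivative D) (at x)" and d: "d > 0"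
    and le: "\<And>t. 0 < t \<Longrightarrow> t < d \<Longrightarrow> H (x + t *\<^sub>R v) \<le> H x"
  shows "D v \<le> 0"
proof (rule ccontr)
  assume "\<not> D v \<le> 0"
  note has_real_derivative_along_line[OF der, of v]
  from DERIV_pos_inc_right[OF this] \<open>\<not> D v \<le> 0\<close>
  obtain e where e: "e > 0" "\<And>h. 0 < h \<Longrightarrow> h < e \<Longrightarrow> H x < H (x + h *\<^sub>R v)"
    by auto
  have "0 < min d e / 2" "min d e / 2 < d" "min d e / 2 < e"
    using d e(1) by auto
  then show False
    using e(2) le by fastforce
qed

text \<open>
  Subtracting half the differential of \<open>p \<bullet> q\<close> turns the action into half the integral of
  \<open>p \<bullet> q' - q \<bullet> p'\<close>. By Hamilton's equations this is a positive multiple of the derivative of \<open>H\<close> at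
  \<open>x\<close> in direction \<open>x\<close>, which is nonnegative because moving towards the origin does not leave \<open>X\<close>.
  Only with this lower bound does the infimum in \<open>min_action\<close> lie below each action.
\<close>

lemma action_nonneg:
  assumes cc: "closed_characteristic X T \<gamma>" and conv: "convex X" and zero: "0 \<in> X"
  shows "action T \<gamma> \<ge> 0"
proof -
  from cc obtain H c where T: "T > 0" and per: "\<And>t. \<gamma> (t + T) = \<gamma> t"
    and C1: "\<gamma> C1_differentiable_on UNIV" and fr: "\<And>t. \<gamma> t \<in> frontier X"
    and reg: "regular_sublevel H c X"
    and vel: "\<And>t. \<exists>r>0. vector_derivative \<gamma> (at t) = r *\<^sub>R hamiltonian_field H (\<gamma> t)"
    unfolding closed_characteristic_def by blast
  define \<gamma>' where "\<gamma>' t = vector_derivative \<gamma> (at t)" for t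
  have der: "(\<gamma> has_vector_derivative \<gamma>' t) (at t)" and cont': "continuous_on UNIV \<gamma>'" for t
    using C1 unfolding \<gamma>'_def C1_differentiable_on_eq
    by (auto simp: vector_derivative_works)
  have cont: "continuous_on UNIV \<gamma>"
    using der by (meson continuous_at_imp_continuous_on has_vector_derivative_continuous)
  have pos: "fst (\<gamma> t) \<bullet> snd (\<gamma>' t) - snd (\<gamma> t) \<bullet> fst (\<gamma>' t) \<ge> 0" for t
  proof -
    obtain r where r: "r > 0" "\<gamma>' t = r *\<^sub>R hamiltonian_field H (\<gamma> t)"
      using vel unfolding \<gamma>'_def by blast
    let ?D = "frechet_derivative H (at (\<gamma> t))"
    have "H (\<gamma> t) = c"
      using fr[of t] frontier_regular_sublevel[OF reg] by auto
    have "?D (- \<gamma> t) \<le> 0"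
    proof (rule derivative_le_0_if_nonincreasing_direction[OF regular_sublevel_has_derivative[OF reg]])
      fix s :: real assume s: "0 < s" "s < 1"
      have "\<gamma> t \<in> X"
        using \<open>H (\<gamma> t) = c\<close> reg by (simp add: regular_sublevel_def)
      then have "(1 - s) *\<^sub>R \<gamma> t + s *\<^sub>R 0 \<in> X"
        using s by (intro convexD[OF conv _ zero]) auto
      then have "\<gamma> t + s *\<^sub>R (- \<gamma> t) \<in> X"
        by (simp add: algebra_simps)
      then show "H (\<gamma> t + s *\<^sub>R (- \<gamma> t)) \<le> H (\<gamma> t)"
        using \<open>H (\<gamma> t) = c\<close> reg by (simp add: regular_sublevel_def)
    qed simp
    then have "?D (\<gamma> t) \<ge> 0"
      using linear_neg[OF regular_sublevel_linear[OF reg]] by simp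
    moreover have "fst (\<gamma> t) \<bullet> snd (\<gamma>' t) - snd (\<gamma> t) \<bullet> fst (\<gamma>' t) = r * ?D (\<gamma> t)"
      unfolding linear_pair_expansion[OF regular_sublevel_linear[OF reg], of "\<gamma> t" "\<gamma> t"]
      by (simp add: r inner_vec_def hamiltonian_field_def sum_distrib_left sum_negf sum.distrib algebra_simps)
    ultimately show ?thesis
      using r by simp
  qed
  have "((\<lambda>t. fst (\<gamma> t) \<bullet> snd (\<gamma>' t) + fst (\<gamma>' t) \<bullet> snd (\<gamma> t)) has_integral
      (fst (\<gamma> T) \<bullet> snd (\<gamma> T) - fst (\<gamma> 0) \<bullet> snd (\<gamma> 0))) {0..T}"
  proof (rule fundamental_theorem_of_calculus)
    fix t assume "t \<in> {0..T}"
    have "(\<gamma> has_vector_derivative \<gamma>' t) (at t within {0..T})"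
      using der by (rule has_vector_derivative_at_within)
    then have "((\<lambda>t. fst (\<gamma> t)) has_vector_derivative fst (\<gamma>' t)) (at t within {0..T})"
      "((\<lambda>t. snd (\<gamma> t)) has_vector_derivative snd (\<gamma>' t)) (at t within {0..T})"
      by (auto simp: has_vector_derivative_def intro!: derivative_eq_intros)
    from bounded_bilinear.has_vector_derivative[OF bounded_bilinear_inner this]
    show "((\<lambda>t. fst (\<gamma> t) \<bullet> snd (\<gamma> t)) has_vector_derivative
        fst (\<gamma> t) \<bullet> snd (\<gamma>' t) + fst (\<gamma>' t) \<bullet> snd (\<gamma> t)) (at t within {0..T})" .
  qed (use T in simp)
  then have 1: "((\<lambda>t. fst (\<gamma> t) \<bullet> snd (\<gamma>' t) + fst (\<gamma>' t) \<bullet> snd (\<gamma> t)) has_integral 0) {0..T}"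
    using per[of 0] by simp
  have "continuous_on {0..T} (\<lambda>t. fst (\<gamma> t) \<bullet> snd (\<gamma>' t))"
    by (intro continuous_intros continuous_on_subset[OF cont] continuous_on_subset[OF cont']) auto
  then have 2: "((\<lambda>t. fst (\<gamma> t) \<bullet> snd (\<gamma>' t)) has_integral action T \<gamma>) {0..T}"
    unfolding action_def \<gamma>'_def[symmetric] inner_vec_def
    using integrable_integral[OF integrable_continuous_real] by (simp add: inner_vec_def)
  have "((\<lambda>t. 2 * (fst (\<gamma> t) \<bullet> snd (\<gamma>' t)) - (fst (\<gamma> t) \<bullet> snd (\<gamma>' t) + fst (\<gamma>' t) \<bullet> snd (\<gamma> t))) has_integral
      2 * action T \<gamma> - 0) {0..T}"
    by (intro has_integral_diff has_integral_mult_right 1 2)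
  from has_integral_nonneg[OF this] show ?thesis
    using pos by (simp add: inner_commute)
qed

lemma min_action_bounds:
  assumes "smooth_convex_body K" "0 \<in> K" "closed_characteristic K T \<gamma>"
  shows "0 \<le> min_action K" "min_action K \<le> action T \<gamma>"
proof -
  have conv: "convex K"
    using assms(1) by (simp add: smooth_convex_body_def convex_body_def)
  let ?S = "{action T \<gamma> | T \<gamma>. closed_characteristic K T \<gamma>}"
  have ge: "0 \<le> x" if "x \<in> ?S" for x
    using that action_nonneg[OF _ conv assms(2)] by auto
  have mem: "action T \<gamma> \<in> ?S"
    using assms(3) by blast
  show "0 \<le> min_action K"
    unfolding min_action_def using ge mem by (intro cInf_greatest) auto
  show "min_action K \<le> action T \<gamma>"
    unfolding min_action_def using ge mem by (intro cInf_lower bdd_belowI[of _ 0]) auto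
qed

lemma hausdorff_distance_bounds:
  assumes "A \<noteq> {}" "B \<noteq> {}"
    and AB: "\<And>a. a \<in> A \<Longrightarrow> \<exists>b\<in>B. dist a b \<le> d"
    and BA: "\<And>b. b \<in> B \<Longrightarrow> \<exists>a\<in>A. dist b a \<le> d"
  shows "\<bar>hausdorff_distance A B\<bar> \<le> d"
proof -
  have *: "(SUP a\<in>A. infdist a B) \<le> d" "0 \<le> (SUP a\<in>A. infdist a B)"
    if ne: "A \<noteq> {}" and AB: "\<And>a. a \<in> A \<Longrightarrow> \<exists>b\<in>B. dist a b \<le> d" for A B :: "'a set"
  proof -
    have le: "infdist a B \<le> d" if "a \<in> A" for a
      using AB[OF that] infdist_le2 by blast
    show "(SUP a\<in>A. infdist a B) \<le> d"
      using ne le by (rule cSUP_least)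
    obtain a where "a \<in> A"
      using ne by blast
    then have "infdist a B \<le> (SUP a\<in>A. infdist a B)"
      using le by (intro cSUP_upper bdd_aboveI2[of _ _ d]) auto
    then show "0 \<le> (SUP a\<in>A. infdist a B)"
      using infdist_nonneg[of a B] by linarith
  qed
  show ?thesis
    unfolding hausdorff_distance_def using *[OF assms(1) AB] *[OF assms(2) BA] by auto
qed

text \<open>
  A limit along the filter of smooth neighbours of \<open>X\<close> is bounded by the values on any bodies that come
  arbitrarily close. These bodies also show that the filter is proper, so that \<open>Lim\<close> is the limit. If
  there is no limit, the capacity is \<open>0\<close> by convention and satisfies both bounds.
\<close>

lemma c_EHZ_bounds:
  fixes X :: "((real ^ 'n) \<times> (real ^ 'n)) set"
  assumes ns: "\<not> smooth_convex_body X" and B: "B \<ge> 0"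
    and approx: "\<And>\<eta>. \<eta> > 0 \<Longrightarrow> \<exists>K. smooth_convex_body K \<and> \<bar>hausdorff_distance K X\<bar> < \<eta> \<and>
      0 \<le> min_action K \<and> min_action K \<le> B + \<eta>"
  shows "0 \<le> c_EHZ X" "c_EHZ X \<le> B"
proof -
  let ?F = "smooth_bodies_near X"
  have ex: "\<exists>K. P K \<and> 0 \<le> min_action K \<and> min_action K \<le> B + \<eta>" if ev: "eventually P ?F" and "\<eta> > 0" for P \<eta>
  proof -
    from ev have "\<forall>\<^sub>F K in filtercomap (\<lambda>K. hausdorff_distance K X) (nhds 0). smooth_convex_body K \<longrightarrow> P K"
      by (simp add: smooth_bodies_near_def eventually_inf_principal)
    then obtain Q where Q: "eventually Q (nhds 0)" "\<And>K. Q (hausdorff_distance K X) \<Longrightarrow> smooth_convex_body K \<Longrightarrow> P K"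
      unfolding eventually_filtercomap by blast
    from Q(1) obtain d where d: "d > 0" "\<And>x. dist x 0 < d \<Longrightarrow> Q x"
      unfolding eventually_nhds_metric by blast
    from approx[of "min d \<eta>"] d(1) \<open>\<eta> > 0\<close> obtain K where
      "smooth_convex_body K" "\<bar>hausdorff_distance K X\<bar> < min d \<eta>" "0 \<le> min_action K" "min_action K \<le> B + min d \<eta>"
      by auto
    then show ?thesis
      using Q(2)[OF d(2)] by (intro exI[of _ K]) auto
  qed
  have nonbot: "?F \<noteq> bot"
    using ex[of "\<lambda>_. False" 1] by auto
  have "0 \<le> c_EHZ X \<and> c_EHZ X \<le> B"
  proof (cases "\<exists>l. (min_action \<longlongrightarrow> l) ?F")
    case True
    then obtain l where l: "(min_action \<longlongrightarrow> l) ?F" ..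
    then have c: "c_EHZ X = l"
      using ns tendsto_Lim[OF nonbot l] by (auto simp: c_EHZ_def)
    have "0 \<le> l"
    proof (rule ccontr)
      assume "\<not> 0 \<le> l"
      then have "\<forall>\<^sub>F K in ?F. min_action K < 0"
        using l by (intro order_tendstoD) auto
      then show False
        using ex[of _ 1] by fastforce
    qed
    moreover have "l \<le> B"
    proof (rule ccontr)
      assume "\<not> l \<le> B"
      then have "\<forall>\<^sub>F K in ?F. min_action K > (l + B) / 2"
        using l by (intro order_tendstoD) auto
      from ex[OF this, of "(l - B) / 2"] show False
        using \<open>\<not> l \<le> B\<close> by (auto simp: field_simps)
    qed
    ultimately show ?thesis
      by (simp add: c)
  next
    case False
    then show ?thesis
      using ns B by (simp add: c_EHZ_def)
  qed
  then show "0 \<le> c_EHZ X" "c_EHZ X \<le> B"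
    by auto
qed

section \<open>The volume\<close>

lemma emeasure_lborel_scaled_sublevel:
  fixes N :: "'a::euclidean_space \<Rightarrow> real"
  assumes hom: "\<And>r x. r > 0 \<Longrightarrow> N (r *\<^sub>R x) = r * N x"
    and meas: "N \<in> borel_measurable borel" and r: "r > 0"
  shows "emeasure lborel {x. N x \<le> r} = ennreal (r ^ DIM('a)) * emeasure lborel {x. N x \<le> 1}"
proof -
  have [measurable]: "N \<in> borel_measurable borel" by fact
  have "emeasure lborel {x. N x \<le> r} =
     emeasure (density (distr lborel borel (\<lambda>x. 0 + r *\<^sub>R x)) (\<lambda>_. \<bar>r\<bar> ^ DIM('a))) {x. N x \<le> r}"
    using lborel_affine[of r "0::'a"] r by simp
  also have "\<dots> = ennreal (r ^ DIM('a)) * emeasure lborel ((\<lambda>x. r *\<^sub>R x) -` {x. N x \<le> r})"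
    using r by (simp add: emeasure_density nn_integral_cmult emeasure_distr)
  also have "(\<lambda>x. r *\<^sub>R x) -` {x. N x \<le> r} = {x. N x \<le> 1}"
    using r hom by auto
  finally show ?thesis .
qed

text \<open>
  Layer cake: \<open>exp (- N\<^sup>k)\<close> is the integral of \<open>exp (- t)\<close> over \<open>t \<ge> N\<^sup>k\<close>, and \<open>{N\<^sup>k \<le> t}\<close> is the unit
  ball of \<open>N\<close> scaled by \<open>t\<^sup>1\<^sup>/\<^sup>k\<close>. Such integrals factor when \<open>N\<^sup>k\<close> is a sum over independent
  variables, which makes the volumes below computable without slicing.
\<close>

lemma nn_integral_exp_powr_homogeneous:
  fixes N :: "'a::euclidean_space \<Rightarrow> real"
  assumes hom: "\<And>r x. r > 0 \<Longrightarrow> N (r *\<^sub>R x) = r * N x"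
    and meas: "N \<in> borel_measurable borel" and nonneg: "\<And>x. N x \<ge> 0" and k: "k > 0"
  shows "(\<integral>\<^sup>+x. ennreal (exp (- (N x ^ k))) \<partial>lborel) =
    emeasure lborel {x. N x \<le> 1} * ennreal (Gamma (real DIM('a) / real k + 1))"
proof -
  have [measurable]: "N \<in> borel_measurable borel" by fact
  define d where "d = DIM('a)"
  have tail: "ennreal (exp (- y)) = (\<integral>\<^sup>+t. ennreal (exp (- t)) * indicator {y..} t \<partial>lborel)" for y :: real
  proof -
    have "(\<integral>\<^sup>+t. ennreal (exp (- t)) * indicator {y..} t \<partial>lborel) = ennreal (0 - (- exp (- y)))"
    proof (rule nn_integral_FTC_atLeast)
      have "((\<lambda>t::real. exp (- t)) \<longlongrightarrow> 0) at_top"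
        by (rule filterlim_compose[OF exp_at_bot filterlim_uminus_at_bot_at_top])
      from tendsto_minus[OF this] show "((\<lambda>t. - exp (- t)) \<longlongrightarrow> (0::real)) at_top"
        by simp
    qed (auto intro!: derivative_eq_intros)
    then show ?thesis
      by simp
  qed
  have "(\<integral>\<^sup>+x. ennreal (exp (- (N x ^ k))) \<partial>lborel) =
      (\<integral>\<^sup>+x. (\<integral>\<^sup>+t. ennreal (exp (- t)) * indicator {N x ^ k..} t \<partial>lborel) \<partial>lborel)"
    by (intro nn_integral_cong tail)
  also have "\<dots> = (\<integral>\<^sup>+t. (\<integral>\<^sup>+x. ennreal (exp (- t)) * indicator {x. N x ^ k \<le> t} x \<partial>lborel) \<partial>lborel)"
  proof -
    let ?f = "\<lambda>(x :: 'a) t. ennreal (exp (- t)) * indicator {z. N (fst z) ^ k \<le> snd z} (x, t)"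
    have "case_prod ?f \<in> borel_measurable (lborel \<Otimes>\<^sub>M lborel)"
      unfolding case_prod_beta by measurable
    from lborel_pair.Fubini'[OF this] show ?thesis
      by (simp add: indicator_def)
  qed
  also have "\<dots> = (\<integral>\<^sup>+t. emeasure lborel {x. N x \<le> 1} *
      (ennreal (indicator {0..} t * t powr (real d / real k + 1 - 1) / exp t)) \<partial>lborel)"
  proof (rule nn_integral_cong_AE)
    \<comment> \<open>At \<open>t = 0\<close> the sublevel set is the zero set of \<open>N\<close>, which is not a scaled unit ball.\<close>
    have "AE t in lborel. t \<noteq> (0::real)"
      by (rule AE_lborel_singleton)
    then show "AE t in lborel. (\<integral>\<^sup>+x. ennreal (exp (- t)) * indicator {x. N x ^ k \<le> t} x \<partial>lborel) =
      emeasure lborel {x. N x \<le> 1} * (ennreal (indicator {0..} t * t powr (real d / real k + 1 - 1) / exp t))"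
    proof eventually_elim
      case (elim t)
      show ?case
      proof (cases "t > 0")
        case True
        have root: "{x. N x ^ k \<le> t} = {x. N x \<le> t powr (1 / real k)}"
        proof -
          have "N x ^ k \<le> t \<longleftrightarrow> N x \<le> t powr (1 / real k)" for x
          proof -
            have "t = (t powr (1 / real k)) ^ k"
              using True k by (simp add: powr_power)
            then have "N x ^ k \<le> t \<longleftrightarrow> N x ^ k \<le> (t powr (1 / real k)) ^ k"
              by simp
            also have "\<dots> \<longleftrightarrow> N x \<le> t powr (1 / real k)"
              using k nonneg[of x] by (simp add: power_mono_iff)
            finally show ?thesis .
          qed
          then show ?thesis by auto
        qed
        have "(t powr (1 / real k)) ^ d = t powr (real d / real k)"
          using True k by (simp add: powr_power)
        then have "emeasure lborel {x. N x ^ k \<le> t} = ennreal (t powr (real d / real k)) * emeasure lborel {x. N x \<le> 1}"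
          unfolding root using emeasure_lborel_scaled_sublevel[OF hom meas, of "t powr (1 / real k)"] True
          by (simp add: d_def)
        moreover have powr_eq: "ennreal (exp (- t)) * (ennreal (t powr (real d / real k)) * e) =
            e * ennreal (t powr (real d / real k) / exp t)" for e :: ennreal
        proof -
          have "ennreal (t powr (real d / real k) / exp t) = ennreal (exp (- t)) * ennreal (t powr (real d / real k))"
            by (simp add: exp_minus divide_inverse mult.commute flip: ennreal_mult')
          then show ?thesis
            by (simp add: mult_ac)
        qed
        moreover have "(\<integral>\<^sup>+x. ennreal (exp (- t)) * indicator {x. N x ^ k \<le> t} x \<partial>lborel) =
            ennreal (exp (- t)) * emeasure lborel {x. N x ^ k \<le> t}"
          by (rule nn_integral_cmult_indicator) measurable
        ultimately show ?thesis
          using True powr_eq by simp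
      next
        case False
        have "t < N x ^ k" for x
          using False elim zero_le_power[OF nonneg, of x k] by linarith
        then have "{x. N x ^ k \<le> t} = {}"
          by (simp add: not_le)
        then show ?thesis
          using False elim by simp
      qed
    qed
  qed
  also have "\<dots> = emeasure lborel {x. N x \<le> 1} * ennreal (Gamma (real d / real k + 1))"
  proof (subst nn_integral_cmult)
    have "real d / real k + 1 > 0"
      using k by (simp add: add_nonneg_pos)
    from Gamma_conv_nn_integral_real[OF this]
    show "emeasure lborel {x. N x \<le> 1} *
        (\<integral>\<^sup>+t. ennreal (indicator {0..} t * t powr (real d / real k + 1 - 1) / exp t) \<partial>lborel) =
        emeasure lborel {x. N x \<le> 1} * ennreal (Gamma (real d / real k + 1))"
      by simp
  qed measurable
  finally show ?thesis
    by (simp add: d_def)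
qed


lemma norm_1_nonneg: "norm_1 p \<ge> 0"
  by (simp add: norm_1_def sum_nonneg)

lemma norm_1_scaleR: "r > 0 \<Longrightarrow> norm_1 (r *\<^sub>R p) = r * norm_1 p"
  by (simp add: norm_1_def abs_mult sum_distrib_left)

lemma continuous_on_norm_1: "continuous_on S norm_1"
  unfolding norm_1_def by (intro continuous_intros)

lemma norm_inf_le_iff: "norm_inf q \<le> r \<longleftrightarrow> (\<forall>i. \<bar>q $ i\<bar> \<le> r)"
  by (auto simp: norm_inf_def)

lemma abs_le_norm_inf: "\<bar>q $ i\<bar> \<le> norm_inf q"
  using norm_inf_le_iff by blast

lemma norm_inf_attained: "\<exists>i. norm_inf q = \<bar>q $ i\<bar>"
proof -
  have "Max (range (\<lambda>i. \<bar>q $ i\<bar>)) \<in> range (\<lambda>i. \<bar>q $ i\<bar>)"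
    by (rule Max_in) auto
  then show ?thesis
    by (simp add: norm_inf_def image_iff)
qed

lemma norm_inf_nonneg: "norm_inf q \<ge> 0"
  using norm_inf_attained[of q] by auto

lemma norm_inf_scaleR:
  assumes "r > 0"
  shows "norm_inf (r *\<^sub>R q) = r * norm_inf q"
proof (rule antisym)
  show "norm_inf (r *\<^sub>R q) \<le> r * norm_inf q"
    using assms by (auto simp: norm_inf_le_iff abs_mult abs_le_norm_inf)
  obtain i where "norm_inf q = \<bar>q $ i\<bar>"
    using norm_inf_attained by blast
  then show "r * norm_inf q \<le> norm_inf (r *\<^sub>R q)"
    using abs_le_norm_inf[of "r *\<^sub>R q" i] assms by (simp add: abs_mult)
qed

lemma borel_measurable_norm_1: "norm_1 \<in> borel_measurable borel"
  by (rule borel_measurable_continuous_onI[OF continuous_on_norm_1])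

lemma borel_measurable_norm_inf: "norm_inf \<in> borel_measurable borel"
proof (rule borel_measurable_iff_le[THEN iffD2], rule allI)
  fix r
  have "closed {q :: real ^ 'n. \<forall>i. \<bar>q $ i\<bar> \<le> r}"
    by (intro closed_Collect_all closed_Collect_le continuous_intros)
  then show "{w \<in> space borel. norm_inf w \<le> r} \<in> sets borel"
    by (simp add: norm_inf_le_iff)
qed

text \<open>
  The case \<open>k = 1\<close>: \<open>exp (- \<parallel>p\<parallel>\<^sub>1)\<close> is a product of functions of one variable, each of integral \<open>2\<close>.
\<close>

lemma emeasure_norm_1_ball:
  "emeasure lborel {p :: real ^ 'n. norm_1 p \<le> 1} * ennreal (fact CARD('n)) = 2 ^ CARD('n)"
proof -
  have "(\<integral>\<^sup>+x. ennreal (exp (- (\<bar>x\<bar> ^ 1))) \<partial>lborel) = emeasure lborel {x::real. \<bar>x\<bar> \<le> 1} * ennreal (Gamma 2)"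
    using nn_integral_exp_powr_homogeneous[of "abs :: real \<Rightarrow> real" 1] by (simp add: abs_mult)
  also have "{x::real. \<bar>x\<bar> \<le> 1} = cbox (- 1) 1"
    by (auto simp: abs_le_iff)
  also have "Gamma (2 :: real) = 1"
    using Gamma_fact[of 1, where 'a = real] by simp
  finally have one: "(\<integral>\<^sup>+x. ennreal (exp (- \<bar>x :: real\<bar>)) \<partial>lborel) = 2"
    by simp
  have prod: "ennreal (exp (- (norm_1 p ^ 1))) = (\<Prod>b\<in>Basis. ennreal (exp (- \<bar>p \<bullet> b\<bar>)))" for p :: "real ^ 'n"
  proof -
    have "norm_1 p = (\<Sum>b\<in>Basis. \<bar>p \<bullet> b\<bar>)"
      by (simp add: norm_1_def Basis_vec_def inner_axis sum.UNION_disjoint axis_eq_axis)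
    then show ?thesis
      by (simp add: exp_sum sum_negf[symmetric] prod_ennreal)
  qed
  have "(\<integral>\<^sup>+p. ennreal (exp (- (norm_1 p ^ 1))) \<partial>(lborel :: (real ^ 'n) measure)) = 2 ^ CARD('n)"
    unfolding prod by (subst nn_integral_lborel_prod) (simp_all add: one)
  moreover have "(\<integral>\<^sup>+p. ennreal (exp (- (norm_1 p ^ 1))) \<partial>(lborel :: (real ^ 'n) measure)) =
      emeasure lborel {p :: real ^ 'n. norm_1 p \<le> 1} * ennreal (Gamma (real DIM(real ^ 'n) / real 1 + 1))"
    by (rule nn_integral_exp_powr_homogeneous) (simp_all add: norm_1_scaleR norm_1_nonneg borel_measurable_norm_1)
  moreover have "Gamma (real DIM(real ^ 'n) / real 1 + 1) = fact CARD('n)"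
    using Gamma_fact[of "CARD('n)", where 'a = real] by (simp add: add.commute)
  ultimately show ?thesis
    by simp
qed

lemma emeasure_norm_inf_ball: "emeasure lborel {q :: real ^ 'n. norm_inf q \<le> 1} = 2 ^ CARD('n)"
proof -
  have "{q :: real ^ 'n. norm_inf q \<le> 1} = cbox (\<chi> i. - 1) (\<chi> i. 1)"
    by (auto simp: norm_inf_le_iff mem_box_cart abs_le_iff minus_le_iff)
  moreover have "emeasure lborel (cbox (\<chi> i. - 1) (\<chi> i. 1) :: (real ^ 'n) set) = 2 ^ CARD('n)"
  proof -
    have "((\<chi> i. 1) - (\<chi> i. - 1) :: real ^ 'n) \<bullet> b = 2" "(\<chi> i. - 1 :: real ^ 'n) \<bullet> b \<le> (\<chi> i. 1) \<bullet> b"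
      if "b \<in> Basis" for b
      using that by (auto simp: Basis_vec_def inner_axis)
    then show ?thesis
      by (simp add: emeasure_lborel_cbox_eq flip: ennreal_power)
  qed
  ultimately show ?thesis
    by simp
qed

text \<open>
  The case \<open>k = 2\<close>, used for \<open>p\<close>, for \<open>q\<close> and for the pair. The set is the unit ball of the gauge
  \<open>N\<close>, and \<open>\<Gamma>(n + 1) = n!\<close> appears since the pair has dimension \<open>2n\<close>.
\<close>

lemma emeasure_square_sum_ball:
  "emeasure lborel {(p :: real ^ 'n, q :: real ^ 'n). (norm_1 p)\<^sup>2 + (norm_inf q)\<^sup>2 \<le> 1} =
    ennreal (4 ^ CARD('n) * (Gamma (real CARD('n) / 2 + 1))\<^sup>2 / (fact CARD('n))\<^sup>2)"
proof -
  define N where "N z = sqrt ((norm_1 (fst z))\<^sup>2 + (norm_inf (snd z))\<^sup>2)" for z :: "(real ^ 'n) \<times> (real ^ 'n)"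
  define G where "G = Gamma (real CARD('n) / 2 + 1)"
  define V where "V = emeasure lborel {z. N z \<le> 1}"
  have G: "G > 0"
    unfolding G_def by (rule Gamma_real_pos) (simp add: add_nonneg_pos)
  note [measurable] = borel_measurable_norm_1 borel_measurable_norm_inf
  have N_meas: "N \<in> borel_measurable borel"
    unfolding N_def borel_prod[symmetric] by measurable
  have N_hom: "N (r *\<^sub>R z) = r * N z" if "r > 0" for r z
  proof -
    have "N (r *\<^sub>R z) = sqrt (r\<^sup>2 * ((norm_1 (fst z))\<^sup>2 + (norm_inf (snd z))\<^sup>2))"
      using that by (simp add: N_def norm_1_scaleR norm_inf_scaleR power_mult_distrib distrib_left)
    then show ?thesis
      using that by (simp add: N_def real_sqrt_mult)
  qed
  have "V * ennreal (fact CARD('n)) = (\<integral>\<^sup>+z. ennreal (exp (- ((N z)\<^sup>2))) \<partial>lborel)"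
  proof -
    have "Gamma (real DIM((real ^ 'n) \<times> (real ^ 'n)) / real 2 + 1) = fact CARD('n)"
      using Gamma_fact[of "CARD('n)", where 'a = real] by (simp add: add.commute)
    then show ?thesis
      using nn_integral_exp_powr_homogeneous[OF N_hom N_meas, of 2] unfolding V_def
      by (simp add: N_def)
  qed
  also have "\<dots> = (\<integral>\<^sup>+z. ennreal (exp (- ((norm_1 (fst z :: real ^ 'n))\<^sup>2))) * ennreal (exp (- ((norm_inf (snd z :: real ^ 'n))\<^sup>2))) \<partial>(lborel \<Otimes>\<^sub>M lborel))"
    by (simp add: lborel_prod N_def exp_diff exp_minus divide_inverse flip: ennreal_mult')
  also have "\<dots> = (\<integral>\<^sup>+p. \<integral>\<^sup>+q. ennreal (exp (- ((norm_1 (p :: real ^ 'n))\<^sup>2))) * ennreal (exp (- ((norm_inf (q :: real ^ 'n))\<^sup>2))) \<partial>lborel \<partial>lborel)"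
    by (subst lborel.nn_integral_fst[symmetric]) simp_all
  also have "\<dots> = (\<integral>\<^sup>+p. ennreal (exp (- ((norm_1 (p :: real ^ 'n))\<^sup>2))) \<partial>lborel) *
      (\<integral>\<^sup>+q. ennreal (exp (- ((norm_inf (q :: real ^ 'n))\<^sup>2))) \<partial>lborel)"
    by (simp add: nn_integral_cmult nn_integral_multc)
  also have "(\<integral>\<^sup>+p. ennreal (exp (- ((norm_1 (p :: real ^ 'n))\<^sup>2))) \<partial>lborel) =
      emeasure lborel {p :: real ^ 'n. norm_1 p \<le> 1} * ennreal G"
    using nn_integral_exp_powr_homogeneous[of "norm_1 :: real ^ 'n \<Rightarrow> real" 2]
    by (simp add: G_def norm_1_scaleR borel_measurable_norm_1 norm_1_nonneg)
  also have "(\<integral>\<^sup>+q. ennreal (exp (- ((norm_inf (q :: real ^ 'n))\<^sup>2))) \<partial>lborel) = 2 ^ CARD('n) * ennreal G"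
    using nn_integral_exp_powr_homogeneous[of "norm_inf :: real ^ 'n \<Rightarrow> real" 2]
    by (simp add: norm_inf_scaleR borel_measurable_norm_inf norm_inf_nonneg G_def emeasure_norm_inf_ball)
  finally have *: "V * ennreal (fact CARD('n)) =
      emeasure lborel {p :: real ^ 'n. norm_1 p \<le> 1} * ennreal G * (2 ^ CARD('n) * ennreal G)" .
  then have "V * ennreal (fact CARD('n)) * ennreal (fact CARD('n)) =
      emeasure lborel {p :: real ^ 'n. norm_1 p \<le> 1} * ennreal (fact CARD('n)) * ennreal G * (2 ^ CARD('n) * ennreal G)"
    by (simp add: mult_ac)
  also have "\<dots> = 2 ^ CARD('n) * 2 ^ CARD('n) * (ennreal G * ennreal G)"
    by (simp only: emeasure_norm_1_ball) (simp only: mult_ac)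
  also have "\<dots> = ennreal (4 ^ CARD('n) * G\<^sup>2)"
  proof -
    have "(2 :: ennreal) ^ CARD('n) = ennreal (2 ^ CARD('n))"
      by (simp flip: ennreal_power)
    moreover have "(2 :: real) ^ CARD('n) * 2 ^ CARD('n) = 4 ^ CARD('n)"
      by (simp flip: power_mult_distrib)
    ultimately show ?thesis
      using G by (simp add: power2_eq_square flip: ennreal_mult')
  qed
  finally have **: "V * ennreal (fact CARD('n)) * ennreal (fact CARD('n)) = ennreal (4 ^ CARD('n) * G\<^sup>2)" .
  have "V = ennreal (4 ^ CARD('n) * G\<^sup>2) / ennreal ((fact CARD('n))\<^sup>2)"
  proof -
    have "V * ennreal ((fact CARD('n))\<^sup>2) = ennreal (4 ^ CARD('n) * G\<^sup>2)"
      using ** by (simp add: power2_eq_square ennreal_mult' mult.assoc)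
    then show ?thesis
      by (metis ennreal_mult_divide_eq ennreal_neq_top ennreal_eq_0_iff fact_nonzero power_eq_0_iff
          zero_le_power2 order_antisym)
  qed
  also have "\<dots> = ennreal (4 ^ CARD('n) * G\<^sup>2 / (fact CARD('n))\<^sup>2)"
    by (rule divide_ennreal) auto
  finally have "V = ennreal (4 ^ CARD('n) * G\<^sup>2 / (fact CARD('n))\<^sup>2)" .
  moreover have "{(p :: real ^ 'n, q :: real ^ 'n). (norm_1 p)\<^sup>2 + (norm_inf q)\<^sup>2 \<le> 1} = {z. N z \<le> 1}"
    by (auto simp: N_def)
  ultimately show ?thesis
    by (simp add: V_def G_def)
qed

text \<open>
  There is equality for \<open>n = 2\<close>. From \<open>n\<close> to \<open>n + 2\<close> the left side is multiplied by
  \<open>(n + 1) (n + 2)\<close> and the right side by \<open>(n + 2)\<^sup>2\<close>.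
\<close>

lemma Gamma_square_bound:
  assumes "n \<ge> 2"
  shows "2 * fact n \<le> 2 ^ n * (Gamma (real n / 2 + 1))\<^sup>2"
  using assms
proof (induction n rule: less_induct)
  case (less n)
  consider "n = 2" | "n = 3" | "n \<ge> 4"
    using less.prems by linarith
  then show ?case
  proof cases
    case 1
    then show ?thesis
      using Gamma_fact[of 1, where 'a = real] by (simp add: fact_numeral)
  next
    case 2
    have "(3 / 2 :: real) \<notin> \<int>\<^sub>\<le>\<^sub>0" "(1 / 2 :: real) \<notin> \<int>\<^sub>\<le>\<^sub>0"
      by (auto dest: nonpos_Ints_nonpos)
    then have "Gamma (real 3 / 2 + 1) = 3 / 2 * (1 / 2 * sqrt pi)"
      using Gamma_plus1[of "3 / 2 :: real"] Gamma_plus1[of "1 / 2 :: real"]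
      by (simp add: Gamma_one_half_real)
    then have "(Gamma (real n / 2 + 1))\<^sup>2 = (3 / 2 * (1 / 2 * sqrt pi))\<^sup>2"
      using 2 by simp
    then have "(Gamma (real n / 2 + 1))\<^sup>2 = 9 / 16 * pi"
      by (simp add: power_mult_distrib power_divide)
    then show ?thesis
      using pi_gt3 2 by (simp add: fact_numeral)
  next
    case 3
    define m where "m = n - 2"
    have n: "n = m + 2" and m: "m \<ge> 2"
      using 3 by (auto simp: m_def)
    have "real m / 2 + 1 \<notin> \<int>\<^sub>\<le>\<^sub>0"
      by (auto dest: nonpos_Ints_nonpos)
    then have "Gamma (real n / 2 + 1) = (real m / 2 + 1) * Gamma (real m / 2 + 1)"
      using Gamma_plus1[of "real m / 2 + 1"] by (simp add: n add_divide_distrib algebra_simps)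
    then have "Gamma (real n / 2 + 1) = (real m + 2) / 2 * Gamma (real m / 2 + 1)"
      by (simp add: add_divide_distrib)
    then have "2 ^ n * (Gamma (real n / 2 + 1))\<^sup>2 =
        2 ^ n * ((real m + 2) / 2 * Gamma (real m / 2 + 1))\<^sup>2"
      by (rule arg_cong)
    also have "\<dots> = (real m + 2)\<^sup>2 * (2 ^ m * (Gamma (real m / 2 + 1))\<^sup>2)"
      unfolding power_mult_distrib power_divide n by simp
    finally have eq: "2 ^ n * (Gamma (real n / 2 + 1))\<^sup>2 = (real m + 2)\<^sup>2 * (2 ^ m * (Gamma (real m / 2 + 1))\<^sup>2)" .
    have "2 * fact n = (real m + 2) * (real m + 1) * (2 * fact m)"
      by (simp add: n algebra_simps)
    also have "\<dots> \<le> (real m + 2)\<^sup>2 * (2 * fact m)"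
      by (simp add: power2_eq_square)
    also have "\<dots> \<le> (real m + 2)\<^sup>2 * (2 ^ m * (Gamma (real m / 2 + 1))\<^sup>2)"
      using less.IH[of m] m n by (intro mult_left_mono) auto
    finally show ?thesis
      using eq by simp
  qed
qed

section \<open>The corner, the disc, and neighbouring bodies\<close>

lemma two_coordinates_le_norm_1: "i \<noteq> j \<Longrightarrow> \<bar>p $ i\<bar> + \<bar>p $ j\<bar> \<le> norm_1 p"
  using sum_mono2[of UNIV "{i, j}" "\<lambda>k. \<bar>p $ k\<bar>"] by (simp add: norm_1_def)

lemma coordinate_le_norm_1: "\<bar>p $ i\<bar> \<le> norm_1 p"
  using member_le_sum[of i UNIV "\<lambda>k. \<bar>p $ k\<bar>"] by (simp add: norm_1_def)

text \<open>
  The body has a corner at \<open>p = e\<^sub>i\<close>, \<open>q = 0\<close>. Every direction without \<open>p\<^sub>i\<close>-component leaves \<open>X\<close> both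
  forwards and backwards, so a defining function has derivative \<open>0\<close> in it. The directions \<open>e\<^sub>i\<close> and
  \<open>2 e\<^sub>j - e\<^sub>i\<close> leave \<open>X\<close> as well, which forces the remaining partial derivative to vanish.
\<close>

lemma square_sum_ball_not_smooth:
  fixes X :: "((real ^ 'n) \<times> (real ^ 'n)) set"
  assumes card: "CARD('n) \<ge> 2" and X: "X = {(p, q). (norm_1 p)\<^sup>2 + (norm_inf q)\<^sup>2 \<le> 1}"
  shows "\<not> smooth_convex_body X"
proof
  assume "smooth_convex_body X"
  then obtain H c where reg: "regular_sublevel H c X"
    by (auto simp: smooth_convex_body_def)
  have "\<exists>i j :: 'n. i \<noteq> j"
  proof (rule ccontr)
    assume "\<nexists>i j :: 'n. i \<noteq> j"
    then have "CARD('n) = card {undefined :: 'n}"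
      by (intro arg_cong[where f = card]) auto
    then show False
      using card by simp
  qed
  then obtain i j :: 'n where ij: "i \<noteq> j"
    by blast
  define x :: "(real ^ 'n) \<times> (real ^ 'n)" where "x = (axis i 1, 0)"
  define D where "D = frechet_derivative H (at x)"
  have D: "(H has_derivative D) (at x)"
    unfolding D_def by (rule regular_sublevel_has_derivative[OF reg])
  note lin = has_derivative_linear[OF D]
  have XH: "z \<in> X \<longleftrightarrow> H z \<le> c" for z
    using reg by (auto simp: regular_sublevel_def)
  have norm_1_x: "norm_1 (axis i 1 :: real ^ 'n) = 1"
    by (simp add: norm_1_def axis_def if_distrib cong: if_cong)
  have "norm_inf (0 :: real ^ 'n) = 0"
    using norm_inf_attained[of "0 :: real ^ 'n"] by auto
  then have "x \<in> X"
    by (simp add: X x_def norm_1_x)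
  then have Hx: "H x \<le> c"
    by (simp add: XH)
  have ge: "D w \<ge> 0" if out: "\<And>t. 0 < t \<Longrightarrow> t < 1 \<Longrightarrow> x + t *\<^sub>R w \<notin> X" for w
  proof -
    have "((\<lambda>z. - H z) has_derivative (\<lambda>v. - D v)) (at x)"
      using D by (rule has_derivative_minus)
    then have "- D w \<le> 0"
    proof (rule derivative_le_0_if_nonincreasing_direction[where d = 1])
      fix t :: real assume "0 < t" "t < 1"
      then have "\<not> H (x + t *\<^sub>R w) \<le> c"
        using out XH by blast
      then show "- H (x + t *\<^sub>R w) \<le> - H x"
        using Hx by linarith
    qed simp
    then show ?thesis
      by simp
  qed
  have outside: "z \<notin> X" if "norm_1 (fst z) \<ge> 1" "norm_1 (fst z) > 1 \<or> norm_inf (snd z) > 0" for z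
  proof -
    have "1 < (norm_1 (fst z))\<^sup>2 + (norm_inf (snd z))\<^sup>2"
      using that(2)
    proof
      assume "norm_1 (fst z) > 1"
      then have "1 < (norm_1 (fst z))\<^sup>2"
        by (simp add: one_less_power)
      then show ?thesis
        using zero_le_power2[of "norm_inf (snd z)"] by linarith
    next
      assume "norm_inf (snd z) > 0"
      then have "(norm_inf (snd z))\<^sup>2 > 0"
        by simp
      moreover have "(norm_1 (fst z))\<^sup>2 \<ge> 1"
        using that(1) by (simp add: one_le_power)
      ultimately show ?thesis
        by linarith
    qed
    then show ?thesis
      by (simp add: X case_prod_beta)
  qed
  have perp: "D w \<ge> 0" if w: "fst w $ i = 0" for w
  proof (cases "w = 0")
    case False
    show ?thesis
    proof (rule ge)
      fix t :: real assume t: "0 < t" "t < 1"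
      let ?z = "x + t *\<^sub>R w"
      have zi: "fst ?z $ i = 1"
        using w by (simp add: x_def)
      show "?z \<notin> X"
      proof (rule outside)
        show "norm_1 (fst ?z) \<ge> 1"
          using coordinate_le_norm_1[of "fst ?z" i] zi by simp
        show "norm_1 (fst ?z) > 1 \<or> norm_inf (snd ?z) > 0"
        proof (cases "snd w = 0")
          case True
          then obtain k where k: "fst w $ k \<noteq> 0"
            using False by (metis prod_eq_iff vec_eq_iff zero_index zero_prod_def fst_zero snd_zero)
          then have "k \<noteq> i"
            using w by auto
          then have "fst ?z $ k = t * fst w $ k"
            by (simp add: x_def axis_def)
          moreover have "\<bar>t * fst w $ k\<bar> > 0"
            using k t by simp
          moreover have "\<bar>fst ?z $ i\<bar> + \<bar>fst ?z $ k\<bar> \<le> norm_1 (fst ?z)"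
            using \<open>k \<noteq> i\<close> by (intro two_coordinates_le_norm_1) auto
          ultimately have "norm_1 (fst ?z) > 1"
            unfolding zi by linarith
          then show ?thesis ..
        next
          case False
          then obtain k where k: "snd w $ k \<noteq> 0"
            by (metis vec_eq_iff zero_index)
          have "snd ?z $ k = t * snd w $ k"
            by (simp add: x_def)
          moreover have "\<bar>t * snd w $ k\<bar> > 0"
            using k t by simp
          ultimately have "norm_inf (snd ?z) > 0"
            using abs_le_norm_inf[of "snd ?z" k] by linarith
          then show ?thesis ..
        qed
      qed
    qed
  qed (use lin in \<open>simp add: linear_0\<close>)
  have perp0: "D w = 0" if "fst w $ i = 0" for w
    using perp[of w] perp[of "- w"] that linear_neg[OF lin, of w] by simp
  define e f :: "(real ^ 'n) \<times> (real ^ 'n)" where "e = (axis i 1, 0)" and "f = (axis j 1, 0)"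
  have "D e \<ge> 0"
  proof (rule ge)
    fix t :: real assume t: "0 < t" "t < 1"
    show "x + t *\<^sub>R e \<notin> X"
      using coordinate_le_norm_1[of "fst (x + t *\<^sub>R e)" i] t
      by (intro outside) (auto simp: x_def e_def)
  qed
  moreover have "D (- e + 2 *\<^sub>R f) \<ge> 0"
  proof (rule ge)
    fix t :: real assume t: "0 < t" "t < 1"
    show "x + t *\<^sub>R (- e + 2 *\<^sub>R f) \<notin> X"
      using two_coordinates_le_norm_1[OF ij, of "fst (x + t *\<^sub>R (- e + 2 *\<^sub>R f))"] t ij
      by (intro outside) (auto simp: x_def e_def f_def axis_def)
  qed
  moreover have "D f = 0"
    using ij by (intro perp0) (simp add: f_def axis_def)
  moreover have "D (- e + 2 *\<^sub>R f) = - D e + 2 * D f"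
    using lin by (simp only: linear_add linear_neg linear_scale real_scaleR_def)
  ultimately have "D e = 0"
    by simp
  have "D w = 0" for w
  proof -
    have "D (w - (fst w $ i) *\<^sub>R e) = 0"
      by (rule perp0) (simp add: e_def)
    moreover have "D (w - (fst w $ i) *\<^sub>R e) = D w - (fst w $ i) * D e"
      using lin by (simp only: linear_diff linear_scale real_scaleR_def)
    ultimately show ?thesis
      using \<open>D e = 0\<close> by simp
  qed
  moreover have "H x = c"
  proof (rule antisym[OF Hx])
    have "((\<lambda>t. H (x + t *\<^sub>R e)) \<longlongrightarrow> H (x + 0 *\<^sub>R e)) (at_right 0)"
    proof (rule isCont_tendsto_compose[where g = H])
      show "isCont H (x + 0 *\<^sub>R e)"
        using smooth_imp_continuous[of H] reg continuous_on_eq_continuous_at[OF open_UNIV, of H]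
        unfolding regular_sublevel_def by blast
    qed (auto intro!: tendsto_eq_intros)
    then have "((\<lambda>t. H (x + t *\<^sub>R e)) \<longlongrightarrow> H x) (at_right 0)"
      by simp
    then show "c \<le> H x"
    proof (rule tendsto_lowerbound)
      have "\<forall>\<^sub>F t in at_right 0. (0 :: real) < t"
        by (rule eventually_at_right_less)
      then show "\<forall>\<^sub>F t in at_right 0. c \<le> H (x + t *\<^sub>R e)"
      proof (rule eventually_mono)
        fix t :: real assume "0 < t"
        then have "x + t *\<^sub>R e \<notin> X"
          using coordinate_le_norm_1[of "fst (x + t *\<^sub>R e)" i]
          by (intro outside) (auto simp: x_def e_def)
        then show "c \<le> H (x + t *\<^sub>R e)"
          by (simp add: XH)
      qed
    qed simp
  qed
  ultimately show False
    using reg unfolding D_def regular_sublevel_def by blast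
qed

text \<open>
  With one degree of freedom \<open>X\<close> is the unit disc, and its boundary circle is a closed
  characteristic of action \<open>\<pi>\<close>.
\<close>

lemma c_EHZ_square_sum_ball_dim_1:
  fixes X :: "((real ^ 'n) \<times> (real ^ 'n)) set"
  assumes card: "CARD('n) = 1" and X: "X = {(p, q). (norm_1 p)\<^sup>2 + (norm_inf q)\<^sup>2 \<le> 1}"
  shows "c_EHZ X \<le> pi"
proof -
  obtain i :: 'n where UNIV: "UNIV = {i}"
    using card by (metis card_1_singletonE)
  then have all: "k = i" for k
    by auto
  define H :: "(real ^ 'n) \<times> (real ^ 'n) \<Rightarrow> real" where "H z = z \<bullet> z" for z
  have X_eq: "X = cball 0 1"
  proof -
    have "norm_inf q = \<bar>q $ i\<bar>" for q :: "real ^ 'n"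
      by (simp add: norm_inf_def UNIV)
    then have "(norm_1 p)\<^sup>2 + (norm_inf q)\<^sup>2 = (norm (p, q))\<^sup>2" for p q :: "real ^ 'n"
      by (simp add: norm_1_def UNIV norm_prod_def norm_vec_def L2_set_def)
    then show ?thesis
      unfolding X by (auto simp: abs_square_le_1)
  qed
  have smooth_H: "smooth H"
  proof -
    have "H = (\<lambda>z. \<Sum>b\<in>Basis. (z \<bullet> b) * (z \<bullet> b))"
      unfolding H_def by (rule ext) (rule euclidean_inner)
    moreover have "smooth (\<lambda>z. \<Sum>b\<in>Basis. (z \<bullet> b) * (z \<bullet> b))"
      by (rule smooth_sum) (simp_all add: smooth_mult smooth_linear bounded_linear_inner_left)
    ultimately show ?thesis
      by (simp only:)
  qed
  have der: "frechet_derivative H (at z) v = 2 * (z \<bullet> v)" for z v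
  proof -
    have "(H has_derivative (\<lambda>v. 2 * (z \<bullet> v))) (at z)"
      unfolding H_def by (auto intro!: derivative_eq_intros simp: inner_commute)
    from frechet_derivative_at[OF this] show ?thesis
      by metis
  qed
  have reg: "regular_sublevel H 1 X"
    unfolding regular_sublevel_def
  proof (intro conjI allI impI)
    show "X = {z. H z \<le> 1}"
      unfolding X_eq H_def by (auto simp: norm_le_square)
    show "\<exists>v. frechet_derivative H (at z) v \<noteq> 0" if "H z = 1" for z
      using that by (intro exI[of _ z]) (simp add: der H_def)
  qed (rule smooth_H)
  have body: "smooth_convex_body X"
    using reg by (auto simp: smooth_convex_body_def convex_body_def X_eq)
  define \<gamma> :: "real \<Rightarrow> (real ^ 'n) \<times> (real ^ 'n)" where
    "\<gamma> t = (cos t *\<^sub>R axis i 1, sin t *\<^sub>R axis i 1)" for t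
  define \<gamma>' :: "real \<Rightarrow> (real ^ 'n) \<times> (real ^ 'n)" where
    "\<gamma>' t = ((- sin t) *\<^sub>R axis i 1, cos t *\<^sub>R axis i 1)" for t
  have vel: "(\<gamma> has_vector_derivative \<gamma>' t) (at t)" for t
    unfolding \<gamma>_def \<gamma>'_def
    by (intro has_vector_derivative_Pair has_vector_derivative_scaleR[where g = "\<lambda>_. axis i 1", THEN has_vector_derivative_eq_rhs]
        has_vector_derivative_const) (auto intro!: derivative_eq_intros)
  have "closed_characteristic X (2 * pi) \<gamma>"
  proof (rule closed_characteristicI[OF reg _ _ vel])
    show "\<gamma> (t + 2 * pi) = \<gamma> t" for t
      by (simp add: \<gamma>_def)
    show "continuous_on UNIV \<gamma>'"
      unfolding \<gamma>'_def by (intro continuous_intros)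
    show "H (\<gamma> t) = 1" for t
      by (simp add: H_def \<gamma>_def inner_axis_axis flip: power2_eq_square)
    show "\<exists>r>0. \<gamma>' t = r *\<^sub>R hamiltonian_field H (\<gamma> t)" for t
      by (intro exI[of _ "1 / 2"])
        (auto simp: hamiltonian_field_def der \<gamma>_def \<gamma>'_def inner_axis vec_eq_iff)
  qed simp
  from min_action_bounds(2)[OF body _ this] have "c_EHZ X \<le> action (2 * pi) \<gamma>"
    using body by (simp add: c_EHZ_def X_eq)
  also have "action (2 * pi) \<gamma> = integral {0..2 * pi} (\<lambda>t. cos t * cos t)"
    unfolding action_def vector_derivative_at[OF vel] by (simp add: UNIV \<gamma>_def \<gamma>'_def axis_def)
  also have "\<dots> = pi"
  proof (rule integral_unique)
    have "((\<lambda>t. cos t * cos t) has_integral ((2 * pi + sin (2 * pi) * cos (2 * pi)) / 2 - (0 + sin 0 * cos 0) / 2)) {0..2 * pi}"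
    proof (rule fundamental_theorem_of_calculus)
      fix t :: real
      have "1 + (cos t * cos t - sin t * sin t) = 2 * (cos t * cos t)"
        using sin_cos_squared_add[of t] by (simp add: power2_eq_square)
      then show "((\<lambda>t. (t + sin t * cos t) / 2) has_vector_derivative cos t * cos t) (at t within {0..2 * pi})"
        unfolding has_real_derivative_iff_has_vector_derivative[symmetric]
        by (auto intro!: derivative_eq_intros)
    qed simp
    then show "((\<lambda>t. cos t * cos t) has_integral pi) {0..2 * pi}"
      by simp
  qed
  finally show ?thesis .
qed

text \<open>
  The gauge \<open>N\<close> of \<open>X\<close> and the function \<open>N'\<close> that defines \<open>K\<close> differ by at most \<open>\<delta>\<close>, because they are
  Euclidean norms of nearby pairs. Hence \<open>K\<close> shrunk by \<open>1 / (1 + \<delta>)\<close> lies in \<open>X\<close>, and \<open>X\<close> shrunk by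
  \<open>1 - \<delta>\<close> lies in \<open>K\<close>; the points involved have norm at most \<open>(n + 1) N\<close>.
\<close>

lemma hausdorff_distance_square_sum_balls:
  fixes A M :: "real ^ 'n \<Rightarrow> real"
  assumes X: "X = {(p, q). (norm_1 p)\<^sup>2 + (norm_inf q)\<^sup>2 \<le> 1}"
    and K: "K = {(p, q). (A p)\<^sup>2 + (M q)\<^sup>2 \<le> 1}"
    and A: "\<And>p. \<bar>A p - norm_1 p\<bar> \<le> \<delta>1" and M: "\<And>q. \<bar>M q - norm_inf q\<bar> \<le> \<delta>2"
    and \<delta>: "\<delta>1 + \<delta>2 \<le> \<delta>" "\<delta> < 1"
  shows "\<bar>hausdorff_distance K X\<bar> \<le> \<delta> * (real CARD('n) + 1)"
proof -
  define N where "N z = norm (norm_1 (fst z), norm_inf (snd z))" for z :: "(real ^ 'n) \<times> (real ^ 'n)"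
  define N' where "N' z = norm (A (fst z), M (snd z))" for z
  have X_N: "z \<in> X \<longleftrightarrow> N z \<le> 1" for z
    by (simp add: X N_def norm_prod_def case_prod_beta)
  have K_N: "z \<in> K \<longleftrightarrow> N' z \<le> 1" for z
    by (simp add: K N'_def norm_prod_def case_prod_beta)
  have close: "\<bar>N' z - N z\<bar> \<le> \<delta>" for z
  proof -
    have "\<bar>N' z - N z\<bar> \<le> norm ((A (fst z), M (snd z)) - (norm_1 (fst z), norm_inf (snd z)))"
      unfolding N_def N'_def by (rule norm_triangle_ineq3)
    also have "\<dots> \<le> \<bar>A (fst z) - norm_1 (fst z)\<bar> + \<bar>M (snd z) - norm_inf (snd z)\<bar>"
      using norm_Pair_le[of "A (fst z) - norm_1 (fst z)" "M (snd z) - norm_inf (snd z)"] by simp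
    finally show ?thesis
      using A[of "fst z"] M[of "snd z"] \<delta> by linarith
  qed
  have \<delta>0: "\<delta> \<ge> 0"
    using close[of undefined] by linarith
  have hom: "N (r *\<^sub>R z) = r * N z" if "r > 0" for r z
  proof -
    have "(norm_1 (fst (r *\<^sub>R z)), norm_inf (snd (r *\<^sub>R z))) = r *\<^sub>R (norm_1 (fst z), norm_inf (snd z))"
      using that by (simp add: norm_1_scaleR norm_inf_scaleR)
    then show ?thesis
      using that unfolding N_def by (simp only: norm_scaleR abs_of_pos)
  qed
  have norm_le: "norm z \<le> (real CARD('n) + 1) * N z" for z
  proof -
    have "norm z \<le> norm (fst z) + norm (snd z)"
      using norm_Pair_le[of "fst z" "snd z"] by simp
    also have "norm (fst z) \<le> norm_1 (fst z)"
      unfolding norm_1_def by (rule norm_le_l1_cart)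
    also have "norm (snd z) \<le> (\<Sum>i\<in>UNIV. \<bar>snd z $ i\<bar>)"
      by (rule norm_le_l1_cart)
    also have "\<dots> \<le> (\<Sum>i\<in>(UNIV :: 'n set). norm_inf (snd z))"
      by (intro sum_mono abs_le_norm_inf)
    also have "\<dots> = real CARD('n) * norm_inf (snd z)"
      by simp
    also have "norm_1 (fst z) \<le> N z"
      unfolding N_def using norm_fst_le[of "norm_1 (fst z)" "norm_inf (snd z)"] by simp
    also have "real CARD('n) * norm_inf (snd z) \<le> real CARD('n) * N z"
      unfolding N_def using norm_snd_le[of "norm_inf (snd z)" "norm_1 (fst z)"] by (intro mult_left_mono) simp_all
    finally show ?thesis
      by (simp add: algebra_simps)
  qed
  have N0: "N 0 = 0"
    using norm_inf_attained[of "0 :: real ^ 'n"] by (auto simp: N_def norm_1_def)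
  then have "0 \<in> X"
    by (simp add: X_N)
  moreover have "0 \<in> K"
    using close[of 0] \<delta> N0 by (simp add: K_N)
  ultimately have ne: "K \<noteq> {}" "X \<noteq> {}"
    by auto
  show ?thesis
  proof (rule hausdorff_distance_bounds[OF ne])
    fix z assume z: "z \<in> K"
    then have Nz: "N z \<le> 1 + \<delta>"
      using close[of z] by (simp add: K_N)
    let ?y = "(1 / (1 + \<delta>)) *\<^sub>R z"
    have Ny: "N ?y \<le> 1"
    proof -
      have "N ?y = N z / (1 + \<delta>)"
        using \<delta>0 hom[of "1 / (1 + \<delta>)" z] by simp
      then show ?thesis
        using Nz \<delta>0 by (simp add: divide_le_eq)
    qed
    have "z - ?y = (\<delta> / (1 + \<delta>)) *\<^sub>R z"
    proof -
      have "z - ?y = (1 - 1 / (1 + \<delta>)) *\<^sub>R z"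
        by (simp add: scaleR_left_diff_distrib)
      also have "1 - 1 / (1 + \<delta>) = \<delta> / (1 + \<delta>)"
        using \<delta>0 by (simp add: field_simps)
      finally show ?thesis .
    qed
    then have "dist z ?y = \<delta> / (1 + \<delta>) * norm z"
      using \<delta>0 by (simp add: dist_norm)
    also have "\<dots> \<le> \<delta> / (1 + \<delta>) * ((real CARD('n) + 1) * (1 + \<delta>))"
      using \<delta>0 Nz norm_le[of z] by (intro mult_left_mono order_trans[OF norm_le]) simp_all
    also have "\<dots> = \<delta> * (real CARD('n) + 1)"
      using \<delta>0 by (simp add: divide_simps)
    finally show "\<exists>y\<in>X. dist z y \<le> \<delta> * (real CARD('n) + 1)"
      using Ny by (intro bexI[of _ ?y]) (auto simp: X_N)
  next
    fix z assume "z \<in> X"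
    then have Nz: "N z \<le> 1"
      by (simp add: X_N)
    let ?y = "(1 - \<delta>) *\<^sub>R z"
    have "(1 - \<delta>) * N z \<le> 1 - \<delta>"
      using mult_left_mono[OF Nz, of "1 - \<delta>"] \<delta> by simp
    moreover have "N ?y = (1 - \<delta>) * N z"
      using hom[of "1 - \<delta>" z] \<delta> by simp
    ultimately have "N' ?y \<le> 1"
      using close[of ?y] by linarith
    moreover have "dist z ?y = \<delta> * norm z"
      using \<delta>0 by (simp add: dist_norm algebra_simps)
    moreover have "\<delta> * norm z \<le> \<delta> * (real CARD('n) + 1)"
      using \<delta>0 Nz norm_le[of z] by (intro mult_left_mono order_trans[OF norm_le]) (simp_all add: mult_left_le)
    ultimately show "\<exists>y\<in>K. dist z y \<le> \<delta> * (real CARD('n) + 1)"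
      by (intro bexI[of _ ?y]) (auto simp: K_N)
  qed
qed

section \<open>A smooth maximum of the coordinates\<close>

context smoothed_abs
begin

text \<open>
  The formula \<open>(x + y + |x - y|) / 2\<close> for the maximum, with the absolute value smoothed.
\<close>

definition smooth_max :: "real \<Rightarrow> real \<Rightarrow> real" where
  "smooth_max x y = (x + y + a (x - y)) / 2"

lemma smooth_max_commute: "smooth_max x y = smooth_max y x"
  using a_even[of "x - y"] by (simp add: smooth_max_def)

lemma smooth_max_ge: "x \<le> smooth_max x y" "y \<le> smooth_max x y"
  using a_ge_abs[of "x - y"] by (auto simp: smooth_max_def)

lemma smooth_max_le: "x \<le> c \<Longrightarrow> y \<le> c \<Longrightarrow> smooth_max x y \<le> c + \<epsilon> / 2"
  using a_le[of "x - y"] by (auto simp: smooth_max_def field_simps abs_if split: if_splits)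

lemma smooth_max_eq: "y + \<epsilon> \<le> x \<Longrightarrow> smooth_max x y = x"
  using a_abs[of "x - y"] eps_pos by (simp add: smooth_max_def)

lemma smooth_max_mono: "x \<le> x' \<Longrightarrow> y \<le> y' \<Longrightarrow> smooth_max x y \<le> smooth_max x' y'"
  using a_lipschitz[of "x - y" "x' - y'"] by (simp add: smooth_max_def abs_if split: if_splits)

lemma smooth_max_convex:
  assumes "u \<ge> 0" "v \<ge> 0" "u + v = 1"
  shows "smooth_max (u * x + v * x') (u * y + v * y') \<le> u * smooth_max x y + v * smooth_max x' y'"
proof -
  have "a (u * (x - y) + v * (x' - y')) \<le> u * a (x - y) + v * a (x' - y')"
    using convex_a assms unfolding convex_on_def by simp
  moreover have "u * (x - y) + v * (x' - y') = (u * x + v * x') - (u * y + v * y')"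
    by (simp add: algebra_simps)
  moreover have "u * smooth_max x y + v * smooth_max x' y' =
      (u * x + v * x' + (u * y + v * y') + (u * a (x - y) + v * a (x' - y'))) / 2"
    by (simp add: smooth_max_def field_simps)
  ultimately show ?thesis
    by (simp add: smooth_max_def)
qed

lemma a_compose_has_derivative:
  assumes "(f has_derivative f') (at x)"
  shows "((\<lambda>x. a (f x)) has_derivative (\<lambda>v. b (f x) * f' v)) (at x)"
  using has_derivative_compose[OF assms a_deriv[unfolded has_field_derivative_def]] .

lemma smooth_max_has_derivative:
  assumes "(f has_derivative f') (at x)" "(g has_derivative g') (at x)"
  shows "((\<lambda>x. smooth_max (f x) (g x)) has_derivative
    (\<lambda>v. (1 + b (f x - g x)) / 2 * f' v + (1 - b (f x - g x)) / 2 * g' v)) (at x)"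
proof -
  have "((\<lambda>x. a (f x - g x)) has_derivative (\<lambda>v. b (f x - g x) * (f' v - g' v))) (at x)"
    by (rule a_compose_has_derivative[OF has_derivative_diff[OF assms]])
  then have "((\<lambda>x. (f x + g x + a (f x - g x)) * (1 / 2)) has_derivative
      (\<lambda>v. (f' v + g' v + b (f x - g x) * (f' v - g' v)) * (1 / 2))) (at x)"
    by (intro has_derivative_mult_left has_derivative_add assms)
  then have "((\<lambda>x. (f x + g x + a (f x - g x)) / 2) has_derivative
      (\<lambda>v. (f' v + g' v + b (f x - g x) * (f' v - g' v)) * (1 / 2))) (at x)"
    by simp
  then show ?thesis
    unfolding smooth_max_def by (rule has_derivative_eq_rhs) (auto simp: fun_eq_iff field_simps)
qed

text \<open>
  The shift \<open>\<beta>\<close> of all coordinates is the free constant that will make the orbit close up. The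
  recursion starts from \<open>0\<close> so that the result is nonnegative, which makes its square convex.
\<close>

primrec smooth_Max :: "real \<Rightarrow> 'n list \<Rightarrow> real ^ 'n \<Rightarrow> real" where
  "smooth_Max \<beta> [] q = 0"
| "smooth_Max \<beta> (i # L) q = smooth_max (a (q $ i) + \<beta>) (smooth_Max \<beta> L q)"

lemma smooth_Max_nonneg: "smooth_Max \<beta> L q \<ge> 0"
  by (induction L) (auto intro: order_trans[OF _ smooth_max_ge(2)])

lemma smooth_Max_ge: "i \<in> set L \<Longrightarrow> a (q $ i) + \<beta> \<le> smooth_Max \<beta> L q"
  by (induction L) (auto intro: smooth_max_ge order_trans[OF _ smooth_max_ge(2)])

lemma smooth_Max_le:
  assumes "\<And>i. i \<in> set L \<Longrightarrow> a (q $ i) + \<beta> \<le> c" "c \<ge> 0"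
  shows "smooth_Max \<beta> L q \<le> c + real (length L) * (\<epsilon> / 2)"
  using assms(1)
proof (induction L)
  case Nil
  then show ?case
    using assms(2) by simp
next
  case (Cons i L)
  have "a (q $ i) + \<beta> \<le> c + real (length L) * (\<epsilon> / 2)"
    using Cons.prems[of i] eps_pos by (intro add_increasing2) simp_all
  moreover have "smooth_Max \<beta> L q \<le> c + real (length L) * (\<epsilon> / 2)"
    using Cons by simp
  ultimately have "smooth_Max \<beta> (i # L) q \<le> c + real (length L) * (\<epsilon> / 2) + \<epsilon> / 2"
    by (simp add: smooth_max_le)
  also have "\<dots> = c + real (length (i # L)) * (\<epsilon> / 2)"
    by (simp add: distrib_right add_divide_distrib)
  finally show ?case .
qed

lemma smooth_Max_convex:
  assumes uv: "u \<ge> 0" "v \<ge> 0" "u + v = 1"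
  shows "smooth_Max \<beta> L (u *\<^sub>R q + v *\<^sub>R q') \<le> u * smooth_Max \<beta> L q + v * smooth_Max \<beta> L q'"
proof (induction L)
  case (Cons i L)
  have "a (u * q $ i + v * q' $ i) \<le> u * a (q $ i) + v * a (q' $ i)"
    using convex_a assms unfolding convex_on_def by simp
  moreover have "\<beta> = u * \<beta> + v * \<beta>"
    using uv(3) by (metis distrib_right mult_1)
  ultimately have "a (u * q $ i + v * q' $ i) + \<beta> \<le> u * (a (q $ i) + \<beta>) + v * (a (q' $ i) + \<beta>)"
    by (simp add: distrib_left)
  then have "smooth_Max \<beta> (i # L) (u *\<^sub>R q + v *\<^sub>R q') \<le>
      smooth_max (u * (a (q $ i) + \<beta>) + v * (a (q' $ i) + \<beta>)) (u * smooth_Max \<beta> L q + v * smooth_Max \<beta> L q')"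
    using Cons by (simp add: smooth_max_mono)
  also have "\<dots> \<le> u * smooth_Max \<beta> (i # L) q + v * smooth_Max \<beta> (i # L) q'"
    using smooth_max_convex[OF uv] by simp
  finally show ?case .
qed simp

lemma smooth_smooth_max: "smooth f \<Longrightarrow> smooth g \<Longrightarrow> smooth (\<lambda>x. smooth_max (f x) (g x))"
proof -
  assume fg: "smooth f" "smooth g"
  have "smooth (\<lambda>x. f x + (- 1) * g x)"
    by (intro smooth_add smooth_mult smooth_const fg)
  then have "smooth (\<lambda>x. f x - g x)"
    by simp
  then have "smooth (\<lambda>x. (1 / 2) * (f x + g x + a (f x - g x)))"
    by (intro smooth_add smooth_mult smooth_const fg smooth_compose[OF smooth_a])
  then show ?thesis
    by (simp add: smooth_max_def)
qed

lemma smooth_smooth_Max: "smooth (\<lambda>z :: (real ^ 'n) \<times> (real ^ 'n). smooth_Max \<beta> L (snd z))"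
proof (induction L)
  case (Cons i L)
  have "smooth (\<lambda>z :: (real ^ 'n) \<times> (real ^ 'n). snd z $ i)"
    by (intro smooth_linear bounded_linear_compose[OF bounded_linear_vec_nth bounded_linear_snd])
  then show ?case
    by (simp, intro smooth_smooth_max smooth_add smooth_const smooth_compose[OF smooth_a] Cons)
qed (simp add: smooth_const)

lemma a_coord_has_derivative:
  "((\<lambda>q :: real ^ 'n. a (q $ i) + \<beta>) has_derivative (\<lambda>v. b (q $ i) * v $ i)) (at q)"
proof -
  have "((\<lambda>q :: real ^ 'n. a (q $ i)) has_derivative (\<lambda>v. b (q $ i) * v $ i)) (at q)"
    by (rule a_compose_has_derivative[OF bounded_linear_imp_has_derivative[OF bounded_linear_vec_nth]])
  from has_derivative_add[OF this has_derivative_const[of \<beta>]] show ?thesis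
    by simp
qed

lemma smooth_Max_Cons_has_derivative:
  assumes "(smooth_Max \<beta> L has_derivative D) (at q)"
  shows "(smooth_Max \<beta> (i # L) has_derivative
    (\<lambda>v. (1 + b (a (q $ i) + \<beta> - smooth_Max \<beta> L q)) / 2 * (b (q $ i) * v $ i) +
      (1 - b (a (q $ i) + \<beta> - smooth_Max \<beta> L q)) / 2 * D v)) (at q)"
proof -
  have "smooth_Max \<beta> (i # L) = (\<lambda>q. smooth_max (a (q $ i) + \<beta>) (smooth_Max \<beta> L q))"
    by (rule ext) simp
  then show ?thesis
    using smooth_max_has_derivative[OF a_coord_has_derivative assms] by simp
qed

lemma smooth_Max_differentiable: "\<exists>D. (smooth_Max \<beta> L has_derivative D) (at q)"
proof (induction L)
  case (Cons i L)
  then obtain D where D: "(smooth_Max \<beta> L has_derivative D) (at q)"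
    by blast
  show ?case
    using smooth_Max_Cons_has_derivative[OF D] by blast
next
  case Nil
  have "smooth_Max \<beta> [] = (\<lambda>q. 0)"
    by (rule ext) simp
  then show ?case
    by (intro exI[of _ "\<lambda>v. 0"]) simp
qed

text \<open>
  Each step of the recursion can exceed the maximum by \<open>\<epsilon> / 2\<close>. With a gap larger than the sum of
  these errors the leading coordinate meets only much smaller values and is returned unchanged.
\<close>

lemma smooth_Max_dominated:
  assumes i: "i \<in> set L" and dist: "distinct L"
    and gap: "\<And>l. l \<in> set L \<Longrightarrow> l \<noteq> i \<Longrightarrow> a (q $ l) + \<beta> + g \<le> a (q $ i) + \<beta>" "g \<le> a (q $ i) + \<beta>"
    and g: "real (length L) * (\<epsilon> / 2) + \<epsilon> \<le> g"
  shows "smooth_Max \<beta> L q = a (q $ i) + \<beta> \<and>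
    (smooth_Max \<beta> L has_derivative (\<lambda>v. b (q $ i) * v $ i)) (at q)"
  using i dist gap(1) g
proof (induction L)
  case (Cons l L)
  have "real (length (l # L)) * (\<epsilon> / 2) = real (length L) * (\<epsilon> / 2) + \<epsilon> / 2"
    by (simp add: distrib_right add_divide_distrib)
  then have len: "real (length L) * (\<epsilon> / 2) + \<epsilon> / 2 + \<epsilon> \<le> g"
    using Cons.prems(4) by linarith
  show ?case
  proof (cases "l = i")
    case True
    obtain D where D: "(smooth_Max \<beta> L has_derivative D) (at q)"
      using smooth_Max_differentiable by blast
    have "smooth_Max \<beta> L q \<le> (a (q $ i) + \<beta> - g) + real (length L) * (\<epsilon> / 2)"
      using Cons.prems(2,3) gap(2) True by (intro smooth_Max_le) fastforce+
    then have far: "smooth_Max \<beta> L q + \<epsilon> \<le> a (q $ i) + \<beta>"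
      using len eps_pos by linarith
    have "smooth_Max \<beta> (l # L) q = a (q $ i) + \<beta>"
      using smooth_max_eq[OF far] True by simp
    moreover have "b (a (q $ i) + \<beta> - smooth_Max \<beta> L q) = 1"
      using far by (intro b_one) simp
    then have "(smooth_Max \<beta> (l # L) has_derivative (\<lambda>v. b (q $ i) * v $ i)) (at q)"
      using smooth_Max_Cons_has_derivative[OF D, of l] True by simp
    ultimately show ?thesis ..
  next
    case False
    have IH: "smooth_Max \<beta> L q = a (q $ i) + \<beta>"
      "(smooth_Max \<beta> L has_derivative (\<lambda>v. b (q $ i) * v $ i)) (at q)"
      using Cons.IH Cons.prems False len eps_pos by auto
    have "0 \<le> real (length L) * (\<epsilon> / 2)"
      using eps_pos by simp
    moreover have "a (q $ l) + \<beta> + g \<le> a (q $ i) + \<beta>"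
      using Cons.prems(3)[of l] False by simp
    ultimately have far: "a (q $ l) + \<beta> + \<epsilon> \<le> a (q $ i) + \<beta>"
      using len eps_pos by linarith
    have "smooth_Max \<beta> (l # L) q = a (q $ i) + \<beta>"
      using smooth_max_eq[OF far] IH(1) by (simp add: smooth_max_commute)
    moreover have "b (a (q $ l) + \<beta> - smooth_Max \<beta> L q) = - 1"
      using far IH(1) by (intro b_minus_one) simp
    then have "(smooth_Max \<beta> (l # L) has_derivative (\<lambda>v. b (q $ i) * v $ i)) (at q)"
      using smooth_Max_Cons_has_derivative[OF IH(2), of l] by simp
    ultimately show ?thesis ..
  qed
qed simp

text \<open>
  Although \<open>smooth_max\<close> is not associative, the order of the list does not matter here: the two leading
  coordinates meet in a single step, and all other steps return the larger argument.
\<close>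

lemma smooth_Max_two_dominating:
  assumes ij: "i \<in> set L" "j \<in> set L" "i \<noteq> j" and dist: "distinct L"
    and gap_i: "\<And>l. l \<in> set L \<Longrightarrow> l \<noteq> i \<Longrightarrow> l \<noteq> j \<Longrightarrow> a (q $ l) + \<beta> + g \<le> a (q $ i) + \<beta>" "g \<le> a (q $ i) + \<beta>"
    and gap_j: "\<And>l. l \<in> set L \<Longrightarrow> l \<noteq> i \<Longrightarrow> l \<noteq> j \<Longrightarrow> a (q $ l) + \<beta> + g \<le> a (q $ j) + \<beta>" "g \<le> a (q $ j) + \<beta>"
    and g: "real (length L) * (\<epsilon> / 2) + \<epsilon> \<le> g"
  shows "smooth_Max \<beta> L q = smooth_max (a (q $ i) + \<beta>) (a (q $ j) + \<beta>) \<and>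
    (smooth_Max \<beta> L has_derivative (\<lambda>v. (1 + b (a (q $ i) - a (q $ j))) / 2 * (b (q $ i) * v $ i) +
      (1 - b (a (q $ i) - a (q $ j))) / 2 * (b (q $ j) * v $ j))) (at q)"
  using ij(1,2) dist gap_i(1) gap_j(1) g
proof (induction L)
  case (Cons l L)
  have "0 \<le> real (length L) * (\<epsilon> / 2)"
    using eps_pos by simp
  have "real (length (l # L)) * (\<epsilon> / 2) = real (length L) * (\<epsilon> / 2) + \<epsilon> / 2"
    by (simp add: distrib_right add_divide_distrib)
  then have len: "real (length L) * (\<epsilon> / 2) + \<epsilon> / 2 + \<epsilon> \<le> g"
    using Cons.prems(6) by linarith
  consider "l = i" | "l = j" | "l \<noteq> i" "l \<noteq> j"
    by blast
  then show ?case
  proof cases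
    case 1
    have j: "smooth_Max \<beta> L q = a (q $ j) + \<beta> \<and>
        (smooth_Max \<beta> L has_derivative (\<lambda>v. b (q $ j) * v $ j)) (at q)"
      by (rule smooth_Max_dominated[where g = g])
        (use Cons.prems 1 gap_j(2) ij(3) len eps_pos in auto)
    have "(smooth_Max \<beta> (l # L) has_derivative (\<lambda>v. (1 + b (a (q $ i) - a (q $ j))) / 2 * (b (q $ i) * v $ i) +
      (1 - b (a (q $ i) - a (q $ j))) / 2 * (b (q $ j) * v $ j))) (at q)"
      using smooth_Max_Cons_has_derivative[OF j[THEN conjunct2], of l] j 1 by simp
    moreover have "smooth_Max \<beta> (l # L) q = smooth_max (a (q $ i) + \<beta>) (a (q $ j) + \<beta>)"
      using j 1 by simp
    ultimately show ?thesis
      by blast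
  next
    case 2
    have i: "smooth_Max \<beta> L q = a (q $ i) + \<beta> \<and>
        (smooth_Max \<beta> L has_derivative (\<lambda>v. b (q $ i) * v $ i)) (at q)"
      by (rule smooth_Max_dominated[where g = g])
        (use Cons.prems 2 gap_i(2) ij(3) len eps_pos in auto)
    have "b (a (q $ j) - a (q $ i)) = - b (a (q $ i) - a (q $ j))"
      using b_odd[of "a (q $ i) - a (q $ j)"] by simp
    then have "(smooth_Max \<beta> (l # L) has_derivative (\<lambda>v. (1 + b (a (q $ i) - a (q $ j))) / 2 * (b (q $ i) * v $ i) +
      (1 - b (a (q $ i) - a (q $ j))) / 2 * (b (q $ j) * v $ j))) (at q)"
      using smooth_Max_Cons_has_derivative[OF i[THEN conjunct2], of l] i 2 by (simp add: add.commute)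
    moreover have "smooth_Max \<beta> (l # L) q = smooth_max (a (q $ i) + \<beta>) (a (q $ j) + \<beta>)"
      using i 2 by (simp add: smooth_max_commute)
    ultimately show ?thesis
      by blast
  next
    case 3
    have IH: "smooth_Max \<beta> L q = smooth_max (a (q $ i) + \<beta>) (a (q $ j) + \<beta>)"
      "(smooth_Max \<beta> L has_derivative (\<lambda>v. (1 + b (a (q $ i) - a (q $ j))) / 2 * (b (q $ i) * v $ i) +
      (1 - b (a (q $ i) - a (q $ j))) / 2 * (b (q $ j) * v $ j))) (at q)"
      using Cons.IH Cons.prems 3 len eps_pos by auto
    have "a (q $ l) + \<beta> + g \<le> a (q $ i) + \<beta>"
      using Cons.prems(4)[of l] 3 by simp
    then have "a (q $ l) + \<beta> + \<epsilon> \<le> a (q $ i) + \<beta>"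
      using len eps_pos \<open>0 \<le> real (length L) * (\<epsilon> / 2)\<close> by linarith
    then have far: "a (q $ l) + \<beta> + \<epsilon> \<le> smooth_Max \<beta> L q"
      using smooth_max_ge(1)[of "a (q $ i) + \<beta>" "a (q $ j) + \<beta>"] IH(1) by linarith
    have "smooth_Max \<beta> (l # L) q = smooth_Max \<beta> L q"
      using smooth_max_eq[OF far] by (simp add: smooth_max_commute)
    moreover have "b (a (q $ l) + \<beta> - smooth_Max \<beta> L q) = - 1"
      using far by (intro b_minus_one) simp
    then have "(smooth_Max \<beta> (l # L) has_derivative (\<lambda>v. (1 + b (a (q $ i) - a (q $ j))) / 2 * (b (q $ i) * v $ i) +
      (1 - b (a (q $ i) - a (q $ j))) / 2 * (b (q $ j) * v $ j))) (at q)"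
      using smooth_Max_Cons_has_derivative[OF IH(2), of l] by simp
    ultimately show ?thesis
      unfolding IH(1) by blast
  qed
qed simp

end

section \<open>The smoothed bodies\<close>

context smoothed_abs
begin

definition smooth_norm_1 :: "real ^ 'n \<Rightarrow> real" where
  "smooth_norm_1 p = (\<Sum>i\<in>UNIV. a (p $ i))"

definition smooth_energy :: "real \<Rightarrow> ('n :: finite) list \<Rightarrow> (real ^ 'n) \<times> (real ^ 'n) \<Rightarrow> real" where
  "smooth_energy \<beta> L z = (smooth_norm_1 (fst z))\<^sup>2 + (smooth_Max \<beta> L (snd z))\<^sup>2"

lemma a_nonneg: "a x \<ge> 0"
  using a_ge_abs[of x] by linarith

lemma smooth_norm_1_nonneg: "smooth_norm_1 p \<ge> 0"
  by (simp add: smooth_norm_1_def sum_nonneg a_nonneg)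

lemma smooth_norm_1_close: "\<bar>smooth_norm_1 (p :: real ^ 'n) - norm_1 p\<bar> \<le> real CARD('n) * \<epsilon>"
proof -
  have "smooth_norm_1 p - norm_1 p = (\<Sum>i\<in>UNIV. a (p $ i) - \<bar>p $ i\<bar>)"
    by (simp add: smooth_norm_1_def norm_1_def sum_subtractf)
  moreover have "0 \<le> (\<Sum>i\<in>UNIV. a (p $ i) - \<bar>p $ i\<bar>)"
    using a_ge_abs by (simp add: sum_nonneg)
  moreover have "(\<Sum>i\<in>UNIV. a (p $ i) - \<bar>p $ i\<bar>) \<le> (\<Sum>i\<in>(UNIV :: 'n set). \<epsilon>)"
    using a_le by (intro sum_mono) (simp add: algebra_simps)
  ultimately show ?thesis
    by simp
qed

lemma smooth_Max_close:
  fixes L :: "('n :: finite) list" and q :: "real ^ 'n"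
  assumes "set L = UNIV" "distinct L"
  shows "\<bar>smooth_Max \<beta> L q - norm_inf q\<bar> \<le> \<bar>\<beta>\<bar> + 2 * real CARD('n) * \<epsilon>"
proof -
  have len: "length L = CARD('n)"
    using assms distinct_card by fastforce
  have "1 \<le> real CARD('n)"
    by (simp add: Suc_le_eq)
  then have n\<epsilon>: "\<epsilon> \<le> real CARD('n) * \<epsilon>"
    using mult_right_mono[of 1 "real CARD('n)" \<epsilon>] eps_pos by simp
  have "a (q $ i) + \<beta> \<le> norm_inf q + \<epsilon> + \<bar>\<beta>\<bar>" for i
    using a_le[of "q $ i"] abs_le_norm_inf[of q i] by linarith
  then have "smooth_Max \<beta> L q \<le> norm_inf q + \<epsilon> + \<bar>\<beta>\<bar> + real (length L) * (\<epsilon> / 2)"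
    using norm_inf_nonneg[of q] eps_pos by (intro smooth_Max_le) auto
  then have 1: "smooth_Max \<beta> L q \<le> norm_inf q + \<bar>\<beta>\<bar> + 2 * real CARD('n) * \<epsilon>"
  proof -
    have "real (length L) * (\<epsilon> / 2) = real CARD('n) * \<epsilon> / 2"
      by (simp add: len)
    with \<open>smooth_Max \<beta> L q \<le> norm_inf q + \<epsilon> + \<bar>\<beta>\<bar> + real (length L) * (\<epsilon> / 2)\<close> show ?thesis
      using n\<epsilon> eps_pos by linarith
  qed
  obtain i where i: "norm_inf q = \<bar>q $ i\<bar>"
    using norm_inf_attained by blast
  have "norm_inf q - \<bar>\<beta>\<bar> \<le> smooth_Max \<beta> L q"
    using smooth_Max_ge[of i L q \<beta>] a_ge_abs[of "q $ i"] assms(1) i by simp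
  then show ?thesis
    using 1 n\<epsilon> eps_pos by linarith
qed

lemma smooth_norm_1_convex:
  assumes "u \<ge> 0" "v \<ge> 0" "u + v = 1"
  shows "smooth_norm_1 (u *\<^sub>R p + v *\<^sub>R p') \<le> u * smooth_norm_1 p + v * smooth_norm_1 p'"
  unfolding smooth_norm_1_def sum_distrib_left sum.distrib[symmetric]
  using convex_a assms unfolding convex_on_def by (intro sum_mono) simp

lemma norm_real_pair_mono:
  fixes x y x' y' :: real
  assumes "0 \<le> x" "x \<le> x'" "0 \<le> y" "y \<le> y'"
  shows "norm (x, y) \<le> norm (x', y')"
  using assms by (auto simp: norm_prod_def intro!: add_mono power_mono)

text \<open>
  The root of the energy is the Euclidean norm of a pair of nonnegative convex functions.
\<close>

lemma sqrt_smooth_energy_convex: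
  fixes z z' :: "(real ^ 'n) \<times> (real ^ 'n)"
  assumes uv: "u \<ge> 0" "v \<ge> 0" "u + v = 1"
  shows "sqrt (smooth_energy \<beta> L (u *\<^sub>R z + v *\<^sub>R z')) \<le>
    u * sqrt (smooth_energy \<beta> L z) + v * sqrt (smooth_energy \<beta> L z')"
proof -
  define P where "P z = (smooth_norm_1 (fst z), smooth_Max \<beta> L (snd z))" for z :: "(real ^ 'n) \<times> (real ^ 'n)"
  have eq: "sqrt (smooth_energy \<beta> L z) = norm (P z)" for z :: "(real ^ 'n) \<times> (real ^ 'n)"
    by (simp add: smooth_energy_def P_def norm_prod_def)
  have "norm (P (u *\<^sub>R z + v *\<^sub>R z')) \<le> norm (u *\<^sub>R P z + v *\<^sub>R P z')"
    using smooth_norm_1_convex[OF uv, of "fst z" "fst z'"] smooth_Max_convex[OF uv, of \<beta> L "snd z" "snd z'"]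
    by (simp add: P_def norm_real_pair_mono smooth_norm_1_nonneg smooth_Max_nonneg)
  also have "\<dots> \<le> u * norm (P z) + v * norm (P z')"
    using norm_triangle_ineq[of "u *\<^sub>R P z" "v *\<^sub>R P z'"] uv by simp
  finally show ?thesis
    by (simp add: eq)
qed

lemma smooth_smooth_energy: "smooth (smooth_energy \<beta> (L :: ('n :: finite) list))"
proof -
  have "smooth (\<lambda>z :: (real ^ 'n) \<times> (real ^ 'n). a (fst z $ i))" for i
    by (rule smooth_compose[OF smooth_a smooth_linear])
      (rule bounded_linear_compose[OF bounded_linear_vec_nth bounded_linear_fst])
  then have "smooth (\<lambda>z :: (real ^ 'n) \<times> (real ^ 'n). smooth_norm_1 (fst z))"
    unfolding smooth_norm_1_def by (intro smooth_sum) auto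
  then have "smooth (\<lambda>z :: (real ^ 'n) \<times> (real ^ 'n).
      smooth_norm_1 (fst z) * smooth_norm_1 (fst z) + smooth_Max \<beta> L (snd z) * smooth_Max \<beta> L (snd z))"
    by (intro smooth_add smooth_mult smooth_smooth_Max)
  then show ?thesis
    unfolding smooth_energy_def power2_eq_square .
qed

text \<open>
  The field is expressed by the derivative of the smooth maximum alone, since that is what the lemmas on
  dominating coordinates provide.
\<close>

lemma hamiltonian_field_smooth_energy:
  fixes z :: "(real ^ 'n) \<times> (real ^ 'n)"
  assumes "(smooth_Max \<beta> L has_derivative D) (at (snd z))"
  shows "hamiltonian_field (smooth_energy \<beta> L) z =
    ((\<chi> i. - (2 * smooth_Max \<beta> L (snd z) * D (axis i 1))), (\<chi> i. 2 * smooth_norm_1 (fst z) * b (fst z $ i)))"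
proof -
  have "((\<lambda>z :: (real ^ 'n) \<times> (real ^ 'n). fst z $ i) has_derivative (\<lambda>v. fst v $ i)) (at z)" for i
    by (rule bounded_linear_imp_has_derivative[OF bounded_linear_compose[OF bounded_linear_vec_nth bounded_linear_fst]])
  from a_compose_has_derivative[OF this]
  have "((\<lambda>z :: (real ^ 'n) \<times> (real ^ 'n). smooth_norm_1 (fst z)) has_derivative
      (\<lambda>v. \<Sum>i\<in>UNIV. b (fst z $ i) * fst v $ i)) (at z)"
    unfolding smooth_norm_1_def by (intro has_derivative_sum)
  note dA = this
  have dM: "((\<lambda>z. smooth_Max \<beta> L (snd z)) has_derivative (\<lambda>v. D (snd v))) (at z)"
    using has_derivative_compose[OF has_derivative_snd[OF has_derivative_ident] assms] .
  have "(smooth_energy \<beta> L has_derivative (\<lambda>v. 2 * smooth_norm_1 (fst z) * (\<Sum>i\<in>UNIV. b (fst z $ i) * fst v $ i) +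
      2 * smooth_Max \<beta> L (snd z) * D (snd v))) (at z)"
    unfolding smooth_energy_def[abs_def] power2_eq_square
    by (rule has_derivative_eq_rhs[OF has_derivative_add[OF has_derivative_mult[OF dA dA] has_derivative_mult[OF dM dM]]])
      (simp add: fun_eq_iff algebra_simps)
  note * = frechet_derivative_at[OF this, symmetric]
  have "D 0 = 0"
    using has_derivative_linear[OF assms] by (rule linear_0)
  moreover have "(\<Sum>k\<in>UNIV. b (fst z $ k) * (axis i 1 :: real ^ 'n) $ k) = b (fst z $ i)" for i
    by (simp add: axis_def if_distrib cong: if_cong)
  ultimately show ?thesis
    unfolding hamiltonian_field_def * by simp
qed

text \<open>
  Regularity comes from convexity: the root of the energy is below \<open>1\<close> at the origin and convex, so
  from a point of the level \<open>1\<close> towards the origin the energy decreases at a linear rate.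
\<close>

lemma smooth_energy_body:
  fixes L :: "('n :: finite) list"
  assumes L: "set L = UNIV" "distinct L" and small: "real CARD('n) * \<epsilon> \<le> 1 / 8" "\<bar>\<beta>\<bar> \<le> 1 / 4"
  shows "regular_sublevel (smooth_energy \<beta> L) 1 {z. smooth_energy \<beta> L z \<le> 1}"
    and "smooth_convex_body {z. smooth_energy \<beta> L z \<le> 1}"
    and "0 \<in> {z. smooth_energy \<beta> L z \<le> 1}"
proof -
  let ?H = "smooth_energy \<beta> L"
  let ?K = "{z. ?H z \<le> 1}"
  have cont: "continuous_on UNIV ?H"
    by (rule smooth_imp_continuous[OF smooth_smooth_energy])
  have nonneg: "?H z \<ge> 0" for z
    by (simp add: smooth_energy_def)
  have z0: "?H 0 < 1"
  proof -
    have "norm_1 (0 :: real ^ 'n) = 0" "norm_inf (0 :: real ^ 'n) = 0"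
      using norm_inf_attained[of "0 :: real ^ 'n"] by (auto simp: norm_1_def)
    then have "smooth_norm_1 (0 :: real ^ 'n) \<le> 1 / 2" "smooth_Max \<beta> L 0 \<le> 1 / 2"
      using smooth_norm_1_close[of "0 :: real ^ 'n"] smooth_Max_close[OF L, of \<beta> 0] small by auto
    then have "(smooth_norm_1 (0 :: real ^ 'n))\<^sup>2 \<le> (1 / 2)\<^sup>2" "(smooth_Max \<beta> L 0)\<^sup>2 \<le> (1 / 2)\<^sup>2"
      using smooth_norm_1_nonneg[of "0 :: real ^ 'n"] smooth_Max_nonneg[of \<beta> L 0] by (auto intro!: power_mono)
    then show ?thesis
      by (simp add: smooth_energy_def power2_eq_square)
  qed
  then show "0 \<in> ?K"
    by simp
  show reg: "regular_sublevel ?H 1 ?K"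
    unfolding regular_sublevel_def
  proof (intro conjI allI impI smooth_smooth_energy refl)
    fix z assume Hz: "?H z = 1"
    have "k_times_cont_differentiable (Suc 0) ?H"
      using smooth_smooth_energy[of \<beta> L] unfolding smooth_def by blast
    then have "?H differentiable (at z)"
      unfolding k_times_cont_differentiable.simps(2) by blast
    then have der: "(?H has_derivative frechet_derivative ?H (at z)) (at z)"
      by (simp only: frechet_derivative_works)
    define \<kappa> where "\<kappa> = 1 - sqrt (?H 0)"
    have \<kappa>: "0 < \<kappa>" "\<kappa> \<le> 1"
      using z0 nonneg[of 0] by (auto simp: \<kappa>_def)
    show "\<exists>v. frechet_derivative ?H (at z) v \<noteq> 0"
    proof (rule ccontr)
      assume "\<nexists>v. frechet_derivative ?H (at z) v \<noteq> 0"
      then have "frechet_derivative ?H (at z) (- z) = 0"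
        by blast
      then have "((\<lambda>t. ?H (z + t *\<^sub>R (- z))) has_real_derivative 0) (at 0)"
        using has_real_derivative_along_line[OF der, of "- z"] by (simp only:)
      then have "((\<lambda>t. ?H (z + t *\<^sub>R (- z)) + \<kappa> * t) has_real_derivative \<kappa>) (at 0)"
        by (auto intro!: derivative_eq_intros)
      from DERIV_pos_inc_right[OF this \<kappa>(1)]
      obtain d where d: "d > 0" "\<And>h. 0 < h \<Longrightarrow> h < d \<Longrightarrow> 1 < ?H (z + h *\<^sub>R (- z)) + \<kappa> * h"
        using Hz by auto
      define h where "h = min d 1 / 2"
      have h: "0 < h" "h < d" "h < 1"
        using d(1) by (auto simp: h_def)
      have "sqrt (?H ((1 - h) *\<^sub>R z + h *\<^sub>R 0)) \<le> (1 - h) * sqrt (?H z) + h * sqrt (?H 0)"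
        using h by (intro sqrt_smooth_energy_convex) auto
      also have "(1 - h) * sqrt (?H z) + h * sqrt (?H 0) = 1 - \<kappa> * h"
        by (simp add: Hz \<kappa>_def algebra_simps)
      also have "(1 - h) *\<^sub>R z + h *\<^sub>R 0 = z + h *\<^sub>R (- z)"
        by (simp add: algebra_simps)
      finally have le: "sqrt (?H (z + h *\<^sub>R (- z))) \<le> 1 - \<kappa> * h" .
      have kh: "0 \<le> \<kappa> * h" "\<kappa> * h \<le> 1"
        using \<kappa> h by (auto simp: mult_le_one)
      have "?H (z + h *\<^sub>R (- z)) = (sqrt (?H (z + h *\<^sub>R (- z))))\<^sup>2"
        using nonneg by simp
      also have "\<dots> \<le> (1 - \<kappa> * h)\<^sup>2"
        using le nonneg by (intro power_mono) auto
      also have "\<dots> \<le> (1 - \<kappa> * h) * 1"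
        unfolding power2_eq_square using kh by (intro mult_left_mono) auto
      finally show False
        using d(2)[OF h(1,2)] by simp
    qed
  qed
  show "smooth_convex_body ?K"
    unfolding smooth_convex_body_def convex_body_def
  proof (intro conjI)
    show "convex ?K"
    proof (rule convexI)
      fix x y and u v :: real
      assume xy: "x \<in> ?K" "y \<in> ?K" and uv: "0 \<le> u" "0 \<le> v" "u + v = 1"
      have "sqrt (?H (u *\<^sub>R x + v *\<^sub>R y)) \<le> u * sqrt (?H x) + v * sqrt (?H y)"
        by (rule sqrt_smooth_energy_convex[OF uv])
      also have "\<dots> \<le> u * 1 + v * 1"
        using xy uv by (intro add_mono mult_left_mono) auto
      finally show "u *\<^sub>R x + v *\<^sub>R y \<in> ?K"
        using uv by simp
    qed
    have "bounded ?K"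
      unfolding bounded_iff
    proof (intro exI ballI)
      fix z assume "z \<in> ?K"
      then have sum_le: "(smooth_norm_1 (fst z))\<^sup>2 + (smooth_Max \<beta> L (snd z))\<^sup>2 \<le> 1"
        by (simp add: smooth_energy_def)
      have "(smooth_norm_1 (fst z))\<^sup>2 \<le> 1" "(smooth_Max \<beta> L (snd z))\<^sup>2 \<le> 1"
        using sum_le zero_le_power2[of "smooth_norm_1 (fst z)"] zero_le_power2[of "smooth_Max \<beta> L (snd z)"]
        by linarith+
      then have "smooth_norm_1 (fst z) \<le> 1" "smooth_Max \<beta> L (snd z) \<le> 1"
        by (auto simp: abs_square_le_1 abs_le_iff)
      then have 1: "norm_1 (fst z) \<le> 2" and 2: "norm_inf (snd z) \<le> 2"
        using smooth_norm_1_close[of "fst z"] smooth_Max_close[OF L, of \<beta> "snd z"] small by linarith+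
      have "norm z \<le> norm (fst z) + norm (snd z)"
        using norm_Pair_le[of "fst z" "snd z"] by simp
      also have "norm (fst z) \<le> norm_1 (fst z)"
        unfolding norm_1_def by (rule norm_le_l1_cart)
      also have "norm (snd z) \<le> (\<Sum>i\<in>UNIV. \<bar>snd z $ i\<bar>)"
        by (rule norm_le_l1_cart)
      also have "\<dots> \<le> (\<Sum>i\<in>(UNIV :: 'n set). 2)"
        using 2 by (intro sum_mono) (metis abs_le_norm_inf order_trans)
      finally show "norm z \<le> 2 + real CARD('n) * 2"
        using 1 by simp
    qed
    moreover have "closed ?K"
      by (rule closed_Collect_le[OF cont continuous_on_const])
    ultimately show "compact ?K"
      by (simp add: compact_eq_bounded_closed)
    have "open {z. ?H z < 1}"
      by (rule open_Collect_less[OF cont continuous_on_const])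
    then have "{z. ?H z < 1} \<subseteq> interior ?K"
      by (rule interior_maximal[rotated]) auto
    then show "interior ?K \<noteq> {}"
      using z0 by auto
    show "\<exists>H c. regular_sublevel H c ?K"
      using reg by blast
  qed
qed

end

section \<open>The motion of one coordinate\<close>

text \<open>
  Position \<open>f\<close> and momentum \<open>g\<close> of one coordinate near a maximum of its position at time \<open>0\<close>, with
  \<open>k = - g'\<close>; the remaining constants are as in the introduction. The other coordinates are copies of
  this one, delayed by multiples of \<open>2D\<close>. This coordinate leads for \<open>|s| \<le> D\<close>. As long as it leads
  alone, \<open>\<parallel>p\<parallel>\<^sub>1\<close> is \<open>(n - 1) m + a (g s)\<close>, since the waiting coordinates contribute \<open>m\<close> each, and the
  smooth maximum is \<open>f s + \<beta>\<close>; the assumption \<open>lead\<close> states conservation of energy and Hamilton's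
  equation for the momentum, for a time in which positions move with velocity \<open>b (g s)\<close>. By symmetry
  the successor has position \<open>f (D - v)\<close> at time \<open>D + v\<close>, and the assumption \<open>transition\<close> is
  the corresponding statement while the two share the force. The numerical bounds hold because
  the limits for \<open>\<epsilon> \<rightarrow> 0\<close> are \<open>D = m = 1 / \<surd>(n\<^sup>2 + (n - 1)\<^sup>2)\<close> and \<open>\<beta> = 0\<close>.
\<close>

locale characteristic_profile = smoothed_abs +
  fixes n :: nat and D m \<beta> :: real and f g k :: "real \<Rightarrow> real"
  assumes n: "n \<ge> 2"
    and eps_small: "(real n)\<^sup>2 * \<epsilon> \<le> 1 / 1000"
    and D_ge: "D \<ge> 69 / 100 / real n" and D_le: "D \<le> 1"
    and beta_small: "\<bar>\<beta>\<bar> \<le> 7 * real n * \<epsilon>"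
    and m_ge: "m \<ge> \<epsilon>"
    and f_deriv: "(f has_real_derivative b (g s)) (at s)"
    and g_deriv: "(g has_real_derivative - k s) (at s)"
    and k_cont: "continuous_on UNIV k"
    and f_even: "f (- s) = f s" and g_odd: "g (- s) = - g s" and k_even: "k (- s) = k s"
    and g_eq: "s \<ge> D + \<epsilon> / 2 \<Longrightarrow> g s = - m"
    and k_eq: "s \<ge> D + \<epsilon> / 2 \<Longrightarrow> k s = 0"
    and f_eq: "s \<ge> D - \<epsilon> / 2 \<Longrightarrow> f s = real n * D - s"
    and f_ge_lead: "0 \<le> s \<Longrightarrow> s \<le> D - \<epsilon> / 2 \<Longrightarrow> f s \<ge> f (D - \<epsilon> / 2)"
    and f_ge: "0 \<le> s \<Longrightarrow> s \<le> D \<Longrightarrow> f s \<ge> real n * D - s - 5 / 2 * \<epsilon>"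
    and lead: "0 \<le> s \<Longrightarrow> s \<le> D - \<epsilon> / 2 \<Longrightarrow>
      f s + \<beta> > 0 \<and> (real n - 1) * m + a (g s) > 0 \<and>
      ((real n - 1) * m + a (g s))\<^sup>2 + (f s + \<beta>)\<^sup>2 = 1 \<and>
      k s = (f s + \<beta>) / ((real n - 1) * m + a (g s))"
    and transition: "\<bar>v\<bar> \<le> \<epsilon> / 2 \<Longrightarrow>
      \<exists>A M. A > 0 \<and> A\<^sup>2 + M\<^sup>2 = 1 \<and> A = (real n - 2) * m + a (g (D + v)) + a (g (D - v)) \<and>
      M = (real n - 1) * D + \<beta> + a (2 * v) / 2 \<and> k (D + v) = M / A * (1 - b (2 * v)) / 2"

lemma DERIV_zero_imp_eq_on_interval:
  fixes h :: "real \<Rightarrow> real"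
  assumes "\<And>x. x \<in> {u..v} \<Longrightarrow> (h has_real_derivative 0) (at x)" "x \<in> {u..v}" "y \<in> {u..v}"
  shows "h x = h y"
proof -
  have "\<exists>c. \<forall>x\<in>{u..v}. h x = c"
    using assms(1) by (intro has_field_derivative_zero_constant) (auto intro: has_field_derivative_at_within)
  then show ?thesis
    using assms(2,3) by metis
qed

text \<open>
  Separation of variables: \<open>\<Theta>\<close> is the integral of \<open>\<phi>\<close>, and \<open>\<Lambda>\<close> is its inverse function.
\<close>

lemma autonomous_solution:
  fixes \<phi> :: "real \<Rightarrow> real"
  assumes cont: "continuous_on UNIV \<phi>" and c: "c > 0" "\<And>x. c \<le> \<phi> x"
  obtains \<Theta> \<Lambda> where "\<And>x. (\<Theta> has_real_derivative \<phi> x) (at x)" "\<Theta> 0 = 0"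
    "\<And>s. (\<Lambda> has_real_derivative 1 / \<phi> (\<Lambda> s)) (at s)" "\<And>x. \<Lambda> (\<Theta> x) = x"
    "strict_mono \<Theta>" "strict_mono \<Lambda>"
proof -
  obtain \<Theta> where \<Theta>: "\<And>x. (\<Theta> has_real_derivative \<phi> x) (at x)" "\<Theta> 0 = 0"
    using antiderivative_exists[OF cont] by blast
  have pos: "\<phi> x > 0" for x
    using c less_le_trans by blast
  have growth: "c * (y - x) \<le> \<Theta> y - \<Theta> x" if "x \<le> y" for x y
  proof -
    have "\<Theta> x - c * x \<le> \<Theta> y - c * y"
    proof (rule DERIV_nonneg_imp_nondecreasing[OF that])
      fix z
      have "((\<lambda>x. \<Theta> x - c * x) has_real_derivative \<phi> z - c) (at z)"
        by (auto intro!: derivative_eq_intros \<Theta>)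
      then show "\<exists>y. ((\<lambda>x. \<Theta> x - c * x) has_real_derivative y) (at z) \<and> 0 \<le> y"
        using c(2)[of z] by (intro exI[of _ "\<phi> z - c"]) simp
    qed
    then show ?thesis
      by (simp add: algebra_simps)
  qed
  have mono: "strict_mono \<Theta>"
  proof (rule strict_monoI)
    fix x y :: real assume "x < y"
    then have "0 < c * (y - x)"
      using c by simp
    then show "\<Theta> x < \<Theta> y"
      using growth[of x y] \<open>x < y\<close> by linarith
  qed
  have cont\<Theta>: "isCont \<Theta> x" for x
    using \<Theta>(1) DERIV_isCont by blast
  have surj: "\<exists>x. \<Theta> x = s" for s
  proof -
    define r where "r = \<bar>s\<bar> / c"
    have r: "r \<ge> 0" "c * r = \<bar>s\<bar>"
      using c by (auto simp: r_def)
    have "\<Theta> (- r) \<le> s" "s \<le> \<Theta> r"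
      using growth[of "- r" 0] growth[of 0 r] r \<Theta>(2) by auto
    then show ?thesis
      using IVT'[of \<Theta> "- r" s r] r cont\<Theta> by (auto simp: continuous_at_imp_continuous_on)
  qed
  define \<Lambda> where "\<Lambda> s = (SOME x. \<Theta> x = s)" for s
  have \<Theta>\<Lambda>: "\<Theta> (\<Lambda> s) = s" for s
    unfolding \<Lambda>_def using surj[of s] by (rule someI_ex)
  have \<Lambda>\<Theta>: "\<Lambda> (\<Theta> x) = x" for x
    using \<Theta>\<Lambda>[of "\<Theta> x"] mono by (simp add: strict_mono_eq)
  have mono\<Lambda>: "strict_mono \<Lambda>"
  proof (rule strict_monoI)
    fix s s' :: real assume "s < s'"
    then have "\<Theta> (\<Lambda> s) < \<Theta> (\<Lambda> s')"
      by (simp only: \<Theta>\<Lambda>)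
    then show "\<Lambda> s < \<Lambda> s'"
      using mono by (simp only: strict_mono_less)
  qed
  have "isCont \<Lambda> s" for s
    using isCont_inverse_function[of 1 "\<Lambda> s" \<Lambda> \<Theta>] \<Lambda>\<Theta> cont\<Theta> \<Theta>\<Lambda> by simp
  then have "(\<Lambda> has_real_derivative inverse (\<phi> (\<Lambda> s))) (at s)" for s
    using DERIV_inverse_function[where f = \<Theta> and g = \<Lambda> and x = s and a = "s - 1" and b = "s + 1"]
      \<Theta>(1)[of "\<Lambda> s"] pos[of "\<Lambda> s"] \<Theta>\<Lambda> by simp
  then have \<Lambda>: "(\<Lambda> has_real_derivative 1 / \<phi> (\<Lambda> s)) (at s)" for s
    by (simp add: inverse_eq_divide)
  show thesis
    by (rule that[OF \<Theta> \<Lambda> \<Lambda>\<Theta> mono mono\<Lambda>])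
qed

text \<open>
  From \<open>(s - t) (s + t) = (y - x) (y + x)\<close>.
\<close>

lemma unit_circle_lipschitz:
  fixes x y s t :: real
  assumes "s\<^sup>2 + x\<^sup>2 = 1" "t\<^sup>2 + y\<^sup>2 = 1"
    and "0 \<le> x" "x \<le> 3 / 4" "0 \<le> y" "y \<le> 3 / 4" "3 / 5 \<le> s" "3 / 5 \<le> t"
  shows "\<bar>s - t\<bar> \<le> 5 / 4 * \<bar>x - y\<bar>"
proof -
  have "(s - t) * (s + t) = (y - x) * (x + y)"
    using assms(1,2) by (simp add: power2_eq_square algebra_simps)
  then have "\<bar>(s - t) * (s + t)\<bar> = \<bar>(y - x) * (x + y)\<bar>"
    by (rule arg_cong)
  then have eq: "\<bar>s - t\<bar> * (s + t) = \<bar>x - y\<bar> * (x + y)"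
    using assms unfolding abs_mult by (simp add: abs_minus_commute[of x])
  have "\<bar>s - t\<bar> * (6 / 5) \<le> \<bar>s - t\<bar> * (s + t)"
    using assms by (intro mult_left_mono) auto
  also note eq
  also have "\<bar>x - y\<bar> * (x + y) \<le> \<bar>x - y\<bar> * (3 / 2)"
    using assms by (intro mult_left_mono) auto
  finally have "\<bar>s - t\<bar> * (6 / 5) \<le> \<bar>x - y\<bar> * (3 / 2)" .
  then have "\<bar>s - t\<bar> * (6 / 5) / (6 / 5) \<le> \<bar>x - y\<bar> * (3 / 2) / (6 / 5)"
    by (rule divide_right_mono) simp
  then show ?thesis
    by simp
qed

context smoothed_abs
begin

text \<open>
  While the lead is exchanged at time \<open>D + v\<close>, both positions move with constant speed, so that the
  smooth maximum \<open>M\<close> is an explicit function of \<open>v\<close>, and \<open>A\<close> is \<open>\<parallel>p\<parallel>\<^sub>1\<close> by conservation of energy. Then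
  \<open>\<kappa>\<close> is the force on the coordinate that loses the lead, and \<open>W\<close> is the momentum it has yet to
  lose. Time reversal exchanges the two coordinates, so \<open>W (- v)\<close> belongs to the successor. The identity
  for \<open>W v + W (- v)\<close> holds because both sides have the same derivative; it says that the momenta
  found in this way have the sum that the energy requires.
\<close>

lemma transition_solution:
  assumes Q: "2 / 5 \<le> Q" "Q \<le> 71 / 100" and small: "\<epsilon> \<le> 1 / 4000"
  defines "M \<equiv> \<lambda>v. Q + a (2 * v) / 2"
  defines "A \<equiv> \<lambda>v. sqrt (1 - (M v)\<^sup>2)"
  obtains \<kappa> W where "continuous_on UNIV \<kappa>" "\<And>v. (W has_real_derivative - \<kappa> v) (at v)"
    "\<And>v. v \<ge> \<epsilon> / 2 \<Longrightarrow> W v = 0" "\<And>v. v \<ge> \<epsilon> / 2 \<Longrightarrow> \<kappa> v = 0"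
    "\<And>v. 0 \<le> \<kappa> v" "0 \<le> W (- (\<epsilon> / 2))" "W (- (\<epsilon> / 2)) \<le> 11 / 10 * \<epsilon>"
    "\<And>v. \<bar>v\<bar> \<le> \<epsilon> / 2 \<Longrightarrow> \<kappa> v = M v / A v * (1 - b (2 * v)) / 2"
    "\<And>v. \<bar>v\<bar> \<le> \<epsilon> / 2 \<Longrightarrow> W v + W (- v) = W (- (\<epsilon> / 2)) + A (\<epsilon> / 2) - A v"
    "\<And>v. \<bar>v\<bar> \<le> \<epsilon> / 2 \<Longrightarrow> 69 / 100 \<le> A v" "\<And>v. \<bar>v\<bar> \<le> \<epsilon> / 2 \<Longrightarrow> A v \<le> 92 / 100"
    "\<And>v. \<bar>v\<bar> \<le> \<epsilon> / 2 \<Longrightarrow> (A v)\<^sup>2 + (M v)\<^sup>2 = 1"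
proof -
  have M_bounds: "2 / 5 \<le> M v" "M v \<le> 72 / 100" if "\<bar>v\<bar> \<le> \<epsilon> / 2" for v
  proof -
    have "a (2 * v) \<le> a \<epsilon>"
      using that by (intro a_le_of_abs_le) (auto simp: abs_mult)
    then show "2 / 5 \<le> M v" "M v \<le> 72 / 100"
      using a_abs[of \<epsilon>] eps_pos a_nonneg[of "2 * v"] Q small by (auto simp: M_def)
  qed
  have A_bounds: "69 / 100 \<le> A v" "A v \<le> 92 / 100" and circle: "(A v)\<^sup>2 + (M v)\<^sup>2 = 1" if "\<bar>v\<bar> \<le> \<epsilon> / 2" for v
  proof -
    have "(2 / 5)\<^sup>2 \<le> (M v)\<^sup>2" "(M v)\<^sup>2 \<le> (72 / 100)\<^sup>2"
      using M_bounds[OF that] by (intro power_mono; linarith)+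
    then have *: "4 / 25 \<le> (M v)\<^sup>2" "(M v)\<^sup>2 \<le> 5184 / 10000"
      by (simp_all add: power2_eq_square)
    have "69 / 100 \<le> sqrt (1 - (M v)\<^sup>2)"
      using * by (intro real_le_rsqrt) (simp add: power2_eq_square)
    moreover have "sqrt (1 - (M v)\<^sup>2) \<le> 92 / 100"
      using * by (intro real_le_lsqrt) (simp_all add: power2_eq_square)
    ultimately show "69 / 100 \<le> A v" "A v \<le> 92 / 100" "(A v)\<^sup>2 + (M v)\<^sup>2 = 1"
      using * by (simp_all add: A_def)
  qed
  \<comment> \<open>Freezing the argument outside the transition keeps \<open>A\<close> positive, so that the force is defined and
    continuous for all times.\<close>
  define clip where "clip v = max (- (\<epsilon> / 2)) (min v (\<epsilon> / 2))" for v :: real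
  have clip: "\<bar>clip v\<bar> \<le> \<epsilon> / 2" for v
    using eps_pos by (auto simp: clip_def)
  have clip_id: "clip v = v" if "\<bar>v\<bar> \<le> \<epsilon> / 2" for v
    using that by (auto simp: clip_def)
  define \<kappa> where "\<kappa> v = M (clip v) / A (clip v) * (1 - b (2 * clip v)) / 2" for v
  have cont_clip: "continuous_on UNIV clip"
    unfolding clip_def by (intro continuous_intros)
  have contM: "continuous_on UNIV (\<lambda>v. M (clip v))"
    unfolding M_def by (intro continuous_intros continuous_on_compose2[OF a_cont[of UNIV]] cont_clip) auto
  have cont\<kappa>: "continuous_on UNIV \<kappa>"
    unfolding \<kappa>_def
  proof (intro continuous_intros contM continuous_on_compose2[OF b_cont] cont_clip ballI)
    show "continuous_on UNIV (\<lambda>v. A (clip v))"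
      unfolding A_def by (intro continuous_intros contM)
    show "A (clip v) \<noteq> 0" for v
      using A_bounds(1)[OF clip[of v]] by linarith
  qed auto
  obtain W where W: "\<And>v. (W has_real_derivative - \<kappa> v) (at v)" "W (\<epsilon> / 2) = 0"
    using antiderivative_exists[OF continuous_on_minus[OF cont\<kappa>]] by blast
  have \<kappa>_0: "\<kappa> v = 0" if "v \<ge> \<epsilon> / 2" for v
    using that b_one[of \<epsilon>] eps_pos by (simp add: \<kappa>_def clip_def)
  have W_0: "W v = 0" if "v \<ge> \<epsilon> / 2" for v
  proof -
    have "W v = W (\<epsilon> / 2)"
    proof (rule DERIV_zero_imp_eq_on_interval[where h = W and u = "\<epsilon> / 2" and v = v])
      show "(W has_real_derivative 0) (at x)" if "x \<in> {\<epsilon> / 2..v}" for x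
        using W(1)[of x] \<kappa>_0[of x] that by simp
    qed (use that in auto)
    then show ?thesis
      using W(2) by simp
  qed
  have \<kappa>_bounds: "0 \<le> \<kappa> v" "\<kappa> v \<le> 11 / 10" for v
  proof -
    have M: "2 / 5 \<le> M (clip v)" "M (clip v) \<le> 72 / 100" and A: "69 / 100 \<le> A (clip v)"
      using M_bounds A_bounds clip by blast+
    have ratio: "0 \<le> M (clip v) / A (clip v)" "M (clip v) / A (clip v) \<le> 11 / 10"
      using M A by (auto simp: divide_le_eq)
    have b: "0 \<le> (1 - b (2 * clip v)) / 2" "(1 - b (2 * clip v)) / 2 \<le> 1"
      using b_bounds[of "2 * clip v"] by auto
    have eq: "\<kappa> v = M (clip v) / A (clip v) * ((1 - b (2 * clip v)) / 2)"
      by (simp add: \<kappa>_def)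
    show "0 \<le> \<kappa> v"
      unfolding eq by (rule mult_nonneg_nonneg[OF ratio(1) b(1)])
    show "\<kappa> v \<le> 11 / 10"
      unfolding eq using mult_mono[OF ratio(2) b(2) _ b(1)] by simp
  qed
  have "- (\<epsilon> / 2) < \<epsilon> / 2"
    using eps_pos by simp
  from MVT2[OF this W(1)] obtain z where "W (\<epsilon> / 2) - W (- (\<epsilon> / 2)) = (\<epsilon> / 2 - - (\<epsilon> / 2)) * - \<kappa> z"
    by blast
  then have I: "W (- (\<epsilon> / 2)) = \<epsilon> * \<kappa> z"
    using W(2) by simp
  then have I_bounds: "0 \<le> W (- (\<epsilon> / 2))" "W (- (\<epsilon> / 2)) \<le> 11 / 10 * \<epsilon>"
    using \<kappa>_bounds[of z] eps_pos mult_left_mono[of "\<kappa> z" "11 / 10" \<epsilon>] by auto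
  have M_even: "M (- v) = M v" for v
    using a_even[of "2 * v"] by (simp add: M_def)
  have A_even: "A (- v) = A v" for v
    by (simp add: A_def M_even)
  have \<kappa>_eq: "\<kappa> v = M v / A v * (1 - b (2 * v)) / 2" if "\<bar>v\<bar> \<le> \<epsilon> / 2" for v
    using clip_id[OF that] by (simp add: \<kappa>_def)
  have sum: "W v + W (- v) = W (- (\<epsilon> / 2)) + A (\<epsilon> / 2) - A v" if v: "\<bar>v\<bar> \<le> \<epsilon> / 2" for v
  proof -
    have "((\<lambda>v. W v + W (- v) + A v) has_real_derivative 0) (at x)" if "x \<in> {- (\<epsilon> / 2)..\<epsilon> / 2}" for x
    proof -
      have x: "\<bar>x\<bar> \<le> \<epsilon> / 2" "\<bar>- x\<bar> \<le> \<epsilon> / 2"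
        using that by auto
      have M_deriv: "(M has_real_derivative b (2 * x)) (at x)"
      proof -
        have "((\<lambda>v. a (2 * v)) has_real_derivative b (2 * x) * 2) (at x)"
          by (rule DERIV_chain2[OF a_deriv]) (auto intro!: derivative_eq_intros)
        from DERIV_add[OF DERIV_const[of Q] DERIV_cdivide[OF this, of 2]]
        have "(M has_real_derivative 0 + b (2 * x) * 2 / 2) (at x)"
          unfolding M_def .
        then show ?thesis
          by simp
      qed
      have "0 < (A x)\<^sup>2"
        using A_bounds(1)[OF x(1)] by (intro zero_less_power) linarith
      then have pos: "0 < 1 - (M x)\<^sup>2"
        using circle[OF x(1)] by linarith
      have "((\<lambda>v. 1 - (M v)\<^sup>2) has_real_derivative 0 - real 2 * (b (2 * x) * M x ^ (2 - Suc 0))) (at x)"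
        by (rule DERIV_diff[OF DERIV_const DERIV_power[OF M_deriv]])
      from DERIV_chain2[where f = sqrt and g = "\<lambda>v. 1 - (M v)\<^sup>2" and x = x, OF DERIV_real_sqrt[OF pos] this]
      have "(A has_real_derivative inverse (A x) / 2 * (0 - real 2 * (b (2 * x) * M x ^ (2 - Suc 0)))) (at x)"
        unfolding A_def .
      moreover have "inverse (A x) / 2 * (0 - real 2 * (b (2 * x) * M x ^ (2 - Suc 0))) = - (M x * b (2 * x) / A x)"
        by (simp add: inverse_eq_divide mult.commute)
      ultimately have "(A has_real_derivative - (M x * b (2 * x) / A x)) (at x)"
        by (rule DERIV_cong)
      moreover have "((\<lambda>v. W (- v)) has_real_derivative \<kappa> (- x)) (at x)"
      proof -
        have "((\<lambda>v. W (- v)) has_real_derivative - \<kappa> (- x) * - 1) (at x)"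
          by (rule DERIV_chain2[OF W(1)]) (auto intro!: derivative_eq_intros)
        then show ?thesis
          by simp
      qed
      ultimately have "((\<lambda>v. W v + W (- v) + A v) has_real_derivative - \<kappa> x + \<kappa> (- x) + - (M x * b (2 * x) / A x)) (at x)"
        by (intro DERIV_add W(1))
      moreover have "\<kappa> (- x) = M x / A x * (1 + b (2 * x)) / 2"
        using \<kappa>_eq[OF x(2)] b_odd[of "2 * x"] by (simp add: M_even A_even)
      then have "- \<kappa> x + \<kappa> (- x) + - (M x * b (2 * x) / A x) = 0"
        unfolding \<kappa>_eq[OF x(1)] by (simp add: right_diff_distrib distrib_left diff_divide_distrib add_divide_distrib)
      ultimately show ?thesis
        by simp
    qed
    then have "W v + W (- v) + A v = W (\<epsilon> / 2) + W (- (\<epsilon> / 2)) + A (\<epsilon> / 2)"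
      by (rule DERIV_zero_imp_eq_on_interval[where h = "\<lambda>v. W v + W (- v) + A v" and u = "- (\<epsilon> / 2)" and v = "\<epsilon> / 2"])
        (use v in auto)
    then show ?thesis
      using W(2) by simp
  qed
  show thesis
    by (rule that[OF cont\<kappa> W(1) W_0 \<kappa>_0 \<kappa>_bounds(1) I_bounds \<kappa>_eq sum A_bounds circle])
qed

text \<open>
  While one coordinate leads alone after its maximum, its momentum is \<open>- \<Lambda> s\<close>. Conservation of energy
  determines its position from its momentum, so the equation for \<open>\<Lambda>\<close> is autonomous. The lead lasts for the
  time \<open>S\<close> in which the momentum reaches \<open>- x1\<close>, and at time \<open>t\<close> the momentum leaves the
  interval where \<open>a\<close> differs from the absolute value.
\<close>

lemma lead_solution:
  assumes c: "39 / 100 \<le> c" and x1: "\<epsilon> \<le> x1" "c + x1 \<le> 92 / 100"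
  defines "A \<equiv> \<lambda>x. c + a x"
  obtains S \<Lambda> \<psi> t where "S > 0" "continuous_on UNIV \<psi>" "\<And>s. (\<Lambda> has_real_derivative \<psi> s) (at s)"
    "\<Lambda> 0 = 0" "\<Lambda> S = x1" "\<And>s. 0 \<le> s \<Longrightarrow> s \<le> S \<Longrightarrow> 0 \<le> \<Lambda> s" "\<And>s. s \<le> S \<Longrightarrow> \<Lambda> s \<le> x1"
    "\<And>s. 0 \<le> s \<Longrightarrow> s \<le> S \<Longrightarrow> \<psi> s = sqrt (1 - (A (\<Lambda> s))\<^sup>2) / A (\<Lambda> s)"
    "0 \<le> t" "t \<le> 5 / 2 * \<epsilon>" "t \<le> S" "\<And>s. t \<le> s \<Longrightarrow> \<epsilon> \<le> \<Lambda> s"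
proof -
  have x1_pos: "0 < x1"
    using x1 eps_pos by linarith
  \<comment> \<open>Beyond \<open>x1\<close> the right-hand side is frozen to obtain a solution for all times.\<close>
  define clip where "clip v = max (- x1) (min v x1)" for v :: real
  have clip: "\<bar>clip v\<bar> \<le> x1" for v
    using x1_pos by (auto simp: clip_def)
  have clip_id: "clip v = v" if "\<bar>v\<bar> \<le> x1" for v
    using that by (auto simp: clip_def)
  have cont_clip: "continuous_on UNIV clip"
    unfolding clip_def by (intro continuous_intros)
  have A_bounds: "39 / 100 \<le> A x" "A x \<le> 92 / 100" if "\<bar>x\<bar> \<le> x1" for x
    using a_le_of_abs_le[OF that] a_abs[of x1] x1 x1_pos a_nonneg[of x] c by (auto simp: A_def)
  have root: "39 / 100 \<le> sqrt (1 - (A x)\<^sup>2)" "sqrt (1 - (A x)\<^sup>2) \<le> 1" if "\<bar>x\<bar> \<le> x1" for x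
  proof -
    have "(A x)\<^sup>2 \<le> (92 / 100)\<^sup>2"
      using A_bounds[OF that] by (intro power_mono) auto
    then show "39 / 100 \<le> sqrt (1 - (A x)\<^sup>2)"
      by (intro real_le_rsqrt) (simp add: power2_eq_square)
    show "sqrt (1 - (A x)\<^sup>2) \<le> 1"
      by simp
  qed
  define \<phi> where "\<phi> x = A (clip x) / sqrt (1 - (A (clip x))\<^sup>2)" for x
  have contA: "continuous_on UNIV (\<lambda>v. A (clip v))"
    unfolding A_def by (intro continuous_intros continuous_on_compose2[OF a_cont[of UNIV]] cont_clip) auto
  have cont\<phi>: "continuous_on UNIV \<phi>"
    unfolding \<phi>_def
  proof (intro continuous_intros contA ballI)
    show "sqrt (1 - (A (clip x))\<^sup>2) \<noteq> 0" for x
      using root(1)[OF clip, of x] by linarith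
  qed
  have \<phi>_bounds: "39 / 100 \<le> \<phi> x" "\<phi> x \<le> 5 / 2" for x
  proof -
    let ?r = "sqrt (1 - (A (clip x))\<^sup>2)"
    have r: "0 < ?r" "39 / 100 * ?r \<le> A (clip x)" "A (clip x) \<le> 5 / 2 * ?r"
      using A_bounds[OF clip, of x] root[OF clip, of x] by linarith+
    show "39 / 100 \<le> \<phi> x"
      unfolding \<phi>_def pos_le_divide_eq[OF r(1)] by (rule r(2))
    show "\<phi> x \<le> 5 / 2"
      unfolding \<phi>_def pos_divide_le_eq[OF r(1)] by (rule r(3))
  qed
  obtain \<Theta> \<Lambda> where \<Theta>: "\<And>x. (\<Theta> has_real_derivative \<phi> x) (at x)" "\<Theta> 0 = 0"
    and \<Lambda>: "\<And>s. (\<Lambda> has_real_derivative 1 / \<phi> (\<Lambda> s)) (at s)" and inv: "\<And>x. \<Lambda> (\<Theta> x) = x"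
    and mono: "strict_mono \<Theta>" "strict_mono \<Lambda>"
  proof (rule autonomous_solution[OF cont\<phi> _ \<phi>_bounds(1)])
    show "(0 :: real) < 39 / 100"
      by simp
  qed (rule that; assumption)
  have \<Lambda>0: "\<Lambda> 0 = 0"
    using inv[of 0] \<Theta>(2) by simp
  have \<Lambda>_mono: "x \<le> y \<Longrightarrow> \<Lambda> x \<le> \<Lambda> y" for x y
    using mono(2) by (simp add: strict_mono_less_eq)
  define \<psi> where "\<psi> s = 1 / \<phi> (\<Lambda> s)" for s
  have "continuous_on UNIV \<Lambda>"
    using \<Lambda> by (auto intro!: DERIV_continuous_on)
  then have cont\<psi>: "continuous_on UNIV \<psi>"
    unfolding \<psi>_def
  proof (intro continuous_intros continuous_on_compose2[OF cont\<phi>] ballI)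
    show "\<phi> (\<Lambda> x) \<noteq> 0" for x
      using \<phi>_bounds(1)[of "\<Lambda> x"] by linarith
  qed auto
  have S: "\<Theta> x1 > 0"
    using mono(1) x1_pos \<Theta>(2) by (metis strict_mono_less)
  have up: "\<Lambda> s \<le> x1" if "s \<le> \<Theta> x1" for s
    using \<Lambda>_mono[OF that] inv by simp
  have low: "0 \<le> \<Lambda> s" if "0 \<le> s" for s
    using \<Lambda>_mono[OF that] \<Lambda>0 by simp
  have \<psi>_eq: "\<psi> s = sqrt (1 - (A (\<Lambda> s))\<^sup>2) / A (\<Lambda> s)" if "0 \<le> s" "s \<le> \<Theta> x1" for s
    using clip_id[of "\<Lambda> s"] up[OF that(2)] low[OF that(1)] by (simp add: \<psi>_def \<phi>_def)
  from MVT2[OF eps_pos \<Theta>(1)] obtain z where "\<Theta> \<epsilon> = \<epsilon> * \<phi> z"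
    using \<Theta>(2) by auto
  then have t: "0 \<le> \<Theta> \<epsilon>" "\<Theta> \<epsilon> \<le> 5 / 2 * \<epsilon>"
    using \<phi>_bounds[of z] eps_pos mult_left_mono[of "\<phi> z" "5 / 2" \<epsilon>] by auto
  have "\<Theta> \<epsilon> \<le> \<Theta> x1"
    using mono(1) x1 by (simp add: strict_mono_less_eq)
  moreover have "\<epsilon> \<le> \<Lambda> s" if "\<Theta> \<epsilon> \<le> s" for s
    using \<Lambda>_mono[OF that] inv by simp
  ultimately show thesis
    by (intro that[OF S cont\<psi> \<Lambda>[folded \<psi>_def] \<Lambda>0 inv _ up \<psi>_eq t]) (auto intro: low)
qed

end

context smoothed_abs
begin

text \<open>
  Without smoothing, the leads are exchanged at \<open>\<parallel>p\<parallel>\<^sub>1 = P = n \<rho>\<close> and \<open>\<parallel>q\<parallel>\<^sub>\<infinity> = Q = (n - 1) \<rho>\<close>, and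
  \<open>m = D = \<rho>\<close>. With smoothing the level \<open>Q\<close> of the exchange is kept. This avoids solving an equation
  for the period: energy conservation at the end of the exchange, where all momenta have absolute value
  \<open>m\<close>, determines \<open>m\<close>; the duration of the lead determines \<open>D\<close>; and the position of both leaders
  at the exchange has to be \<open>(n - 1) D\<close> for the triangle wave to be antiperiodic, so \<open>\<beta>\<close> is the
  difference to \<open>Q\<close>. All these numbers differ from their limits by \<open>O(\<epsilon>)\<close>.
\<close>

lemma characteristic_profile_exists:
  assumes n: "n \<ge> 2" and eps_small: "(real n)\<^sup>2 * \<epsilon> \<le> 1 / 1000"
  shows "\<exists>D m \<beta> f g k. characteristic_profile a b \<epsilon> n D m \<beta> f g k"
proof -
  define N where "N = real n"
  have N: "N \<ge> 2"
    using n by (simp add: N_def)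
  have eps: "\<epsilon> \<le> 1 / 4000" "N * \<epsilon> \<le> 1 / 2000" "0 \<le> N * \<epsilon>"
  proof -
    have "N * (N * \<epsilon>) \<le> 1 / 1000"
      using eps_small by (simp add: N_def power2_eq_square mult.assoc)
    moreover have "2 * (N * \<epsilon>) \<le> N * (N * \<epsilon>)"
      using N eps_pos by (intro mult_right_mono) auto
    moreover have "2 * \<epsilon> \<le> N * \<epsilon>"
      using N eps_pos by (intro mult_right_mono) auto
    ultimately show "\<epsilon> \<le> 1 / 4000" "N * \<epsilon> \<le> 1 / 2000" "0 \<le> N * \<epsilon>"
      using eps_pos by linarith+
  qed
  define \<rho> where "\<rho> = 1 / sqrt (N\<^sup>2 + (N - 1)\<^sup>2)"
  define Q where "Q = (N - 1) * \<rho>"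
  define P where "P = N * \<rho>"
  have sum_pos: "N\<^sup>2 + (N - 1)\<^sup>2 > 0"
    using N by (simp add: add_pos_nonneg)
  have \<rho>: "\<rho> > 0"
    using sum_pos by (simp add: \<rho>_def)
  have "\<rho>\<^sup>2 * (N\<^sup>2 + (N - 1)\<^sup>2) = 1"
    using sum_pos by (simp add: \<rho>_def power_divide)
  then have PQ: "P\<^sup>2 + Q\<^sup>2 = 1"
    by (simp only: P_def Q_def power_mult_distrib distrib_left mult.commute[of _ "\<rho>\<^sup>2"])
  have QP: "Q \<le> P" "P \<le> 2 * Q" "0 < Q" "\<rho> = P - Q"
    using N \<rho> by (auto simp: P_def Q_def algebra_simps)
  have Q: "2 / 5 \<le> Q" "Q \<le> 71 / 100" and P: "7 / 10 \<le> P" "P \<le> 92 / 100"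
  proof -
    have "P\<^sup>2 \<le> (2 * Q)\<^sup>2" "Q\<^sup>2 \<le> P\<^sup>2"
      by (rule power_mono; use QP in linarith)+
    then have *: "1 / 5 \<le> Q\<^sup>2" "Q\<^sup>2 \<le> 1 / 2" "1 / 2 \<le> P\<^sup>2" "P\<^sup>2 \<le> 4 / 5"
      using PQ by (auto simp: power_mult_distrib)
    show "2 / 5 \<le> Q" by (rule power2_le_imp_le) (use * QP in \<open>auto simp: power2_eq_square\<close>)
    show "Q \<le> 71 / 100" by (rule power2_le_imp_le) (use * in \<open>auto simp: power2_eq_square\<close>)
    show "7 / 10 \<le> P" by (rule power2_le_imp_le) (use * QP in \<open>auto simp: power2_eq_square\<close>)
    show "P \<le> 92 / 100" by (rule power2_le_imp_le) (use * in \<open>auto simp: power2_eq_square\<close>)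
  qed
  define M where "M v = Q + a (2 * v) / 2" for v
  define A where "A v = sqrt (1 - (M v)\<^sup>2)" for v
  obtain \<kappa> W where cont\<kappa>: "continuous_on UNIV \<kappa>" and W: "\<And>v. (W has_real_derivative - \<kappa> v) (at v)"
    and W_0: "\<And>v. v \<ge> \<epsilon> / 2 \<Longrightarrow> W v = 0" and \<kappa>_0: "\<And>v. v \<ge> \<epsilon> / 2 \<Longrightarrow> \<kappa> v = 0"
    and \<kappa>_nonneg: "\<And>v. 0 \<le> \<kappa> v" and I: "0 \<le> W (- (\<epsilon> / 2))" "W (- (\<epsilon> / 2)) \<le> 11 / 10 * \<epsilon>"
    and \<kappa>_eq: "\<And>v. \<bar>v\<bar> \<le> \<epsilon> / 2 \<Longrightarrow> \<kappa> v = M v / A v * (1 - b (2 * v)) / 2"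
    and W_sum: "\<And>v. \<bar>v\<bar> \<le> \<epsilon> / 2 \<Longrightarrow> W v + W (- v) = W (- (\<epsilon> / 2)) + A (\<epsilon> / 2) - A v"
    and A_bounds: "\<And>v. \<bar>v\<bar> \<le> \<epsilon> / 2 \<Longrightarrow> 69 / 100 \<le> A v" "\<And>v. \<bar>v\<bar> \<le> \<epsilon> / 2 \<Longrightarrow> A v \<le> 92 / 100"
    and circle: "\<And>v. \<bar>v\<bar> \<le> \<epsilon> / 2 \<Longrightarrow> (A v)\<^sup>2 + (M v)\<^sup>2 = 1"
    by (rule transition_solution[OF Q eps(1), folded M_def, folded A_def]) (rule that; assumption)
  define \<alpha> where "\<alpha> = A (\<epsilon> / 2)"
  define I where "I = W (- (\<epsilon> / 2))"
  define m where "m = (\<alpha> + I) / N"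
  define c where "c = (N - 1) * m"
  define x1 where "x1 = m - I"
  have half: "\<bar>\<epsilon> / 2\<bar> \<le> \<epsilon> / 2" "\<bar>- (\<epsilon> / 2)\<bar> \<le> \<epsilon> / 2"
    using eps_pos by auto
  have \<alpha>: "69 / 100 \<le> \<alpha>" "\<alpha> \<le> 92 / 100" and M1: "M (\<epsilon> / 2) = Q + \<epsilon> / 2"
    and \<alpha>_circle: "\<alpha>\<^sup>2 + (Q + \<epsilon> / 2)\<^sup>2 = 1"
    using A_bounds[OF half(1)] circle[OF half(1)] a_abs[of \<epsilon>] eps_pos by (auto simp: \<alpha>_def M_def)
  have Nm: "N * m = \<alpha> + I"
    using N by (simp add: m_def)
  have I': "0 \<le> I" "I \<le> 11 / 10 * \<epsilon>"
    using I by (auto simp: I_def)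
  have "\<bar>\<alpha> - P\<bar> \<le> 5 / 4 * \<bar>(Q + \<epsilon> / 2) - Q\<bar>"
    by (rule unit_circle_lipschitz[OF \<alpha>_circle PQ]) (use Q P \<alpha> eps eps_pos in auto)
  then have \<alpha>P: "\<bar>\<alpha> - P\<bar> \<le> 5 / 8 * \<epsilon>"
    using eps_pos by simp
  then have NmP: "\<bar>N * m - P\<bar> \<le> 2 * \<epsilon>"
    using I' eps_pos unfolding Nm by linarith
  have cQ: "\<bar>c - Q\<bar> \<le> 2 * \<epsilon>"
  proof -
    have "N * (c - Q) = (N - 1) * (N * m - P)"
      by (simp add: c_def Q_def P_def algebra_simps)
    then have "N * \<bar>c - Q\<bar> = (N - 1) * \<bar>N * m - P\<bar>"
    proof -
      have "\<bar>N * (c - Q)\<bar> = \<bar>(N - 1) * (N * m - P)\<bar>"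
        using \<open>N * (c - Q) = (N - 1) * (N * m - P)\<close> by (rule arg_cong)
      then show ?thesis
        using N unfolding abs_mult by simp
    qed
    also have "\<dots> \<le> N * (2 * \<epsilon>)"
      using N NmP eps_pos by (intro mult_mono) auto
    finally show ?thesis
      using N by simp
  qed
  have c_ge: "39 / 100 \<le> c"
    using cQ Q eps by linarith
  have c_x1: "c + x1 = \<alpha>"
    using Nm by (simp add: c_def x1_def algebra_simps)
  have c_x1_le: "c + x1 \<le> 92 / 100"
    using c_x1 \<alpha>(2) by simp
  have x1_ge: "\<epsilon> \<le> x1"
  proof -
    have "N * I \<le> N * (11 / 10 * \<epsilon>)"
      using N I' by (intro mult_left_mono) auto
    then have "N * I \<le> 11 / 20000"
      using eps(2) by linarith
    moreover have "N * x1 = \<alpha> + I - N * I"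
      using Nm by (simp add: x1_def algebra_simps)
    ultimately have "N * \<epsilon> \<le> N * x1"
      using \<alpha> I' eps(2) by linarith
    then show ?thesis
      using N by simp
  qed
  obtain S \<Lambda> \<psi> t where S: "S > 0" and cont\<psi>: "continuous_on UNIV \<psi>"
    and \<Lambda>: "\<And>s. (\<Lambda> has_real_derivative \<psi> s) (at s)" and \<Lambda>0: "\<Lambda> 0 = 0" and \<Lambda>S: "\<Lambda> S = x1"
    and \<Lambda>_bounds: "\<And>s. 0 \<le> s \<Longrightarrow> s \<le> S \<Longrightarrow> 0 \<le> \<Lambda> s" "\<And>s. s \<le> S \<Longrightarrow> \<Lambda> s \<le> x1"
    and \<psi>_eq: "\<And>s. 0 \<le> s \<Longrightarrow> s \<le> S \<Longrightarrow> \<psi> s = sqrt (1 - (c + a (\<Lambda> s))\<^sup>2) / (c + a (\<Lambda> s))"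
    and t: "0 \<le> t" "t \<le> 5 / 2 * \<epsilon>" "t \<le> S" and \<Lambda>_t: "\<And>s. t \<le> s \<Longrightarrow> \<epsilon> \<le> \<Lambda> s"
    by (rule lead_solution[OF c_ge x1_ge c_x1_le]) (rule that; assumption)
  define D where "D = S + \<epsilon> / 2"
  have D_pos: "D > 0" and DS: "D - \<epsilon> / 2 = S"
    using S eps_pos by (auto simp: D_def)
  \<comment> \<open>The two formulas for the force agree when the transition begins.\<close>
  have junction: "\<psi> S = \<kappa> (- (\<epsilon> / 2))"
  proof -
    have "\<psi> S = sqrt (1 - \<alpha>\<^sup>2) / \<alpha>"
      using \<psi>_eq[of S] S \<Lambda>S a_abs[of x1] x1_ge eps_pos c_x1 by simp
    also have "1 - \<alpha>\<^sup>2 = (Q + \<epsilon> / 2)\<^sup>2"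
      using \<alpha>_circle by simp
    also have "sqrt \<dots> = Q + \<epsilon> / 2"
      using Q eps_pos by simp
    finally have "\<psi> S = (Q + \<epsilon> / 2) / \<alpha>" .
    moreover have M: "M (- (\<epsilon> / 2)) = M (\<epsilon> / 2)" and b: "b (2 * - (\<epsilon> / 2)) = - 1"
      using a_even[of \<epsilon>] b_minus_one[of "- \<epsilon>"] by (auto simp: M_def)
    have "A (- (\<epsilon> / 2)) = \<alpha>"
      unfolding \<alpha>_def A_def M ..
    with \<kappa>_eq[OF half(2)] have "\<kappa> (- (\<epsilon> / 2)) = (Q + \<epsilon> / 2) / \<alpha> * (1 - - 1) / 2"
      unfolding b M M1 by (simp only:)
    moreover have "y / \<alpha> * (1 - - 1) / 2 = y / \<alpha>" for y
      by simp
    ultimately show ?thesis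
      by (simp only:)
  qed
  define k where "k s = (if \<bar>s\<bar> \<le> S then \<psi> \<bar>s\<bar> else \<kappa> (\<bar>s\<bar> - D))" for s
  have k_lead: "k s = \<psi> s" if "0 \<le> s" "s \<le> S" for s
    using that by (simp add: k_def)
  have k_trans: "k s = \<kappa> (s - D)" if "s \<ge> S" for s
    using that S junction by (cases "s = S") (auto simp: k_def D_def)
  have k_cont: "continuous_on UNIV k"
    unfolding k_def
  proof (rule continuous_on_cases_le[where h = abs and a = S and S = UNIV, simplified])
    show "continuous_on {t. \<bar>t\<bar> \<le> S} (\<lambda>s. \<psi> \<bar>s\<bar>)"
      by (intro continuous_on_compose2[OF cont\<psi>] continuous_intros) auto
    show "continuous_on {t. S \<le> \<bar>t\<bar>} (\<lambda>s. \<kappa> (\<bar>s\<bar> - D))"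
      by (intro continuous_on_compose2[OF cont\<kappa>] continuous_intros) auto
    show "continuous_on UNIV (abs :: real \<Rightarrow> real)"
      by (intro continuous_intros)
    show "\<psi> \<bar>t\<bar> = \<kappa> (\<bar>t\<bar> - D)" if "\<bar>t\<bar> = S" for t
      using that junction by (simp add: D_def)
  qed
  have k_even: "k (- s) = k s" for s
    by (simp add: k_def)
  obtain g where g: "\<And>s. (g has_real_derivative - k s) (at s)" "g 0 = 0"
    using antiderivative_exists[OF continuous_on_minus[OF k_cont]] by blast
  have g_odd: "g (- s) = - g s" for s
  proof -
    have "((\<lambda>s. g s + g (- s)) has_real_derivative 0) (at x)" for x
    proof -
      have "((\<lambda>s. g (- s)) has_real_derivative - k (- x) * - 1) (at x)"
        by (rule DERIV_chain2[where f = g and g = uminus, OF g(1)]) (auto intro!: derivative_eq_intros)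
      from DERIV_add[OF g(1) this] show ?thesis
        by (simp add: k_even)
    qed
    then have "g s + g (- s) = g 0 + g (- 0)"
      by (intro DERIV_isconst_all) auto
    then show ?thesis
      using g(2) by simp
  qed
  have "continuous_on UNIV g"
    using g(1) by (rule DERIV_continuous_on[OF has_field_derivative_at_within])
  then have "continuous_on UNIV (\<lambda>s. b (g s))"
    by (rule continuous_on_compose2[OF b_cont]) auto
  then obtain F where F: "\<And>s. (F has_real_derivative b (g s)) (at s)" "F D = 0"
    using antiderivative_exists by blast
  define f where "f s = F s + (N - 1) * D" for s
  have f: "(f has_real_derivative b (g s)) (at s)" "f D = (N - 1) * D" for s
    using DERIV_add[OF F(1) DERIV_const[of "(N - 1) * D"]] F(2) by (auto simp: f_def[abs_def])
  have f_even: "f (- s) = f s" for s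
  proof -
    have "((\<lambda>s. f s - f (- s)) has_real_derivative b (g x) - b (g (- x)) * - 1) (at x)" for x
      by (rule DERIV_diff[OF f(1) DERIV_chain2[where f = f and g = uminus, OF f(1)]])
        (auto intro!: derivative_eq_intros)
    then have "((\<lambda>s. f s - f (- s)) has_real_derivative 0) (at x)" for x
      by (simp add: g_odd b_odd)
    then have "f s - f (- s) = f 0 - f (- 0)"
      by (intro DERIV_isconst_all) auto
    then show ?thesis
      by simp
  qed
  have g_lead: "g s = - \<Lambda> s" if "0 \<le> s" "s \<le> S" for s
  proof -
    have "g s + \<Lambda> s = g 0 + \<Lambda> 0"
    proof (rule DERIV_zero_imp_eq_on_interval[where h = "\<lambda>s. g s + \<Lambda> s" and u = 0 and v = S])
      show "((\<lambda>s. g s + \<Lambda> s) has_real_derivative 0) (at x)" if "x \<in> {0..S}" for x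
        using that k_lead[of x] by (auto intro!: derivative_eq_intros g \<Lambda>)
    qed (use that S in auto)
    then show ?thesis
      using g(2) \<Lambda>0 by simp
  qed
  have g_trans: "g s = - m + W (s - D)" if "s \<ge> S" for s
  proof -
    have "g s - W (s - D) = g S - W (S - D)"
    proof (rule DERIV_zero_imp_eq_on_interval[where h = "\<lambda>s. g s - W (s - D)" and u = S and v = s])
      show "((\<lambda>s. g s - W (s - D)) has_real_derivative 0) (at x)" if "x \<in> {S..s}" for x
      proof -
        have "((\<lambda>s. W (s - D)) has_real_derivative - \<kappa> (x - D) * 1) (at x)"
          by (rule DERIV_chain2[where f = W and g = "\<lambda>s. s - D", OF W]) (auto intro!: derivative_eq_intros)
        from DERIV_diff[OF g(1) this] show ?thesis
          using that k_trans[of x] by simp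
      qed
    qed (use that in auto)
    moreover have "S - D = - (\<epsilon> / 2)"
      by (simp add: D_def)
    ultimately show ?thesis
      using g_lead[of S] S \<Lambda>S by (simp add: x1_def I_def)
  qed
  have W_le: "W v \<le> I" if "- (\<epsilon> / 2) \<le> v" for v
    unfolding I_def
  proof (rule DERIV_nonpos_imp_nonincreasing[OF that])
    show "\<exists>y. (W has_real_derivative y) (at x) \<and> y \<le> 0" for x
      using W[of x] \<kappa>_nonneg[of x] by (intro exI[of _ "- \<kappa> x"]) simp
  qed
  have g_le: "g s \<le> - \<epsilon>" if "s \<ge> S" for s
    using g_trans[OF that] W_le[of "s - D"] that x1_ge by (simp add: x1_def D_def)
  have f_eq: "f s = N * D - s" if "s \<ge> S" for s
  proof -
    have "f s + s = f D + D"
    proof (rule DERIV_zero_imp_eq_on_interval[where h = "\<lambda>s. f s + s" and u = S and v = "max s D"])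
      show "((\<lambda>s. f s + s) has_real_derivative 0) (at x)" if "x \<in> {S..max s D}" for x
        using that g_le[of x] b_minus_one[of "g x"] by (auto intro!: derivative_eq_intros f)
    qed (use that eps_pos in \<open>auto simp: D_def\<close>)
    then show ?thesis
      using f(2) by (simp add: algebra_simps)
  qed
  have g_nonpos: "g s \<le> 0" if "0 \<le> s" for s
    using g_lead[of s] \<Lambda>_bounds(1)[of s] g_le[of s] that eps_pos by (cases "s \<le> S") auto
  have f_le: "f s \<le> N * D - s" and f_ge: "f s \<ge> N * D - s - 5 / 2 * \<epsilon>" if "0 \<le> s" for s
  proof -
    have zero: "f s = N * D - s" if "t \<le> s" for s
    proof -
      have "f s + s = f (max s S) + max s S"
      proof (rule DERIV_zero_imp_eq_on_interval[where h = "\<lambda>s. f s + s" and u = t and v = "max s S"])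
        show "((\<lambda>s. f s + s) has_real_derivative 0) (at x)" if "x \<in> {t..max s S}" for x
        proof -
          have "g x \<le> - \<epsilon>"
            using that t g_lead[of x] \<Lambda>_t[of x] g_le[of x] by (cases "x \<le> S") auto
          then show ?thesis
            using b_minus_one[of "g x"] by (auto intro!: derivative_eq_intros f)
        qed
      qed (use that t in auto)
      then show ?thesis
        using f_eq[of "max s S"] by simp
    qed
    have "f s \<le> N * D - s \<and> f s \<ge> N * D - s - 5 / 2 * \<epsilon>"
    proof (cases "t \<le> s")
      case True
      then show ?thesis
        using zero eps_pos by simp
    next
      case False
      then have st: "s \<le> t"
        by simp
      have "f s + s \<le> f t + t"
      proof (rule DERIV_nonneg_imp_nondecreasing[of s t "\<lambda>s. f s + s", OF st])
        show "\<exists>y. ((\<lambda>s. f s + s) has_real_derivative y) (at x) \<and> 0 \<le> y" for x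
          by (rule exI[of _ "b (g x) + 1"]) (use b_bounds(1)[of "g x"] in \<open>auto intro!: derivative_eq_intros f\<close>)
      qed
      moreover have "f t \<le> f s"
      proof (rule DERIV_nonpos_imp_nonincreasing[of s t f, OF st])
        show "\<exists>y. (f has_real_derivative y) (at x) \<and> y \<le> 0" if "s \<le> x" for x
          using f(1)[of x] b_mono[OF g_nonpos[of x]] that \<open>0 \<le> s\<close> b_zero by auto
      qed
      ultimately show ?thesis
        using zero[of t] t \<open>0 \<le> s\<close> by simp
    qed
    then show "f s \<le> N * D - s" "f s \<ge> N * D - s - 5 / 2 * \<epsilon>"
      by auto
  qed
  define \<beta> where "\<beta> = Q - (N - 1) * D"
  have lead: "f s + \<beta> = sqrt (1 - (c + a (g s))\<^sup>2) \<and> 39 / 100 \<le> c + a (g s) \<and> c + a (g s) \<le> 92 / 100"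
    if "0 \<le> s" "s \<le> S" for s
  proof -
    have cA: "39 / 100 \<le> c + a (\<Lambda> x)" "c + a (\<Lambda> x) \<le> 92 / 100" if "x \<in> {0..S}" for x
      using a_nonneg[of "\<Lambda> x"] c_ge a_mono[of "\<Lambda> x" x1] \<Lambda>_bounds[of x] that a_abs[of x1] x1_ge eps_pos c_x1 \<alpha>
      by auto
    have "f s - sqrt (1 - (c + a (\<Lambda> s))\<^sup>2) = f S - sqrt (1 - (c + a (\<Lambda> S))\<^sup>2)"
    proof (rule DERIV_zero_imp_eq_on_interval[where h = "\<lambda>s. f s - sqrt (1 - (c + a (\<Lambda> s))\<^sup>2)" and u = 0 and v = S])
      show "((\<lambda>s. f s - sqrt (1 - (c + a (\<Lambda> s))\<^sup>2)) has_real_derivative 0) (at x)" if x: "x \<in> {0..S}" for x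
      proof -
        have "(c + a (\<Lambda> x))\<^sup>2 \<le> (92 / 100)\<^sup>2"
          using cA[OF x] by (intro power_mono) auto
        then have pos: "0 < 1 - (c + a (\<Lambda> x))\<^sup>2"
          by (simp add: power2_eq_square)
        define r where "r = sqrt (1 - (c + a (\<Lambda> x))\<^sup>2)"
        have r: "r > 0"
          using pos by (simp add: r_def)
        have "((\<lambda>s. a (\<Lambda> s)) has_real_derivative b (\<Lambda> x) * \<psi> x) (at x)"
          by (rule DERIV_chain2[where f = a and g = \<Lambda>, OF a_deriv \<Lambda>])
        from DERIV_diff[OF DERIV_const[of 1] DERIV_power[OF DERIV_add[OF DERIV_const[of c] this], of 2]]
        have "((\<lambda>s. 1 - (c + a (\<Lambda> s))\<^sup>2) has_real_derivative - (2 * ((c + a (\<Lambda> x)) * (b (\<Lambda> x) * \<psi> x)))) (at x)"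
          by (simp add: mult_ac)
        from DERIV_chain2[where f = sqrt and g = "\<lambda>s. 1 - (c + a (\<Lambda> s))\<^sup>2" and x = x, OF DERIV_real_sqrt[OF pos] this]
        have "((\<lambda>s. sqrt (1 - (c + a (\<Lambda> s))\<^sup>2)) has_real_derivative
            inverse r / 2 * - (2 * ((c + a (\<Lambda> x)) * (b (\<Lambda> x) * \<psi> x)))) (at x)"
          unfolding r_def .
        then have "((\<lambda>s. sqrt (1 - (c + a (\<Lambda> s))\<^sup>2)) has_real_derivative
            - ((c + a (\<Lambda> x)) * (b (\<Lambda> x) * \<psi> x) / r)) (at x)"
          by (simp add: inverse_eq_divide)
        from DERIV_diff[OF f(1) this]
        have "((\<lambda>s. f s - sqrt (1 - (c + a (\<Lambda> s))\<^sup>2)) has_real_derivative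
            b (g x) - - ((c + a (\<Lambda> x)) * (b (\<Lambda> x) * \<psi> x) / r)) (at x)" .
        moreover have "\<psi> x = r / (c + a (\<Lambda> x))"
          using \<psi>_eq[of x] x by (simp add: r_def)
        moreover have "b (g x) = - b (\<Lambda> x)"
          using g_lead[of x] x b_odd by simp
        moreover have "c + a (\<Lambda> x) \<noteq> 0"
          using cA(1)[OF x] by linarith
        ultimately show ?thesis
          using r by simp
      qed
    qed (use that S in auto)
    also have "c + a (\<Lambda> S) = \<alpha>"
      using \<Lambda>S a_abs[of x1] x1_ge eps_pos c_x1 by simp
    also have "sqrt (1 - \<alpha>\<^sup>2) = Q + \<epsilon> / 2"
    proof -
      have "1 - \<alpha>\<^sup>2 = (Q + \<epsilon> / 2)\<^sup>2"
        using \<alpha>_circle by simp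
      then show ?thesis
        using Q eps_pos by simp
    qed
    also have "f S - (Q + \<epsilon> / 2) = - \<beta>"
    proof -
      have "\<beta> = Q - (N * D - D)"
        by (simp add: \<beta>_def left_diff_distrib)
      moreover have "f S = N * D - S"
        using f_eq[of S] by simp
      ultimately show ?thesis
        using DS by linarith
    qed
    finally have "f s + \<beta> = sqrt (1 - (c + a (\<Lambda> s))\<^sup>2)"
      by simp
    moreover have "a (g s) = a (\<Lambda> s)"
      using g_lead[OF that] a_even by simp
    ultimately show ?thesis
      using cA[of s] that by simp
  qed
  \<comment> \<open>Compare two expressions for the position at the maximum: energy conservation, and the length of the
    way back to the exchange, which is shortened by at most \<open>5 / 2 \<epsilon>\<close> while the velocity changes sign.\<close>
  have D_close: "\<bar>D - \<rho>\<bar> \<le> 7 * \<epsilon>"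
  proof -
    define y where "y = c + a 0"
    have y: "39 / 100 \<le> y" "\<bar>y - Q\<bar> \<le> 3 * \<epsilon>"
      using c_ge cQ a_nonneg[of 0] a_le[of 0] by (auto simp: y_def)
    have y_le: "y \<le> 3 / 4"
      using y Q eps by linarith
    have f0: "f 0 + \<beta> = sqrt (1 - y\<^sup>2)"
      using lead[of 0] S g(2) by (simp add: y_def)
    have "y\<^sup>2 \<le> (3 / 4)\<^sup>2"
      using y y_le by (intro power_mono) auto
    then have y2: "y\<^sup>2 \<le> 9 / 16"
      by (simp add: power2_eq_square)
    have "\<bar>sqrt (1 - y\<^sup>2) - P\<bar> \<le> 5 / 4 * \<bar>y - Q\<bar>"
    proof (rule unit_circle_lipschitz[OF _ PQ])
      show "(sqrt (1 - y\<^sup>2))\<^sup>2 + y\<^sup>2 = 1"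
        using y2 by simp
      show "3 / 5 \<le> sqrt (1 - y\<^sup>2)"
        using y2 by (intro real_le_rsqrt) (simp add: power2_eq_square)
    qed (use y y_le Q P in auto)
    also have "\<dots> \<le> 5 / 4 * (3 * \<epsilon>)"
      using y(2) by (rule mult_left_mono) simp
    finally have "\<bar>sqrt (1 - y\<^sup>2) - P\<bar> \<le> 15 / 4 * \<epsilon>"
      by simp
    moreover have "f 0 \<le> N * D" "N * D - 5 / 2 * \<epsilon> \<le> f 0"
      using f_le[of 0] f_ge[of 0] by auto
    moreover have "N * D + \<beta> = D + Q"
      by (simp add: \<beta>_def algebra_simps)
    ultimately show ?thesis
      using f0 QP(4) eps_pos by linarith
  qed
  have "characteristic_profile a b \<epsilon> n D m \<beta> f g k"
  proof (unfold_locales, unfold N_def[symmetric] DS)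
    show "n \<ge> 2" "N\<^sup>2 * \<epsilon> \<le> 1 / 1000"
      using n eps_small by (auto simp: N_def)
    show "D \<ge> 69 / 100 / N"
    proof -
      have "N * \<bar>D - \<rho>\<bar> \<le> N * (7 * \<epsilon>)"
        using N D_close by (intro mult_left_mono) auto
      moreover have "N * (\<rho> - D) \<le> N * \<bar>D - \<rho>\<bar>"
        using N by (intro mult_left_mono) auto
      moreover have "N * (\<rho> - D) = P - N * D"
        by (simp add: P_def algebra_simps)
      ultimately have "69 / 100 \<le> N * D"
        using P eps(2) by linarith
      then show ?thesis
        using N by (simp add: divide_le_eq mult.commute)
    qed
    show "D \<le> 1"
      using D_close QP(4) P Q eps by linarith
    show "\<bar>\<beta>\<bar> \<le> 7 * N * \<epsilon>"
    proof -
      have "\<beta> = (N - 1) * (\<rho> - D)"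
        by (simp add: \<beta>_def Q_def algebra_simps)
      then have "\<bar>\<beta>\<bar> = (N - 1) * \<bar>D - \<rho>\<bar>"
        using N by (simp add: abs_mult abs_minus_commute)
      also have "\<dots> \<le> N * (7 * \<epsilon>)"
        using N D_close by (intro mult_mono) auto
      finally show ?thesis
        by simp
    qed
    show "\<epsilon> \<le> m"
      using x1_ge I' by (simp add: x1_def)
    show "(f has_real_derivative b (g s)) (at s)" "(g has_real_derivative - k s) (at s)" for s
      by (rule f g)+
    show "continuous_on UNIV k"
      by (rule k_cont)
    show "f (- s) = f s" "g (- s) = - g s" "k (- s) = k s" for s
      by (rule f_even g_odd k_even)+
    show "g s = - m" if "D + \<epsilon> / 2 \<le> s" for s
      using that g_trans[of s] W_0[of "s - D"] eps_pos by (simp add: D_def)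
    show "k s = 0" if "D + \<epsilon> / 2 \<le> s" for s
      using that k_trans[of s] \<kappa>_0[of "s - D"] eps_pos by (simp add: D_def)
    show "f s = N * D - s" if "S \<le> s" for s
      by (rule f_eq[OF that])
    show "f S \<le> f s" if "0 \<le> s" "s \<le> S" for s
    proof (rule DERIV_nonpos_imp_nonincreasing[of s S f, OF that(2)])
      show "\<exists>y. (f has_real_derivative y) (at x) \<and> y \<le> 0" if "s \<le> x" for x
        using f(1)[of x] b_mono[OF g_nonpos[of x]] that \<open>0 \<le> s\<close> b_zero by auto
    qed
    show "N * D - s - 5 / 2 * \<epsilon> \<le> f s" if "0 \<le> s" for s
      by (rule f_ge[OF that])
    show "0 < f s + \<beta> \<and> 0 < (N - 1) * m + a (g s) \<and> ((N - 1) * m + a (g s))\<^sup>2 + (f s + \<beta>)\<^sup>2 = 1 \<and>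
        k s = (f s + \<beta>) / ((N - 1) * m + a (g s))" if s: "0 \<le> s" "s \<le> S" for s
    proof -
      define y where "y = c + a (g s)"
      have y: "f s + \<beta> = sqrt (1 - y\<^sup>2)" "39 / 100 \<le> y" "y \<le> 92 / 100"
        using lead[OF s] by (auto simp: y_def)
      have "y\<^sup>2 \<le> (92 / 100)\<^sup>2"
        using y by (intro power_mono) auto
      then have y2: "y\<^sup>2 < 1"
        by (simp add: power2_eq_square)
      have "c + a (\<Lambda> s) = y"
        using g_lead[OF s] a_even by (simp add: y_def)
      then have "k s = (f s + \<beta>) / y"
        using \<psi>_eq[OF s] k_lead[OF s] y(1) by simp
      moreover have "0 < f s + \<beta>" "y\<^sup>2 + (f s + \<beta>)\<^sup>2 = 1" "0 < y"
        using y y2 by auto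
      ultimately show ?thesis
        unfolding y_def c_def by blast
    qed
    show "\<exists>A M. A > 0 \<and> A\<^sup>2 + M\<^sup>2 = 1 \<and> A = (N - 2) * m + a (g (D + v)) + a (g (D - v)) \<and>
      M = (N - 1) * D + \<beta> + a (2 * v) / 2 \<and> k (D + v) = M / A * (1 - b (2 * v)) / 2" if v: "\<bar>v\<bar> \<le> \<epsilon> / 2" for v
    proof (intro exI conjI)
      show "0 < A v"
        using A_bounds(1)[OF v] by linarith
      show "(A v)\<^sup>2 + (M v)\<^sup>2 = 1"
        by (rule circle[OF v])
      have S_le: "S \<le> D + v" "S \<le> D - v"
        using v by (auto simp: D_def)
      have "a (g (D + v)) = m - W v"
        using g_le[OF S_le(1)] g_trans[OF S_le(1)] a_abs[of "g (D + v)"] eps_pos by simp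
      moreover have "a (g (D - v)) = m - W (- v)"
        using g_le[OF S_le(2)] g_trans[OF S_le(2)] a_abs[of "g (D - v)"] eps_pos by simp
      ultimately show "A v = (N - 2) * m + a (g (D + v)) + a (g (D - v))"
        using W_sum[OF v] Nm by (simp add: \<alpha>_def I_def algebra_simps)
      show "M v = (N - 1) * D + \<beta> + a (2 * v) / 2"
        by (simp add: M_def \<beta>_def)
      show "k (D + v) = M v / A v * (1 - b (2 * v)) / 2"
        using k_trans[OF S_le(1)] \<kappa>_eq[OF v] by simp
    qed
  qed
  then show ?thesis
    by blast
qed

end

section \<open>Antiperiodic extension\<close>

definition sign_of :: "int \<Rightarrow> real" where
  "sign_of l = (if even l then 1 else - 1)"

lemma sign_of_add: "sign_of (k + l) = sign_of k * sign_of l"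
  by (simp add: sign_of_def)

lemma sign_of_cases: "sign_of l = 1 \<or> sign_of l = - 1"
  by (simp add: sign_of_def)

text \<open>
  The values of \<open>u\<close> on \<open>[- L / 2, L / 2)\<close>, continued by \<open>u (x + L) = - u x\<close>.
\<close>

definition antiperiodic_ext :: "real \<Rightarrow> (real \<Rightarrow> real) \<Rightarrow> real \<Rightarrow> real" where
  "antiperiodic_ext L u x = sign_of \<lfloor>x / L + 1 / 2\<rfloor> * u (x - L * of_int \<lfloor>x / L + 1 / 2\<rfloor>)"

text \<open>
  Antiperiodicity on a whole interval around the seam \<open>L / 2\<close>; this makes the extension as regular as
  \<open>u\<close>. As a predicate it also keeps the condition on \<open>u\<close> first-order in the rules below.
\<close>

definition antiperiodic_between :: "real \<Rightarrow> real \<Rightarrow> (real \<Rightarrow> real) \<Rightarrow> bool" where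
  "antiperiodic_between L h u \<longleftrightarrow> (\<forall>x. h \<le> x \<longrightarrow> x \<le> L - h \<longrightarrow> u x = - u (x - L))"

lemma antiperiodic_ext_shift:
  assumes "L > 0"
  shows "antiperiodic_ext L u (x + L * of_int l) = sign_of l * antiperiodic_ext L u x"
proof -
  have "(x + L * of_int l) / L + 1 / 2 = x / L + 1 / 2 + of_int l"
    using assms by (simp add: field_simps)
  then have "\<lfloor>(x + L * of_int l) / L + 1 / 2\<rfloor> = \<lfloor>x / L + 1 / 2\<rfloor> + l"
    by (metis floor_add_int)
  then show ?thesis
    unfolding antiperiodic_ext_def by (simp add: sign_of_add algebra_simps)
qed

lemma antiperiodic_ext_eq:
  assumes L: "L > 0" "0 \<le> h" "h < L / 2"
    and anti: "antiperiodic_between L h u"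
    and x: "\<bar>x\<bar> \<le> L - h"
  shows "antiperiodic_ext L u x = u x"
proof -
  consider "x < - (L / 2)" | "- (L / 2) \<le> x" "x < L / 2" | "L / 2 \<le> x"
    by linarith
  then show ?thesis
  proof cases
    case 1
    have "\<lfloor>x / L + 1 / 2\<rfloor> = - 1"
      using 1 x L by (intro floor_unique) (simp_all add: field_simps)
    moreover have "u (x + L) = - u (x + L - L)"
      using 1 x L by (intro anti[unfolded antiperiodic_between_def, rule_format]) auto
    ultimately show ?thesis
      by (simp add: antiperiodic_ext_def sign_of_def)
  next
    case 2
    have "\<lfloor>x / L + 1 / 2\<rfloor> = 0"
      using 2 L by (intro floor_unique) (simp_all add: field_simps)
    then show ?thesis
      by (simp add: antiperiodic_ext_def sign_of_def)
  next
    case 3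
    have "\<lfloor>x / L + 1 / 2\<rfloor> = 1"
      using 3 x L by (intro floor_unique) (simp_all add: field_simps)
    moreover have "u x = - u (x - L)"
      using 3 x L by (intro anti[unfolded antiperiodic_between_def, rule_format]) auto
    ultimately show ?thesis
      by (simp add: antiperiodic_ext_def sign_of_def)
  qed
qed

lemma antiperiodic_ext_local:
  assumes L: "L > 0" "0 \<le> h" "h < L / 2"
    and anti: "antiperiodic_between L h u"
    and x: "\<bar>x - L * of_int l\<bar> \<le> L - h"
  shows "antiperiodic_ext L u x = sign_of l * u (x - L * of_int l)"
  using antiperiodic_ext_eq[OF L anti x] antiperiodic_ext_shift[OF L(1), of u "x - L * of_int l" l]
  by simp

lemma antiperiodic_window:
  assumes L: "L > 0"
  obtains l :: int where "\<bar>(x :: real) - L * of_int l\<bar> \<le> L / 2"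
proof
  define y where "y = x / L + 1 / 2"
  have "of_int \<lfloor>y\<rfloor> \<le> y" "y \<le> of_int \<lfloor>y\<rfloor> + 1"
    by linarith+
  then have "L * of_int \<lfloor>y\<rfloor> \<le> L * y" "L * y \<le> L * (of_int \<lfloor>y\<rfloor> + 1)"
    using L by (auto intro: mult_left_mono)
  moreover have "L * y = x + L / 2"
    using L by (simp add: y_def distrib_left)
  moreover have "L * (of_int \<lfloor>y\<rfloor> + 1) = L * of_int \<lfloor>y\<rfloor> + L"
    by (simp add: distrib_left)
  ultimately have "\<bar>x - L * of_int \<lfloor>y\<rfloor>\<bar> \<le> L / 2"
    by (intro abs_leI) linarith+
  then show "\<bar>x - L * of_int \<lfloor>x / L + 1 / 2\<rfloor>\<bar> \<le> L / 2"
    by (simp only: y_def)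
qed

lemma antiperiodic_ext_deriv:
  assumes L: "L > 0" "0 \<le> h" "h < L / 2"
    and anti: "antiperiodic_between L h u"
    and anti': "antiperiodic_between L h u'"
    and der: "\<And>x. (u has_real_derivative u' x) (at x)"
  shows "(antiperiodic_ext L u has_real_derivative antiperiodic_ext L u' x) (at x)"
proof -
  obtain l :: int where l: "\<bar>x - L * of_int l\<bar> \<le> L / 2"
    using antiperiodic_window[OF L(1)] .
  have "((\<lambda>y. u (y - L * of_int l)) has_real_derivative u' (x - L * of_int l) * 1) (at x)"
    by (rule DERIV_chain2[where f = u and g = "\<lambda>y. y - L * of_int l", OF der]) (auto intro!: derivative_eq_intros)
  then have "((\<lambda>y. sign_of l * u (y - L * of_int l)) has_real_derivative sign_of l * u' (x - L * of_int l)) (at x)"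
    using DERIV_cmult by fastforce
  also have "sign_of l * u' (x - L * of_int l) = antiperiodic_ext L u' x"
    using antiperiodic_ext_local[OF L anti', of x l] l L by simp
  finally show ?thesis
  proof (rule has_field_derivative_transform_within_open)
    show "open (ball (L * of_int l) (L - h))" "x \<in> ball (L * of_int l) (L - h)"
      using l L by (auto simp: dist_real_def abs_minus_commute)
    show "sign_of l * u (y - L * of_int l) = antiperiodic_ext L u y" if "y \<in> ball (L * of_int l) (L - h)" for y
      using antiperiodic_ext_local[OF L anti, of y l] that by (simp add: dist_real_def abs_minus_commute)
  qed
qed

lemma antiperiodic_ext_cont:
  assumes L: "L > 0" "0 \<le> h" "h < L / 2"
    and anti: "antiperiodic_between L h u"
    and cont: "continuous_on UNIV u"
  shows "continuous_on UNIV (antiperiodic_ext L u)"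
proof -
  have "isCont (antiperiodic_ext L u) x" for x
  proof -
    obtain l :: int where l: "\<bar>x - L * of_int l\<bar> \<le> L / 2"
      using antiperiodic_window[OF L(1)] .
    have "continuous_on UNIV (\<lambda>y. sign_of l * u (y - L * of_int l))"
      by (intro continuous_intros continuous_on_compose2[OF cont]) auto
    then have "continuous_on (ball (L * of_int l) (L - h)) (antiperiodic_ext L u)"
    proof (rule continuous_on_eq[OF continuous_on_subset])
      show "sign_of l * u (y - L * of_int l) = antiperiodic_ext L u y" if "y \<in> ball (L * of_int l) (L - h)" for y
        using antiperiodic_ext_local[OF L anti, of y l] that by (simp add: dist_real_def abs_minus_commute)
    qed simp
    moreover have "x \<in> ball (L * of_int l) (L - h)"
      using l L by (auto simp: dist_real_def abs_minus_commute)
    ultimately show ?thesis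
      by (simp add: continuous_on_eq_continuous_at)
  qed
  then show ?thesis
    by (simp add: continuous_at_imp_continuous_on)
qed

text \<open>
  Renumbering of the coordinates after \<open>w\<close> exchanges of the lead; \<open>l j\<close> counts half periods, hence
  sign changes.
\<close>

lemma mod_shift_bijection:
  fixes e :: "'n :: finite \<Rightarrow> nat" and w :: int
  assumes e: "bij_betw e UNIV {..<CARD('n)}"
  obtains \<pi> l where "bij_betw \<pi> UNIV {..<CARD('n)}"
    "\<And>j. int (e j) - w = int (\<pi> j) + int CARD('n) * l j"
proof
  let ?n = "int CARD('n)"
  define \<pi> where "\<pi> j = nat ((int (e j) - w) mod ?n)" for j
  have n: "?n > 0"
    by simp
  have \<pi>: "int (\<pi> j) = (int (e j) - w) mod ?n" for j
    using n by (simp add: \<pi>_def)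
  show "int (e j) - w = int (\<pi> j) + ?n * ((int (e j) - w) div ?n)" for j
    unfolding \<pi> by simp
  have lt: "\<pi> j < CARD('n)" for j
  proof -
    have "int (\<pi> j) < ?n"
      unfolding \<pi> using n by (rule pos_mod_bound)
    then show ?thesis
      by simp
  qed
  have inj: "inj \<pi>"
  proof (rule injI)
    fix i j assume "\<pi> i = \<pi> j"
    then have "(int (e i) - w) mod ?n = (int (e j) - w) mod ?n"
      using \<pi>[of i] \<pi>[of j] by simp
    then have "(int (e i) - w + w) mod ?n = (int (e j) - w + w) mod ?n"
      by (rule mod_add_cong) simp
    then have "int (e i) mod ?n = int (e j) mod ?n"
      by simp
    moreover have "e i < CARD('n)" "e j < CARD('n)"
      using e bij_betwE by blast+
    ultimately have "e i = e j"
      by (simp flip: of_nat_mod)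
    then show "i = j"
      using e by (auto simp: bij_betw_def dest: injD)
  qed
  have "\<pi> ` UNIV = {..<CARD('n)}"
    by (rule card_subset_eq) (auto simp: lt card_image[OF inj])
  then show "bij_betw \<pi> UNIV {..<CARD('n)}"
    using inj by (simp add: bij_betw_def)
qed

section \<open>The closed characteristic\<close>

context characteristic_profile
begin

lemma smallness: "real n * \<epsilon> \<le> D / 600" "\<epsilon> \<le> D / 1200" "\<bar>\<beta>\<bar> \<le> D / 80" and D_pos: "D > 0"
proof -
  have n2: "real n \<ge> 2"
    using n by simp
  have nD: "69 / 100 \<le> real n * D"
    using D_ge n2 by (simp add: divide_le_eq mult.commute)
  show D: "D > 0"
    using nD n2 by (intro zero_less_mult_pos[of "real n" D]) linarith+
  have "real n * (real n * \<epsilon>) \<le> 1 / 1000"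
    using eps_small by (simp add: power2_eq_square mult.assoc)
  also have "\<dots> \<le> real n * (D / 600)"
    using nD by simp
  finally show 1: "real n * \<epsilon> \<le> D / 600"
    using n2 by simp
  have "2 * \<epsilon> \<le> real n * \<epsilon>"
    using n2 eps_pos by (intro mult_right_mono) auto
  then show "\<epsilon> \<le> D / 1200"
    using 1 by linarith
  have "7 * real n * \<epsilon> \<le> D / 80"
    using 1 D by linarith
  then show "\<bar>\<beta>\<bar> \<le> D / 80"
    using beta_small by linarith
qed

definition half_period :: real where
  "half_period = 2 * real n * D"

definition ext_f :: "real \<Rightarrow> real" where
  "ext_f = antiperiodic_ext half_period f"

definition ext_g :: "real \<Rightarrow> real" where
  "ext_g = antiperiodic_ext half_period g"

definition ext_k :: "real \<Rightarrow> real" where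
  "ext_k = antiperiodic_ext half_period k"

lemma half_period: "half_period > 0" "0 \<le> D + \<epsilon> / 2" "D + \<epsilon> / 2 < half_period / 2"
proof -
  have "2 * D \<le> real n * D"
    using n D_pos by (intro mult_right_mono) auto
  then show "half_period > 0" "0 \<le> D + \<epsilon> / 2" "D + \<epsilon> / 2 < half_period / 2"
    using D_pos smallness(2) eps_pos unfolding half_period_def by linarith+
qed

lemma f_eq_abs: "\<bar>s\<bar> \<ge> D - \<epsilon> / 2 \<Longrightarrow> f s = real n * D - \<bar>s\<bar>"
  using f_eq[of "\<bar>s\<bar>"] f_even[of s] by (auto simp: abs_if split: if_splits)

lemma f_anti: "antiperiodic_between half_period (D + \<epsilon> / 2) f"
  unfolding antiperiodic_between_def
proof (intro allI impI)
  fix x assume x: "D + \<epsilon> / 2 \<le> x" "x \<le> half_period - (D + \<epsilon> / 2)"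
  have "f x = real n * D - x"
    using x eps_pos by (intro f_eq) linarith
  moreover have "f (half_period - x) = real n * D - (half_period - x)"
    using x eps_pos by (intro f_eq) linarith
  moreover have "f (x - half_period) = f (half_period - x)"
    using f_even[of "half_period - x"] by simp
  ultimately show "f x = - f (x - half_period)"
    by (simp add: half_period_def)
qed

lemma g_anti: "antiperiodic_between half_period (D + \<epsilon> / 2) g"
  unfolding antiperiodic_between_def
proof (intro allI impI)
  fix x assume "D + \<epsilon> / 2 \<le> x" "x \<le> half_period - (D + \<epsilon> / 2)"
  then show "g x = - g (x - half_period)"
    using g_eq[of x] g_eq[of "half_period - x"] g_odd[of "half_period - x"] by simp
qed

lemma k_anti: "antiperiodic_between half_period (D + \<epsilon> / 2) k"
  unfolding antiperiodic_between_def
proof (intro allI impI)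
  fix x assume "D + \<epsilon> / 2 \<le> x" "x \<le> half_period - (D + \<epsilon> / 2)"
  then show "k x = - k (x - half_period)"
    using k_eq[of x] k_eq[of "half_period - x"] k_even[of "half_period - x"] by simp
qed

lemma ext_f_deriv: "(ext_f has_real_derivative b (ext_g s)) (at s)"
proof -
  have "antiperiodic_between half_period (D + \<epsilon> / 2) (\<lambda>s. b (g s))"
    using g_anti b_odd by (auto simp: antiperiodic_between_def)
  from antiperiodic_ext_deriv[OF half_period f_anti this f_deriv]
  have "(ext_f has_real_derivative antiperiodic_ext half_period (\<lambda>s. b (g s)) s) (at s)"
    by (simp add: ext_f_def)
  moreover have "antiperiodic_ext half_period (\<lambda>s. b (g s)) s = b (ext_g s)"
    by (simp add: antiperiodic_ext_def ext_g_def sign_of_def b_odd)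
  ultimately show ?thesis
    by simp
qed

lemma ext_g_deriv: "(ext_g has_real_derivative - ext_k s) (at s)"
proof -
  have "antiperiodic_between half_period (D + \<epsilon> / 2) (\<lambda>s. - k s)"
    using k_anti by (auto simp: antiperiodic_between_def)
  from antiperiodic_ext_deriv[OF half_period g_anti this g_deriv]
  have "(ext_g has_real_derivative antiperiodic_ext half_period (\<lambda>s. - k s) s) (at s)"
    by (simp add: ext_g_def)
  moreover have "antiperiodic_ext half_period (\<lambda>s. - k s) s = - ext_k s"
    by (simp add: antiperiodic_ext_def ext_k_def)
  ultimately show ?thesis
    by simp
qed

lemma ext_k_cont: "continuous_on UNIV ext_k"
  unfolding ext_k_def by (rule antiperiodic_ext_cont[OF half_period k_anti k_cont])

lemma ext_g_cont: "continuous_on UNIV ext_g"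
  by (rule DERIV_continuous_on[OF has_field_derivative_at_within[OF ext_g_deriv]])

lemma ext_shift:
  "ext_f (x + half_period * of_int l) = sign_of l * ext_f x"
  "ext_g (x + half_period * of_int l) = sign_of l * ext_g x"
  "ext_k (x + half_period * of_int l) = sign_of l * ext_k x"
  unfolding ext_f_def ext_g_def ext_k_def by (rule antiperiodic_ext_shift[OF half_period(1)])+

lemma ext_eq:
  assumes "\<bar>x\<bar> \<le> half_period - (D + \<epsilon> / 2)"
  shows "ext_f x = f x" "ext_g x = g x" "ext_k x = k x"
  unfolding ext_f_def ext_g_def ext_k_def
  by (rule antiperiodic_ext_eq[OF half_period f_anti assms] antiperiodic_ext_eq[OF half_period g_anti assms]
      antiperiodic_ext_eq[OF half_period k_anti assms]; assumption)+

lemma lead_abs: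
  assumes "\<bar>s\<bar> \<le> D - \<epsilon> / 2"
  shows "f s + \<beta> > 0" "(real n - 1) * m + a (g s) > 0"
    "((real n - 1) * m + a (g s))\<^sup>2 + (f s + \<beta>)\<^sup>2 = 1"
    "k s = (f s + \<beta>) / ((real n - 1) * m + a (g s))"
  using lead[of "\<bar>s\<bar>"] assms f_even[of s] k_even[of s] g_odd[of s] a_even[of "g s"]
  by (cases "s \<ge> 0"; simp)+

lemma a_m: "a m = m"
  using m_ge a_abs[of m] eps_pos by simp

lemma g_far: "\<bar>s\<bar> \<ge> D + \<epsilon> / 2 \<Longrightarrow> a (g s) = m"
  using g_eq[of "\<bar>s\<bar>"] g_odd[of s] a_even[of m] a_m by (cases "s \<ge> 0") auto

lemma k_far: "\<bar>s\<bar> \<ge> D + \<epsilon> / 2 \<Longrightarrow> k s = 0"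
  using k_eq[of "\<bar>s\<bar>"] k_even[of s] by (cases "s \<ge> 0") auto

text \<open>
  The equations from the maximum of one coordinate at time \<open>0\<close> to the maximum of its successor at time
  \<open>2D\<close>, at which the successor has position \<open>f (2 * D - s)\<close>. Because \<open>smooth_max\<close> and its weights
  are the plain maximum away from the diagonal, one form covers the time before, during and after the
  exchange.
\<close>

definition exchange_at :: "real \<Rightarrow> bool" where
  "exchange_at s \<longleftrightarrow> (\<exists>A M. A > 0 \<and> A\<^sup>2 + M\<^sup>2 = 1 \<and>
    A = (real n - 2) * m + a (g s) + a (g (2 * D - s)) \<and>
    M = smooth_max (f s + \<beta>) (f (2 * D - s) + \<beta>) \<and>
    k s = M / A * ((1 + b (f s - f (2 * D - s))) / 2) \<and>
    k (2 * D - s) = M / A * ((1 - b (f s - f (2 * D - s))) / 2))"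

lemma exchange_at_reflect:
  assumes "exchange_at s"
  shows "exchange_at (2 * D - s)"
proof -
  from assms obtain A M where AM: "A > 0" "A\<^sup>2 + M\<^sup>2 = 1"
    "A = (real n - 2) * m + a (g s) + a (g (2 * D - s))"
    "M = smooth_max (f s + \<beta>) (f (2 * D - s) + \<beta>)"
    "k s = M / A * ((1 + b (f s - f (2 * D - s))) / 2)"
    "k (2 * D - s) = M / A * ((1 - b (f s - f (2 * D - s))) / 2)"
    unfolding exchange_at_def by blast
  have b: "b (f (2 * D - s) - f s) = - b (f s - f (2 * D - s))"
    using b_odd[of "f s - f (2 * D - s)"] by simp
  have s: "2 * D - (2 * D - s) = s"
    by simp
  show ?thesis
    unfolding exchange_at_def s b
  proof (intro exI conjI)
    show "A > 0" "A\<^sup>2 + M\<^sup>2 = 1"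
      by (fact AM)+
    show "A = (real n - 2) * m + a (g (2 * D - s)) + a (g s)"
      using AM(3) by simp
    show "M = smooth_max (f (2 * D - s) + \<beta>) (f s + \<beta>)"
      using AM(4) smooth_max_commute by simp
    show "k (2 * D - s) = M / A * ((1 + - b (f s - f (2 * D - s))) / 2)"
      "k s = M / A * ((1 - - b (f s - f (2 * D - s))) / 2)"
      using AM(5,6) by simp_all
  qed
qed

lemma exchange_before:
  assumes "0 \<le> s" "s \<le> D - \<epsilon> / 2"
  shows "exchange_at s"
proof -
  define A where "A = (real n - 1) * m + a (g s)"
  have L: "A > 0" "A\<^sup>2 + (f s + \<beta>)\<^sup>2 = 1" "k s = (f s + \<beta>) / A"
    using lead[OF assms] by (auto simp: A_def)
  have far: "\<bar>2 * D - s\<bar> \<ge> D + \<epsilon> / 2"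
    using assms eps_pos by linarith
  have "f (2 * D - s) = real n * D - (2 * D - s)"
    using assms eps_pos by (intro f_eq) linarith
  moreover have "f s \<ge> real n * D - (D - \<epsilon> / 2)"
    using f_ge_lead[OF assms] f_eq[of "D - \<epsilon> / 2"] by simp
  ultimately have gap: "f (2 * D - s) + \<epsilon> \<le> f s"
    using assms by linarith
  then have "smooth_max (f s + \<beta>) (f (2 * D - s) + \<beta>) = f s + \<beta>"
    by (intro smooth_max_eq) simp
  moreover have "b (f s - f (2 * D - s)) = 1"
    using gap by (intro b_one) simp
  moreover have "A = (real n - 2) * m + a (g s) + a (g (2 * D - s))"
    using g_far[OF far] by (simp add: A_def algebra_simps)
  ultimately show ?thesis
    unfolding exchange_at_def using L k_far[OF far] by (intro exI[of _ A] exI[of _ "f s + \<beta>"]) simp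
qed

lemma exchange_during:
  assumes "\<bar>s - D\<bar> \<le> \<epsilon> / 2"
  shows "exchange_at s"
proof -
  define v where "v = s - D"
  have s: "s = D + v" "2 * D - s = D - v"
    by (simp_all add: v_def)
  have "\<bar>v\<bar> \<le> \<epsilon> / 2"
    using assms unfolding v_def .
  then have v: "\<bar>v\<bar> \<le> \<epsilon> / 2" "\<bar>- v\<bar> \<le> \<epsilon> / 2"
    by simp_all
  from transition[OF v(1)] obtain A M where T: "A > 0" "A\<^sup>2 + M\<^sup>2 = 1"
    "A = (real n - 2) * m + a (g (D + v)) + a (g (D - v))"
    "M = (real n - 1) * D + \<beta> + a (2 * v) / 2" "k (D + v) = M / A * (1 - b (2 * v)) / 2"
    by blast
  from transition[OF v(2)] obtain A' M' where T': "A' = (real n - 2) * m + a (g (D - v)) + a (g (D + v))"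
    "M' = (real n - 1) * D + \<beta> + a (2 * v) / 2" "k (D - v) = M' / A' * (1 + b (2 * v)) / 2"
    using a_even[of "2 * v"] b_odd[of "2 * v"] by auto
  have "A' = A" "M' = M"
    using T T' by simp_all
  have f: "f s = real n * D - D - v" "f (2 * D - s) = real n * D - D + v"
    using f_eq[of "D + v"] f_eq[of "D - v"] v unfolding s by auto
  have diff: "f s - f (2 * D - s) = - (2 * v)"
    unfolding f by simp
  have "smooth_max (f s + \<beta>) (f (2 * D - s) + \<beta>) = M"
    unfolding smooth_max_def T(4) using a_even[of "2 * v"] by (simp add: f left_diff_distrib)
  then show ?thesis
    unfolding exchange_at_def diff b_odd using T T'(3) \<open>A' = A\<close> \<open>M' = M\<close>
    by (intro exI[of _ A] exI[of _ M]) (simp add: s)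
qed

lemma exchange:
  assumes "0 \<le> s" "s \<le> 2 * D"
  shows "exchange_at s"
proof -
  consider "s \<le> D - \<epsilon> / 2" | "\<bar>s - D\<bar> \<le> \<epsilon> / 2" | "2 * D - s \<le> D - \<epsilon> / 2"
    by linarith
  then show ?thesis
  proof cases
    case 3
    then have "exchange_at (2 * D - s)"
      using assms by (intro exchange_before) auto
    from exchange_at_reflect[OF this] show ?thesis
      by simp
  next
    case 1
    with assms(1) show ?thesis
      by (rule exchange_before)
  next
    case 2
    then show ?thesis
      by (rule exchange_during)
  qed
qed

lemma f_lower:
  assumes "\<bar>s\<bar> \<le> 2 * D"
  shows "f s \<ge> real n * D - \<bar>s\<bar> - 5 / 2 * \<epsilon>"
  using f_ge[of "\<bar>s\<bar>"] f_eq_abs[of s] f_even[of s] assms eps_pos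
  by (cases "\<bar>s\<bar> \<le> D"; cases "s \<ge> 0") auto

text \<open>
  Going back in time by a multiple \<open>2 D w\<close> of the delay permutes the coordinates cyclically and changes
  some signs. This reduces statements about all times to times near \<open>0\<close> or \<open>D\<close>.
\<close>

lemma shifted_numbering:
  fixes e :: "'n :: finite \<Rightarrow> nat" and w :: int
  assumes e: "bij_betw e UNIV {..<CARD('n)}" and card: "CARD('n) = n"
  obtains \<pi> \<sigma> where "bij_betw \<pi> UNIV {..<n}" "\<And>j. \<sigma> j = 1 \<or> \<sigma> j = - 1"
    "\<And>j s. ext_f (s - 2 * D * real (e j)) = \<sigma> j * ext_f (s - 2 * D * of_int w - 2 * D * real (\<pi> j))"
    "\<And>j s. ext_g (s - 2 * D * real (e j)) = \<sigma> j * ext_g (s - 2 * D * of_int w - 2 * D * real (\<pi> j))"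
    "\<And>j s. ext_k (s - 2 * D * real (e j)) = \<sigma> j * ext_k (s - 2 * D * of_int w - 2 * D * real (\<pi> j))"
proof -
  obtain \<pi> l where \<pi>: "bij_betw \<pi> UNIV {..<CARD('n)}"
    and l: "\<And>j. int (e j) - w = int (\<pi> j) + int CARD('n) * l j"
    using mod_shift_bijection[OF e] by metis
  have arg: "s - 2 * D * real (e j) = s - 2 * D * of_int w - 2 * D * real (\<pi> j) + half_period * of_int (- l j)" for s j
  proof -
    have "real_of_int (int (e j) - w) = real_of_int (int (\<pi> j) + int CARD('n) * l j)"
      by (simp only: l)
    then have "real (e j) = of_int w + real (\<pi> j) + real n * of_int (l j)"
      by (simp add: card)
    then show ?thesis
      by (simp add: half_period_def algebra_simps)
  qed
  show thesis
  proof (rule that[of \<pi> "\<lambda>j. sign_of (- l j)"])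
    show "bij_betw \<pi> UNIV {..<n}"
      using \<pi> card by simp
    show "sign_of (- l j) = 1 \<or> sign_of (- l j) = - 1" for j
      by (rule sign_of_cases)
  qed (simp_all only: arg ext_shift)
qed

lemma far_arguments:
  assumes s: "- (D / 2) \<le> s" "s \<le> 3 / 2 * D" and t: "t < n"
  shows "\<bar>s - 2 * D * real t\<bar> \<le> half_period - (D + \<epsilon> / 2)"
proof -
  have "2 * D * real t \<le> 2 * D * (real n - 1)"
    using t D_pos by (intro mult_left_mono) auto
  moreover have "0 \<le> 2 * D * real t"
    using D_pos by simp
  moreover have "2 * D * (real n - 1) = half_period - 2 * D"
    by (simp add: half_period_def algebra_simps)
  moreover have "4 * D \<le> half_period"
    using n D_pos by (simp add: half_period_def)
  ultimately show ?thesis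
    using s smallness(2) D_pos by (intro abs_leI) linarith+
qed

text \<open>
  Here \<open>r\<close> is the number of coordinates that may lead: one close to a maximum, two around an exchange.
\<close>

lemma other_coordinates:
  assumes s: "- (D / 2) \<le> s" "s \<le> 3 / 2 * D" and t: "t < n" "r \<le> t" "r = 1 \<and> s \<le> D / 2 \<or> r = 2 \<and> D / 2 \<le> s"
  shows "\<bar>f (s - 2 * D * real t)\<bar> \<le> (real n - real r - 1 / 2) * D" "a (g (s - 2 * D * real t)) = m"
    "k (s - 2 * D * real t) = 0"
proof -
  define z where "z = 2 * D * real t"
  have "2 * D * real t \<le> 2 * D * (real n - 1)" "2 * D * real r \<le> z"
    using t D_pos by (auto simp: z_def intro!: mult_left_mono)
  then have z: "z \<le> 2 * (real n * D) - 2 * D" "2 * D * real r \<le> z"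
    by (auto simp: z_def algebra_simps)
  have "(real r + 1 / 2) * D \<le> z - s \<and> 3 / 2 * D \<le> z - s \<and> z - s \<le> 2 * (real n * D) - (real r + 1 / 2) * D"
    using t(3)
  proof
    assume r: "r = 1 \<and> s \<le> D / 2"
    then have "(real r + 1 / 2) * D = 3 / 2 * D" "2 * D * real r = 2 * D"
      by simp_all
    then show ?thesis
      using r s z by linarith
  next
    assume r: "r = 2 \<and> D / 2 \<le> s"
    then have "(real r + 1 / 2) * D = 5 / 2 * D" "2 * D * real r = 4 * D"
      by simp_all
    then show ?thesis
      using r s z D_pos by linarith
  qed
  moreover from this have "\<bar>s - z\<bar> = z - s"
    using D_pos by linarith
  ultimately have y: "(real r + 1 / 2) * D \<le> \<bar>s - 2 * D * real t\<bar>" "3 / 2 * D \<le> \<bar>s - 2 * D * real t\<bar>"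
      "\<bar>s - 2 * D * real t\<bar> \<le> 2 * (real n * D) - (real r + 1 / 2) * D"
    unfolding z_def by simp_all
  have "f (s - 2 * D * real t) = real n * D - \<bar>s - 2 * D * real t\<bar>"
    using y smallness(2) eps_pos D_pos by (intro f_eq_abs) linarith
  then show "\<bar>f (s - 2 * D * real t)\<bar> \<le> (real n - real r - 1 / 2) * D"
    using y by (auto simp: algebra_simps abs_le_iff)
  have "\<bar>s - 2 * D * real t\<bar> \<ge> D + \<epsilon> / 2"
    using y(2) smallness(2) D_pos by linarith
  then show "a (g (s - 2 * D * real t)) = m" "k (s - 2 * D * real t) = 0"
    using g_far k_far by blast+
qed

definition curve_p :: "('n \<Rightarrow> nat) \<Rightarrow> real \<Rightarrow> real ^ 'n" where
  "curve_p e s = (\<chi> j. ext_g (s - 2 * D * real (e j)))"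

definition curve_q :: "('n \<Rightarrow> nat) \<Rightarrow> real \<Rightarrow> real ^ 'n" where
  "curve_q e s = (\<chi> j. ext_f (s - 2 * D * real (e j)))"

lemma b_signed: "\<epsilon> \<le> x \<Longrightarrow> \<sigma> = 1 \<or> \<sigma> = - 1 \<Longrightarrow> b (\<sigma> * x) = \<sigma>"
  using b_one[of x] b_odd[of x] by auto

lemma a_signed: "\<sigma> = 1 \<or> \<sigma> = - 1 \<Longrightarrow> a (\<sigma> * x) = a x"
  using a_even[of x] by auto

text \<open>
  After renumbering, time lies between \<open>- D / 2\<close> and \<open>3 D / 2\<close>. Up to \<open>D / 2\<close> coordinate \<open>0\<close> dominates
  all others by a fixed gap; later coordinates \<open>0\<close> and \<open>1\<close> dominate the rest, by a gap that does not shrink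
  with \<open>\<epsilon>\<close>. The signs from the renumbering cancel since the energy is even in each coordinate.
\<close>

lemma curve_equations:
  fixes e :: "'n :: finite \<Rightarrow> nat" and L :: "'n list"
  assumes e: "bij_betw e UNIV {..<CARD('n)}" and card: "CARD('n) = n"
    and L: "set L = UNIV" "distinct L"
  defines "A \<equiv> \<lambda>s. smooth_norm_1 (curve_p e s)" and "M \<equiv> \<lambda>s. smooth_Max \<beta> L (curve_q e s)"
  shows "\<exists>DM. A s > 0 \<and> (A s)\<^sup>2 + (M s)\<^sup>2 = 1 \<and>
    (smooth_Max \<beta> L has_derivative DM) (at (curve_q e s)) \<and>
    (\<forall>j. - ext_k (s - 2 * D * real (e j)) = - (M s / A s * DM (axis j 1)))"
proof -
  \<comment> \<open>The last time up to \<open>s + D / 2\<close> at which a leading coordinate turns round is \<open>2 D w\<close>.\<close>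
  define w where "w = \<lfloor>(s + D / 2) / (2 * D)\<rfloor>"
  define s' where "s' = s - 2 * D * of_int w"
  have s': "- (D / 2) \<le> s'" "s' \<le> 3 / 2 * D"
  proof -
    have "of_int w \<le> (s + D / 2) / (2 * D)" "(s + D / 2) / (2 * D) \<le> of_int w + 1"
      unfolding w_def by linarith+
    then have "of_int w * (2 * D) \<le> s + D / 2" "s + D / 2 \<le> (of_int w + 1) * (2 * D)"
      using D_pos by (auto simp: pos_le_divide_eq pos_divide_le_eq)
    then show "- (D / 2) \<le> s'" "s' \<le> 3 / 2 * D"
      by (auto simp: s'_def algebra_simps)
  qed
  obtain \<pi> \<sigma> where \<pi>: "bij_betw \<pi> UNIV {..<n}" and \<sigma>: "\<And>j. \<sigma> j = 1 \<or> \<sigma> j = - 1"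
    and ext: "\<And>j s. ext_f (s - 2 * D * real (e j)) = \<sigma> j * ext_f (s - 2 * D * of_int w - 2 * D * real (\<pi> j))"
      "\<And>j s. ext_g (s - 2 * D * real (e j)) = \<sigma> j * ext_g (s - 2 * D * of_int w - 2 * D * real (\<pi> j))"
      "\<And>j s. ext_k (s - 2 * D * real (e j)) = \<sigma> j * ext_k (s - 2 * D * of_int w - 2 * D * real (\<pi> j))"
    by (rule shifted_numbering[OF e card, of w]) (rule that; assumption)
  have \<pi>_lt: "\<pi> j < n" for j
    using \<pi> by (auto dest: bij_betwE)
  have \<pi>_eq: "\<pi> i = \<pi> j \<longleftrightarrow> i = j" for i j
    using \<pi> by (auto simp: bij_betw_def inj_eq)
  have q: "curve_q e s $ j = \<sigma> j * f (s' - 2 * D * real (\<pi> j))"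
    and p: "curve_p e s $ j = \<sigma> j * g (s' - 2 * D * real (\<pi> j))"
    and ext_k: "ext_k (s - 2 * D * real (e j)) = \<sigma> j * k (s' - 2 * D * real (\<pi> j))" for j
    using ext[of s j] ext_eq[OF far_arguments[OF s' \<pi>_lt[of j]]]
    by (simp_all add: curve_q_def curve_p_def s'_def)
  have A_sum: "A s = (\<Sum>t<n. a (g (s' - 2 * D * real t)))"
  proof -
    have "A s = (\<Sum>j\<in>UNIV. a (g (s' - 2 * D * real (\<pi> j))))"
      by (simp add: A_def smooth_norm_1_def p a_signed[OF \<sigma>])
    also have "\<dots> = (\<Sum>t<n. a (g (s' - 2 * D * real t)))"
      by (rule sum.reindex_bij_betw[OF \<pi>])
    finally show ?thesis .
  qed
  have surj: "\<exists>j. \<pi> j = t" if "t < n" for t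
    using \<pi> that by (auto simp: bij_betw_def) (metis UNIV_I image_iff lessThan_iff)
  obtain i where i: "\<pi> i = 0"
    using surj[of 0] n by auto
  obtain i' where i': "\<pi> i' = 1"
    using surj[of 1] n by auto
  have "i \<noteq> i'"
    using i i' by auto
  have nD: "2 * D \<le> real n * D"
    using n D_pos by (intro mult_right_mono) auto
  have len: "real (length L) * (\<epsilon> / 2) + \<epsilon> \<le> D / 4"
  proof -
    have "length L = n"
      using L card distinct_card[of L] by simp
    then have "real (length L) * (\<epsilon> / 2) = real n * \<epsilon> / 2"
      by simp
    then show ?thesis
      using smallness(1,2) D_pos by linarith
  qed
  have a_other: "a (curve_q e s $ j) \<le> \<bar>f (s' - 2 * D * real (\<pi> j))\<bar> + \<epsilon>" for j
    using a_le[of "f (s' - 2 * D * real (\<pi> j))"] by (simp add: q a_signed[OF \<sigma>])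
  show ?thesis
  proof (cases "s' \<le> D / 2")
    case True
    have abs_s': "\<bar>s'\<bar> \<le> D - \<epsilon> / 2"
      using True s' smallness(2) D_pos by (intro abs_leI) linarith+
    note ld = lead_abs[OF abs_s']
    have low: "f s' \<ge> real n * D - D / 2 - 5 / 2 * \<epsilon>"
    proof -
      have "\<bar>s'\<bar> \<le> D / 2"
        using True s' by (intro abs_leI) linarith+
      then show ?thesis
        using f_lower[of s'] D_pos by linarith
    qed
    then have f_ge_eps: "\<epsilon> \<le> f s'"
      using nD smallness(2) D_pos by linarith
    have qi: "a (curve_q e s $ i) = f s'" and bi: "b (curve_q e s $ i) = \<sigma> i"
      using a_abs[of "f s'"] f_ge_eps eps_pos b_signed[OF f_ge_eps \<sigma>] by (simp_all add: q i a_signed[OF \<sigma>])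
    have oth: "\<bar>f (s' - 2 * D * real (\<pi> j))\<bar> \<le> (real n - real 1 - 1 / 2) * D"
      "k (s' - 2 * D * real (\<pi> j)) = 0" if "j \<noteq> i" for j
    proof -
      have "1 \<le> \<pi> j"
        using that \<pi>_eq[of j i] i by (cases "\<pi> j") auto
      then show "\<bar>f (s' - 2 * D * real (\<pi> j))\<bar> \<le> (real n - real 1 - 1 / 2) * D"
        "k (s' - 2 * D * real (\<pi> j)) = 0"
        using other_coordinates[OF s' \<pi>_lt[of j], of 1] True by auto
    qed
    have dom: "smooth_Max \<beta> L (curve_q e s) = a (curve_q e s $ i) + \<beta> \<and>
        (smooth_Max \<beta> L has_derivative (\<lambda>v. b (curve_q e s $ i) * v $ i)) (at (curve_q e s))"
    proof (rule smooth_Max_dominated[where g = "D / 4"])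
      show "a (curve_q e s $ l) + \<beta> + D / 4 \<le> a (curve_q e s $ i) + \<beta>" if "l \<noteq> i" for l
      proof -
        have "a (curve_q e s $ l) \<le> (real n - 1 - 1 / 2) * D + \<epsilon>"
          using a_other[of l] oth(1)[OF that] by simp
        moreover have "(real n - 1 - 1 / 2) * D = real n * D - 3 / 2 * D"
          by (simp add: left_diff_distrib)
        ultimately show ?thesis
          using qi low smallness(2) D_pos by linarith
      qed
      show "D / 4 \<le> a (curve_q e s $ i) + \<beta>"
        using qi low nD smallness(2,3) D_pos by linarith
    qed (use L len in auto)
    have M: "M s = f s' + \<beta>"
      using dom qi by (simp add: M_def)
    have A: "A s = (real n - 1) * m + a (g s')"
    proof -
      have "{..<n} = insert 0 {1..<n}"
        using n by auto
      then have "A s = a (g s') + (\<Sum>t\<in>{1..<n}. a (g (s' - 2 * D * real t)))"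
        unfolding A_sum by simp
      also have "(\<Sum>t\<in>{1..<n}. a (g (s' - 2 * D * real t))) = (\<Sum>t\<in>{1..<n}. m)"
        using other_coordinates(2)[OF s', of _ 1] True by (intro sum.cong) auto
      also have "\<dots> = (real n - 1) * m"
        using n by (simp add: of_nat_diff)
      finally show ?thesis
        by simp
    qed
    show ?thesis
    proof (intro exI conjI allI)
      show "A s > 0" "(A s)\<^sup>2 + (M s)\<^sup>2 = 1"
        unfolding A M by (rule ld)+
      show "(smooth_Max \<beta> L has_derivative (\<lambda>v. b (curve_q e s $ i) * v $ i)) (at (curve_q e s))"
        using dom by blast
      show "- ext_k (s - 2 * D * real (e j)) = - (M s / A s * (b (curve_q e s $ i) * axis j 1 $ i))" for j
      proof (cases "j = i")
        case True
        then show ?thesis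
          using ld(4) by (simp add: ext_k i bi A M)
      next
        case False
        then show ?thesis
          using oth(2) by (simp add: ext_k axis_def)
      qed
    qed
  next
    case False
    then have ge: "D / 2 \<le> s'"
      by simp
    define r where "r = 2 * D - s'"
    have r: "D / 2 \<le> r" "r \<le> 3 / 2 * D"
      using ge s' by (auto simp: r_def)
    have refl: "s' - 2 * D = - r"
      by (simp add: r_def)
    from exchange[of s'] obtain A' M' where ex: "A' > 0" "A'\<^sup>2 + M'\<^sup>2 = 1"
      "A' = (real n - 2) * m + a (g s') + a (g r)"
      "M' = smooth_max (f s' + \<beta>) (f r + \<beta>)"
      "k s' = M' / A' * ((1 + b (f s' - f r)) / 2)" "k r = M' / A' * ((1 - b (f s' - f r)) / 2)"
      using ge s' D_pos unfolding exchange_at_def r_def by auto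
    have low: "f s' \<ge> real n * D - 3 / 2 * D - 5 / 2 * \<epsilon>" "f r \<ge> real n * D - 3 / 2 * D - 5 / 2 * \<epsilon>"
      using f_lower[of s'] f_lower[of r] ge s' r D_pos by auto
    then have ge_eps: "\<epsilon> \<le> f s'" "\<epsilon> \<le> f r"
      using nD smallness(2) D_pos by linarith+
    have qi: "a (curve_q e s $ i) = f s'" and bi: "b (curve_q e s $ i) = \<sigma> i"
      using a_abs[of "f s'"] ge_eps(1) eps_pos b_signed[OF ge_eps(1) \<sigma>] by (simp_all add: q i a_signed[OF \<sigma>])
    have qi': "a (curve_q e s $ i') = f r" and bi': "b (curve_q e s $ i') = \<sigma> i'"
      using a_abs[of "f r"] ge_eps(2) eps_pos b_signed[OF ge_eps(2) \<sigma>] f_even[of r]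
      by (simp_all add: q i' refl a_signed[OF \<sigma>])
    have oth: "\<bar>f (s' - 2 * D * real (\<pi> j))\<bar> \<le> (real n - real 2 - 1 / 2) * D"
      "k (s' - 2 * D * real (\<pi> j)) = 0" if "j \<noteq> i" "j \<noteq> i'" for j
    proof -
      have "\<pi> j \<noteq> 0" "\<pi> j \<noteq> 1"
        using that \<pi>_eq[of j i] \<pi>_eq[of j i'] i i' by auto
      then have "2 \<le> \<pi> j"
        by simp
      then show "\<bar>f (s' - 2 * D * real (\<pi> j))\<bar> \<le> (real n - real 2 - 1 / 2) * D"
        "k (s' - 2 * D * real (\<pi> j)) = 0"
        using other_coordinates[OF s' \<pi>_lt[of j], of 2] ge by auto
    qed
    have small: "a (curve_q e s $ l) + D / 4 \<le> min (f s') (f r)" if "l \<noteq> i" "l \<noteq> i'" for l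
    proof -
      have "a (curve_q e s $ l) \<le> (real n - 2 - 1 / 2) * D + \<epsilon>"
        using a_other[of l] oth(1)[OF that] by simp
      moreover have "(real n - 2 - 1 / 2) * D = real n * D - 5 / 2 * D"
        by (simp add: left_diff_distrib)
      ultimately show ?thesis
        using low smallness(2) D_pos by (intro min.boundedI) linarith+
    qed
    let ?DM = "\<lambda>v :: real ^ 'n. (1 + b (a (curve_q e s $ i) - a (curve_q e s $ i'))) / 2 * (b (curve_q e s $ i) * v $ i) +
      (1 - b (a (curve_q e s $ i) - a (curve_q e s $ i'))) / 2 * (b (curve_q e s $ i') * v $ i')"
    have dom: "smooth_Max \<beta> L (curve_q e s) = smooth_max (a (curve_q e s $ i) + \<beta>) (a (curve_q e s $ i') + \<beta>) \<and>
        (smooth_Max \<beta> L has_derivative ?DM) (at (curve_q e s))"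
    proof (rule smooth_Max_two_dominating[where g = "D / 4"])
      show "a (curve_q e s $ l) + \<beta> + D / 4 \<le> a (curve_q e s $ i) + \<beta>"
        "a (curve_q e s $ l) + \<beta> + D / 4 \<le> a (curve_q e s $ i') + \<beta>" if "l \<noteq> i" "l \<noteq> i'" for l
        using small[OF that] qi qi' by auto
      show "D / 4 \<le> a (curve_q e s $ i) + \<beta>" "D / 4 \<le> a (curve_q e s $ i') + \<beta>"
        using qi qi' low nD smallness(2,3) D_pos by linarith+
    qed (use L len \<open>i \<noteq> i'\<close> in auto)
    have M: "M s = M'"
      using dom qi qi' ex(4) by (simp add: M_def)
    have A: "A s = A'"
    proof -
      have "{..<n} = insert 0 (insert 1 {2..<n})"
        using n by auto
      then have "A s = a (g s') + (a (g (s' - 2 * D)) + (\<Sum>t\<in>{2..<n}. a (g (s' - 2 * D * real t))))"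
        unfolding A_sum by simp
      also have "(\<Sum>t\<in>{2..<n}. a (g (s' - 2 * D * real t))) = (\<Sum>t\<in>{2..<n}. m)"
        using other_coordinates(2)[OF s', of _ 2] ge by (intro sum.cong) auto
      also have "\<dots> = (real n - 2) * m"
        using n by (simp add: of_nat_diff)
      also have "a (g (s' - 2 * D)) = a (g r)"
        unfolding refl g_odd a_even ..
      finally show ?thesis
        using ex(3) by simp
    qed
    show ?thesis
    proof (intro exI conjI allI)
      show "A s > 0" "(A s)\<^sup>2 + (M s)\<^sup>2 = 1"
        unfolding A M by (rule ex)+
      show "(smooth_Max \<beta> L has_derivative ?DM) (at (curve_q e s))"
        using dom by blast
      show "- ext_k (s - 2 * D * real (e j)) = - (M s / A s * ?DM (axis j 1))" for j
      proof -
        consider "j = i" | "j = i'" | "j \<noteq> i" "j \<noteq> i'"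
          by blast
        then show ?thesis
        proof cases
          case 1
          then have DM: "?DM (axis j 1) = (1 + b (f s' - f r)) / 2 * \<sigma> i"
            using \<open>i \<noteq> i'\<close> by (simp add: axis_def qi qi' bi)
          have "ext_k (s - 2 * D * real (e j)) = \<sigma> i * k s'"
            using 1 i by (simp add: ext_k)
          then show ?thesis
            unfolding DM ex(5) A M by simp
        next
          case 2
          then have DM: "?DM (axis j 1) = (1 - b (f s' - f r)) / 2 * \<sigma> i'"
            using \<open>i \<noteq> i'\<close> by (simp add: axis_def qi qi' bi')
          have "ext_k (s - 2 * D * real (e j)) = \<sigma> i' * k r"
            using 2 i' by (simp add: ext_k refl k_even)
          then show ?thesis
            unfolding DM ex(6) A M by simp
        next
          case 3
          then have "?DM (axis j 1) = 0"
            by (simp add: axis_def)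
          moreover have "ext_k (s - 2 * D * real (e j)) = 0"
            using oth(2)[OF 3] by (simp add: ext_k)
          ultimately show ?thesis
            by simp
        qed
      qed
    qed
  qed
qed

lemma leading_coordinate:
  fixes e :: "'n :: finite \<Rightarrow> nat" and w :: int
  assumes e: "bij_betw e UNIV {..<CARD('n)}" and card: "CARD('n) = n"
    and s: "\<bar>s - 2 * D * of_int w\<bar> \<le> D"
  shows "\<exists>j. real n * D - \<bar>s - 2 * D * of_int w\<bar> - 5 / 2 * \<epsilon> \<le> \<bar>curve_q e s $ j\<bar>"
proof -
  obtain \<pi> \<sigma> where \<pi>: "bij_betw \<pi> UNIV {..<n}" and \<sigma>: "\<And>j. \<sigma> j = 1 \<or> \<sigma> j = - 1"
    and ext_f: "\<And>j s. ext_f (s - 2 * D * real (e j)) = \<sigma> j * ext_f (s - 2 * D * of_int w - 2 * D * real (\<pi> j))"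
    by (rule shifted_numbering[OF e card, of w]) (rule that; assumption)
  have "0 \<in> \<pi> ` UNIV"
    using \<pi> n by (auto simp: bij_betw_def)
  then obtain i where i: "\<pi> i = 0"
    by auto
  have "4 * D \<le> half_period"
    using n D_pos by (simp add: half_period_def)
  then have "\<bar>s - 2 * D * of_int w\<bar> \<le> half_period - (D + \<epsilon> / 2)"
    using s smallness(2) D_pos by linarith
  then have "ext_f (s - 2 * D * of_int w) = f (s - 2 * D * of_int w)"
    by (rule ext_eq)
  then have "curve_q e s $ i = \<sigma> i * f (s - 2 * D * of_int w)"
    using ext_f[of s i] i by (simp add: curve_q_def)
  then have "\<bar>f (s - 2 * D * of_int w)\<bar> = \<bar>curve_q e s $ i\<bar>"
    using \<sigma>[of i] by auto
  moreover have "f (s - 2 * D * of_int w) \<ge> real n * D - \<bar>s - 2 * D * of_int w\<bar> - 5 / 2 * \<epsilon>"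
    using s D_pos by (intro f_lower) linarith
  ultimately show ?thesis
    by (intro exI[of _ i]) linarith
qed

definition action_density :: "('n :: finite \<Rightarrow> nat) \<Rightarrow> real \<Rightarrow> real" where
  "action_density e s = (\<Sum>j\<in>UNIV. curve_p e s $ j * b (curve_p e s $ j))"

text \<open>
  Because \<open>x b(x) \<le> a x\<close>, the density is at most the smoothed \<open>1\<close>-norm \<open>A\<close>, and \<open>A + M \<le> \<surd>2\<close> on the
  unit circle; \<open>M\<close> is at least the position of the leading coordinate.
\<close>

lemma action_density_le:
  fixes e :: "'n :: finite \<Rightarrow> nat" and L :: "'n list" and w :: int
  assumes e: "bij_betw e UNIV {..<CARD('n)}" and card: "CARD('n) = n"
    and L: "set L = UNIV" "distinct L" and s: "\<bar>s - 2 * D * of_int w\<bar> \<le> D"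
  shows "action_density e s \<le> sqrt 2 - \<beta> - real n * D + 5 / 2 * \<epsilon> + \<bar>s - 2 * D * of_int w\<bar>"
proof -
  define A where "A = smooth_norm_1 (curve_p e s)"
  define M where "M = smooth_Max \<beta> L (curve_q e s)"
  have circle: "A\<^sup>2 + M\<^sup>2 = 1"
    using curve_equations[OF e card L, of s] by (auto simp: A_def M_def)
  have "x * b x \<le> a x" for x
  proof -
    have "x * b x \<le> \<bar>x\<bar> * \<bar>b x\<bar>"
      by (metis abs_ge_self abs_mult)
    also have "\<dots> \<le> \<bar>x\<bar> * 1"
      using b_bounds[of x] by (intro mult_left_mono) auto
    finally show ?thesis
      using a_ge_abs[of x] by simp
  qed
  then have "action_density e s \<le> A"
    unfolding action_density_def A_def smooth_norm_1_def by (intro sum_mono)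
  also have "A \<le> sqrt 2 - M"
  proof -
    have "(A + M)\<^sup>2 = 2 * (A\<^sup>2 + M\<^sup>2) - (A - M)\<^sup>2"
      by (simp add: power2_eq_square algebra_simps)
    also have "\<dots> \<le> 2"
      unfolding circle by simp
    finally have "A + M \<le> sqrt 2"
      by (rule real_le_rsqrt)
    then show ?thesis
      by simp
  qed
  also have "sqrt 2 - M \<le> sqrt 2 - \<beta> - real n * D + 5 / 2 * \<epsilon> + \<bar>s - 2 * D * of_int w\<bar>"
  proof -
    obtain j where "real n * D - \<bar>s - 2 * D * of_int w\<bar> - 5 / 2 * \<epsilon> \<le> \<bar>curve_q e s $ j\<bar>"
      using leading_coordinate[OF e card s] by blast
    moreover have "\<bar>curve_q e s $ j\<bar> + \<beta> \<le> M"
      using smooth_Max_ge[of j L "curve_q e s" \<beta>] a_ge_abs[of "curve_q e s $ j"] L(1) by (simp add: M_def)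
    ultimately show ?thesis
      by linarith
  qed
  finally show ?thesis .
qed

lemma curve_p_cont: "continuous_on S (curve_p e)"
  unfolding curve_p_def
  by (intro continuous_on_vec_lambda continuous_on_compose2[OF ext_g_cont] continuous_intros) auto

lemma action_density_cont: "continuous_on S (action_density e)"
  unfolding action_density_def
  by (intro continuous_intros continuous_on_compose2[OF b_cont] curve_p_cont) auto

text \<open>
  On intervals of length \<open>D\<close> between maxima and exchanges the bound for the density is linear in
  time, alternately increasing and decreasing.
\<close>

lemma action_density_integral_le:
  fixes e :: "'n :: finite \<Rightarrow> nat" and L :: "'n list" and w :: nat
  assumes e: "bij_betw e UNIV {..<CARD('n)}" and card: "CARD('n) = n"
    and L: "set L = UNIV" "distinct L"
  shows "integral {0..real w * D} (action_density e) \<le>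
    real w * (D * (sqrt 2 - \<beta> - real n * D + 5 / 2 * \<epsilon>) + D\<^sup>2 / 2)"
proof (induction w)
  case (Suc w)
  define c where "c = sqrt 2 - \<beta> - real n * D + 5 / 2 * \<epsilon>"
  define x where "x = real w * D"
  have int: "action_density e integrable_on {u..v}" for u v
    by (rule integrable_continuous_real[OF action_density_cont])
  have "integral {x..x + D} (action_density e) \<le> D * c + D\<^sup>2 / 2"
  proof (cases "even w")
    case True
    then obtain v where w: "w = 2 * v" ..
    have "((\<lambda>s. c + (s - x)) has_integral (c * (x + D) + ((x + D) - x)\<^sup>2 / 2) - (c * x + (x - x)\<^sup>2 / 2)) {x..x + D}"
      using D_pos by (intro fundamental_theorem_of_calculus)
        (auto intro!: derivative_eq_intros simp flip: has_real_derivative_iff_has_vector_derivative)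
    then have lin: "((\<lambda>s. c + (s - x)) has_integral D * c + D\<^sup>2 / 2) {x..x + D}"
      by (simp add: algebra_simps)
    show ?thesis
    proof (rule has_integral_le[OF integrable_integral[OF int] lin])
      fix s assume s: "s \<in> {x..x + D}"
      have "2 * D * of_int (int v) = x"
        by (simp add: x_def w)
      then have abs: "\<bar>s - 2 * D * of_int (int v)\<bar> = s - x"
        using s by simp
      then have "\<bar>s - 2 * D * of_int (int v)\<bar> \<le> D"
        using s by simp
      from action_density_le[OF e card L this] show "action_density e s \<le> c + (s - x)"
        unfolding abs c_def .
    qed
  next
    case False
    then obtain v where w: "w = 2 * v + 1"
      using oddE by blast
    have "((\<lambda>s. c + (x + D - s)) has_integral (c * (x + D) - (x + D - (x + D))\<^sup>2 / 2) - (c * x - (x + D - x)\<^sup>2 / 2)) {x..x + D}"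
    proof (rule fundamental_theorem_of_calculus)
      fix s
      have "((\<lambda>s. c * s - (x + D - s)\<^sup>2 / 2) has_real_derivative c * 1 - 2 * (x + D - s) * (0 - 1) / 2) (at s within {x..x + D})"
        by (auto intro!: derivative_eq_intros)
      moreover have "c * 1 - 2 * (x + D - s) * (0 - 1) / 2 = c + (x + D - s)"
        by (simp add: field_simps)
      ultimately show "((\<lambda>s. c * s - (x + D - s)\<^sup>2 / 2) has_vector_derivative c + (x + D - s)) (at s within {x..x + D})"
        by (simp only: has_real_derivative_iff_has_vector_derivative)
    qed (use D_pos in simp)
    then have lin: "((\<lambda>s. c + (x + D - s)) has_integral D * c + D\<^sup>2 / 2) {x..x + D}"
      by (simp add: algebra_simps)
    show ?thesis
    proof (rule has_integral_le[OF integrable_integral[OF int] lin])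
      fix s assume s: "s \<in> {x..x + D}"
      have "2 * D * of_int (int v + 1) = x + D"
        by (simp add: x_def w algebra_simps)
      then have abs: "\<bar>s - 2 * D * of_int (int v + 1)\<bar> = x + D - s"
        using s by simp
      then have "\<bar>s - 2 * D * of_int (int v + 1)\<bar> \<le> D"
        using s by simp
      from action_density_le[OF e card L this] show "action_density e s \<le> c + (x + D - s)"
        unfolding abs c_def .
    qed
  qed
  moreover have "integral {0..x} (action_density e) + integral {x..x + D} (action_density e) = integral {0..x + D} (action_density e)"
    using D_pos by (intro Henstock_Kurzweil_Integration.integral_combine int) (auto simp: x_def)
  moreover have "x + D = real (Suc w) * D"
    by (simp add: x_def algebra_simps)
  moreover have "integral {0..x} (action_density e) \<le> real w * (D * c + D\<^sup>2 / 2)"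
    using Suc.IH unfolding x_def c_def .
  moreover have "real (Suc w) * (D * c + D\<^sup>2 / 2) = real w * (D * c + D\<^sup>2 / 2) + (D * c + D\<^sup>2 / 2)"
    by (simp add: distrib_right)
  ultimately have "integral {0..real (Suc w) * D} (action_density e) \<le> real (Suc w) * (D * c + D\<^sup>2 / 2)"
    by (metis add_mono)
  then show ?case
    unfolding c_def .
qed simp

text \<open>
  With \<open>h = n - 1 / 2\<close> the integrated bound is \<open>4n (\<surd>2 D - h D\<^sup>2)\<close> up to \<open>O(\<epsilon>)\<close>, and
  \<open>\<surd>2 D - h D\<^sup>2 \<le> 1 / (2 h)\<close> for every \<open>D\<close>, by completing the square.
\<close>

lemma short_closed_characteristic:
  fixes L :: "('n :: finite) list"
  assumes card: "CARD('n) = n" and L: "set L = UNIV" "distinct L"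
  shows "\<exists>T \<gamma>. closed_characteristic {z. smooth_energy \<beta> L z \<le> 1} T \<gamma> \<and>
    action T \<gamma> \<le> 4 * real n / (2 * real n - 1) + 40 * (real n)\<^sup>2 * \<epsilon>"
proof -
  obtain e :: "'n \<Rightarrow> nat" where e: "bij_betw e UNIV {..<CARD('n)}"
    using ex_bij_betw_finite_nat[of "UNIV :: 'n set"] by (auto simp: atLeast0LessThan)
  have small: "real CARD('n) * \<epsilon> \<le> 1 / 8" "\<bar>\<beta>\<bar> \<le> 1 / 4"
    using smallness D_le unfolding card by linarith+
  note reg = smooth_energy_body(1)[OF L small]
  define \<gamma> where "\<gamma> s = (curve_p e s, curve_q e s)" for s
  define \<gamma>' :: "real \<Rightarrow> (real ^ 'n) \<times> (real ^ 'n)" where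
    "\<gamma>' s = ((\<chi> j. - ext_k (s - 2 * D * real (e j))), (\<chi> j. b (curve_p e s $ j)))" for s
  have deriv: "(\<gamma> has_vector_derivative \<gamma>' s) (at s)" for s
  proof -
    have 1: "((\<lambda>s. ext_g (s - 2 * D * real (e j))) has_vector_derivative - ext_k (s - 2 * D * real (e j))) (at s)" for j
    proof -
      have "((\<lambda>s. ext_g (s - 2 * D * real (e j))) has_real_derivative - ext_k (s - 2 * D * real (e j)) * 1) (at s)"
        by (rule DERIV_chain2[where f = ext_g and g = "\<lambda>s. s - 2 * D * real (e j)", OF ext_g_deriv])
          (auto intro!: derivative_eq_intros)
      then show ?thesis
        by (simp add: has_real_derivative_iff_has_vector_derivative)
    qed
    have 2: "((\<lambda>s. ext_f (s - 2 * D * real (e j))) has_vector_derivative b (curve_p e s $ j)) (at s)" for j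
    proof -
      have "((\<lambda>s. ext_f (s - 2 * D * real (e j))) has_real_derivative b (ext_g (s - 2 * D * real (e j))) * 1) (at s)"
        by (rule DERIV_chain2[where f = ext_f and g = "\<lambda>s. s - 2 * D * real (e j)", OF ext_f_deriv])
          (auto intro!: derivative_eq_intros)
      then show ?thesis
        by (simp add: curve_p_def has_real_derivative_iff_has_vector_derivative)
    qed
    have vec: "((\<lambda>s. \<chi> j. h j s) has_vector_derivative (\<chi> j. h' j)) (at s)"
      if "\<And>j :: 'n. (h j has_vector_derivative h' j) (at s)" for h :: "'n \<Rightarrow> real \<Rightarrow> real" and h'
    proof -
      have "((\<lambda>s. \<chi> j. h j s) has_derivative (\<lambda>x. \<chi> j. x *\<^sub>R h' j)) (at s)"
      proof (rule has_derivative_componentwise_within[THEN iffD2], intro ballI)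
        fix i :: "real ^ 'n" assume "i \<in> Basis"
        then obtain j where "i = axis j 1"
          by (auto simp: Basis_vec_def)
        then show "((\<lambda>s. (\<chi> j. h j s) \<bullet> i) has_derivative (\<lambda>x. (\<chi> j. x *\<^sub>R h' j) \<bullet> i)) (at s)"
          using that[of j] by (simp add: inner_axis has_vector_derivative_def)
      qed
      moreover have "(\<lambda>x. \<chi> j. x *\<^sub>R h' j) = (\<lambda>x. x *\<^sub>R (\<chi> j. h' j))"
        by (simp add: fun_eq_iff vec_eq_iff)
      ultimately show ?thesis
        by (simp add: has_vector_derivative_def)
    qed
    show ?thesis
      unfolding \<gamma>_def \<gamma>'_def
      using has_vector_derivative_Pair[OF vec[OF 1] vec[OF 2]] by (simp only: curve_p_def curve_q_def)
  qed
  have cont: "continuous_on UNIV \<gamma>'"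
    unfolding \<gamma>'_def
    by (intro continuous_on_Pair continuous_on_vec_lambda continuous_intros continuous_on_compose2[OF ext_k_cont]
        continuous_on_compose2[OF b_cont] curve_p_cont) auto
  have T: "2 * half_period > 0"
    using half_period(1) by simp
  have "closed_characteristic {z. smooth_energy \<beta> L z \<le> 1} (2 * half_period) \<gamma>"
  proof (rule closed_characteristicI[OF reg T _ deriv cont])
    fix s
    have shift: "s + 2 * half_period - c = s - c + half_period * of_int 2" for c
      by simp
    show "\<gamma> (s + 2 * half_period) = \<gamma> s"
      unfolding \<gamma>_def curve_p_def curve_q_def shift ext_shift by (simp add: sign_of_def)
    obtain DM where eqs: "smooth_norm_1 (curve_p e s) > 0"
      "(smooth_norm_1 (curve_p e s))\<^sup>2 + (smooth_Max \<beta> L (curve_q e s))\<^sup>2 = 1"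
      "(smooth_Max \<beta> L has_derivative DM) (at (curve_q e s))"
      "\<And>j. - ext_k (s - 2 * D * real (e j)) = - (smooth_Max \<beta> L (curve_q e s) / smooth_norm_1 (curve_p e s) * DM (axis j 1))"
      using curve_equations[OF e card L, of s] by blast
    show "smooth_energy \<beta> L (\<gamma> s) = 1"
      using eqs(2) by (simp add: smooth_energy_def \<gamma>_def)
    have "hamiltonian_field (smooth_energy \<beta> L) (\<gamma> s) =
        ((\<chi> i. - (2 * smooth_Max \<beta> L (curve_q e s) * DM (axis i 1))),
         (\<chi> i. 2 * smooth_norm_1 (curve_p e s) * b (curve_p e s $ i)))"
      using hamiltonian_field_smooth_energy[of \<beta> L DM "\<gamma> s"] eqs(3) by (simp add: \<gamma>_def)
    then have "\<gamma>' s = (1 / (2 * smooth_norm_1 (curve_p e s))) *\<^sub>R hamiltonian_field (smooth_energy \<beta> L) (\<gamma> s)"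
      using eqs(1) unfolding \<gamma>'_def eqs(4) by (simp add: vec_eq_iff)
    then show "\<exists>r>0. \<gamma>' s = r *\<^sub>R hamiltonian_field (smooth_energy \<beta> L) (\<gamma> s)"
      using eqs(1) by (intro exI[of _ "1 / (2 * smooth_norm_1 (curve_p e s))"]) simp
  qed
  moreover have "action (2 * half_period) \<gamma> \<le> 4 * real n / (2 * real n - 1) + 40 * (real n)\<^sup>2 * \<epsilon>"
  proof -
    have "action (2 * half_period) \<gamma> = integral {0..real (4 * n) * D} (action_density e)"
      unfolding action_def vector_derivative_at[OF deriv]
      by (simp add: \<gamma>_def \<gamma>'_def action_density_def[abs_def] half_period_def mult.assoc)
    also have "\<dots> \<le> real (4 * n) * (D * (sqrt 2 - \<beta> - real n * D + 5 / 2 * \<epsilon>) + D\<^sup>2 / 2)"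
      by (rule action_density_integral_le[OF e card L])
    also have "\<dots> = 4 * real n * (D * sqrt 2 - (real n - 1 / 2) * D\<^sup>2) + 4 * real n * (D * (5 / 2 * \<epsilon> - \<beta>))"
      by (simp add: power2_eq_square algebra_simps)
    also have "\<dots> \<le> 4 * real n * (1 / (2 * real n - 1)) + 4 * real n * (10 * real n * \<epsilon>)"
    proof (intro add_mono mult_left_mono)
      define h where "h = real n - 1 / 2"
      have h: "h > 0" "2 * real n - 1 = 2 * h"
        using n by (auto simp: h_def)
      have "0 \<le> (sqrt 2 * h * D - 1)\<^sup>2"
        by simp
      also have "\<dots> = 2 * h\<^sup>2 * D\<^sup>2 - 2 * h * (D * sqrt 2) + 1"
        by (simp add: power2_diff power_mult_distrib)
      also have "\<dots> = 1 - 2 * h * (D * sqrt 2 - h * D\<^sup>2)"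
        by (simp add: power2_eq_square algebra_simps)
      finally have "(D * sqrt 2 - h * D\<^sup>2) * (2 * h) \<le> 1"
        by (simp add: mult.commute)
      then show "D * sqrt 2 - (real n - 1 / 2) * D\<^sup>2 \<le> 1 / (2 * real n - 1)"
        using h unfolding h(2) h_def[symmetric] by (simp add: pos_le_divide_eq)
      have "5 / 2 * \<epsilon> - \<beta> \<le> 10 * real n * \<epsilon>"
      proof -
        have "2 * \<epsilon> \<le> real n * \<epsilon>"
          using n eps_pos by (intro mult_right_mono) auto
        then show ?thesis
          using beta_small eps_pos by linarith
      qed
      then have "D * (5 / 2 * \<epsilon> - \<beta>) \<le> D * (10 * real n * \<epsilon>)"
        using D_pos by (intro mult_left_mono) auto
      also have "\<dots> \<le> 1 * (10 * real n * \<epsilon>)"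
        using D_le eps_pos by (intro mult_right_mono) auto
      finally show "D * (5 / 2 * \<epsilon> - \<beta>) \<le> 10 * real n * \<epsilon>"
        by simp
    qed auto
    finally show ?thesis
      by (simp add: power2_eq_square)
  qed
  ultimately show ?thesis
    by blast
qed

end

section \<open>The capacity against the volume\<close>

lemma c_EHZ_square_sum_ball_bounds:
  fixes X :: "((real ^ 'n) \<times> (real ^ 'n)) set"
  assumes card: "CARD('n) \<ge> 2" and X: "X = {(p, q). (norm_1 p)\<^sup>2 + (norm_inf q)\<^sup>2 \<le> 1}"
  shows "0 \<le> c_EHZ X" "c_EHZ X \<le> 4 * real CARD('n) / (2 * real CARD('n) - 1)"
proof -
  define N where "N = real CARD('n)"
  have N: "N \<ge> 2"
    using card by (simp add: N_def)
  obtain L :: "'n list" where L: "set L = UNIV" "distinct L"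
    using finite_distinct_list[of "UNIV :: 'n set"] by auto
  have approx: "\<exists>K :: ((real ^ 'n) \<times> (real ^ 'n)) set. smooth_convex_body K \<and> \<bar>hausdorff_distance K X\<bar> < \<eta> \<and>
      0 \<le> min_action K \<and> min_action K \<le> 4 * N / (2 * N - 1) + \<eta>" if \<eta>: "\<eta> > 0" for \<eta>
  proof -
    \<comment> \<open>The profile needs \<open>N\<^sup>2 \<epsilon> \<le> 1 / 1000\<close>, and the action exceeds its bound by at most \<open>40 N\<^sup>2 \<epsilon>\<close>.\<close>
    define \<epsilon> where "\<epsilon> = min (1 / 1000) (\<eta> / 40) / N\<^sup>2"
    have \<epsilon>: "\<epsilon> > 0"
      using \<eta> N by (simp add: \<epsilon>_def)
    have "N\<^sup>2 * \<epsilon> = min (1 / 1000) (\<eta> / 40)"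
      using N by (simp add: \<epsilon>_def)
    then have N2\<epsilon>: "N\<^sup>2 * \<epsilon> \<le> 1 / 1000" "N\<^sup>2 * \<epsilon> \<le> \<eta> / 40"
      by simp_all
    have N\<epsilon>: "N * \<epsilon> * 2 \<le> N\<^sup>2 * \<epsilon>"
      using N \<epsilon> mult_left_mono[of 2 N "N * \<epsilon>"] by (simp add: power2_eq_square mult_ac)
    obtain a b where ab: "smoothed_abs a b \<epsilon>"
      using smoothed_abs_exists[OF \<epsilon>] by blast
    interpret smoothed_abs a b \<epsilon>
      by (rule ab)
    obtain D m \<beta> f g k where "characteristic_profile a b \<epsilon> CARD('n) D m \<beta> f g k"
      using characteristic_profile_exists[OF card] N2\<epsilon>(1) by (auto simp: N_def)
    then interpret characteristic_profile a b \<epsilon> "CARD('n)" D m \<beta> f g k .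
    define K' :: "((real ^ 'n) \<times> (real ^ 'n)) set" where "K' = {z. smooth_energy \<beta> L z \<le> 1}"
    have small: "real CARD('n) * \<epsilon> \<le> 1 / 8" "\<bar>\<beta>\<bar> \<le> 1 / 4"
      using smallness D_le by linarith+
    note body = smooth_energy_body(2,3)[OF L small, folded K'_def]
    obtain T \<gamma> where cc: "closed_characteristic K' T \<gamma>"
      and act: "action T \<gamma> \<le> 4 * N / (2 * N - 1) + 40 * N\<^sup>2 * \<epsilon>"
      using short_closed_characteristic[OF refl L] unfolding K'_def N_def by blast
    have "\<bar>hausdorff_distance K' X\<bar> \<le> 10 * N * \<epsilon> * (real CARD('n) + 1)"
    proof (rule hausdorff_distance_square_sum_balls[OF X])
      show "K' = {(p, q). (smooth_norm_1 p)\<^sup>2 + (smooth_Max \<beta> L q)\<^sup>2 \<le> 1}"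
        by (auto simp: K'_def smooth_energy_def)
      show "\<bar>smooth_norm_1 p - norm_1 p\<bar> \<le> N * \<epsilon>" for p :: "real ^ 'n"
        unfolding N_def by (rule smooth_norm_1_close)
      show "\<bar>smooth_Max \<beta> L q - norm_inf q\<bar> \<le> 9 * N * \<epsilon>" for q
        using smooth_Max_close[OF L, of \<beta> q] beta_small unfolding N_def by linarith
      show "N * \<epsilon> + 9 * N * \<epsilon> \<le> 10 * N * \<epsilon>" "10 * N * \<epsilon> < 1"
        using N\<epsilon> N2\<epsilon>(1) by linarith+
    qed
    also have "\<dots> \<le> 10 * N * \<epsilon> * (2 * N)"
      using N \<epsilon> unfolding N_def by (intro mult_left_mono) auto
    also have "\<dots> = 20 * (N\<^sup>2 * \<epsilon>)"
      by (simp add: power2_eq_square)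
    also have "\<dots> < \<eta>"
      using N2\<epsilon>(2) \<eta> by linarith
    finally have "\<bar>hausdorff_distance K' X\<bar> < \<eta>" .
    moreover have "0 \<le> min_action K'" "min_action K' \<le> 4 * N / (2 * N - 1) + \<eta>"
      using min_action_bounds[OF body cc] act N2\<epsilon>(2) by linarith+
    ultimately show ?thesis
      using body(1) by blast
  qed
  have "0 \<le> 4 * N / (2 * N - 1)"
    using N by simp
  from c_EHZ_bounds[OF square_sum_ball_not_smooth[OF card X] this approx]
  show "0 \<le> c_EHZ X" "c_EHZ X \<le> 4 * real CARD('n) / (2 * real CARD('n) - 1)"
    unfolding N_def by blast+
qed

lemma measure_square_sum_ball:
  "measure lebesgue {(p :: real ^ 'n, q :: real ^ 'n). (norm_1 p)\<^sup>2 + (norm_inf q)\<^sup>2 \<le> 1} =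
    4 ^ CARD('n) * (Gamma (real CARD('n) / 2 + 1))\<^sup>2 / (fact CARD('n))\<^sup>2"
proof -
  let ?X = "{(p :: real ^ 'n, q :: real ^ 'n). (norm_1 p)\<^sup>2 + (norm_inf q)\<^sup>2 \<le> 1}"
  note [measurable] = borel_measurable_norm_1 borel_measurable_norm_inf
  have "(\<lambda>z :: (real ^ 'n) \<times> (real ^ 'n). (norm_1 (fst z))\<^sup>2 + (norm_inf (snd z))\<^sup>2) \<in> borel_measurable borel"
    unfolding borel_prod[symmetric] by measurable
  then have "{z :: (real ^ 'n) \<times> (real ^ 'n). (norm_1 (fst z))\<^sup>2 + (norm_inf (snd z))\<^sup>2 \<le> 1} \<in> sets borel"
    by measurable
  moreover have "?X = {z. (norm_1 (fst z))\<^sup>2 + (norm_inf (snd z))\<^sup>2 \<le> 1}"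
    by auto
  ultimately have "?X \<in> sets lborel"
    by simp
  then have "measure lebesgue ?X = measure lborel ?X"
    by (rule measure_completion)
  also have "\<dots> = 4 ^ CARD('n) * (Gamma (real CARD('n) / 2 + 1))\<^sup>2 / (fact CARD('n))\<^sup>2"
    unfolding measure_def emeasure_square_sum_ball by (rule enn2real_ennreal) simp
  finally show ?thesis .
qed

text \<open>
  The inverse is \<open>(1 - 1 / (2 n))\<^sup>n \<ge> 1 - n / (2 n)\<close> by Bernoulli's inequality.
\<close>

lemma Bernoulli_power_le_2:
  assumes "n \<ge> 1"
  shows "(2 * real n / (2 * real n - 1)) ^ n \<le> 2"
proof -
  define x where "x = 1 - 1 / (2 * real n)"
  have x: "x > 0" "2 * real n / (2 * real n - 1) = inverse x"
    using assms by (auto simp: x_def field_simps)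
  have "1 + real n * (- (1 / (2 * real n))) \<le> (1 + - (1 / (2 * real n))) ^ n"
    using assms by (intro Bernoulli_inequality) (simp add: field_simps)
  then have "1 / 2 \<le> x ^ n"
    using assms by (simp add: x_def)
  then have "inverse (x ^ n) \<le> inverse (1 / 2)"
    by (rule le_imp_inverse_le) simp
  then show ?thesis
    unfolding x(2) by (simp add: power_inverse)
qed

theorem theorem4p5:
  fixes X :: "((real ^ 'n) \<times> (real ^ 'n)) set"
  assumes "X = {(p, q). (norm_1 p)\<^sup>2 + (norm_inf q)\<^sup>2 \<le> 1}"
  shows "measure lebesgue X \<ge> c_EHZ X ^ CARD('n) / fact CARD('n)"
proof -
  define n where "n = CARD('n)"
  define \<Gamma> where "\<Gamma> = Gamma (real n / 2 + 1)"
  have vol: "measure lebesgue X = 4 ^ n * \<Gamma>\<^sup>2 / (fact n)\<^sup>2"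
    unfolding assms n_def \<Gamma>_def by (rule measure_square_sum_ball)
  have "n \<ge> 1"
    by (simp add: n_def Suc_le_eq)
  then consider "n = 1" | "n \<ge> 2"
    by linarith
  then show ?thesis
  proof cases
    case 1
    then have "c_EHZ X \<le> pi"
      using c_EHZ_square_sum_ball_dim_1[OF _ assms] by (simp add: n_def)
    moreover have Gamma_eq: "\<Gamma> = sqrt pi / 2"
    proof -
      have "(1 / 2 :: real) \<notin> \<int>\<^sub>\<le>\<^sub>0"
        by (auto dest: nonpos_Ints_nonpos)
      then show ?thesis
        using Gamma_plus1[of "1 / 2 :: real"] 1 by (simp add: \<Gamma>_def Gamma_one_half_real add.commute)
    qed
    have "measure lebesgue X = pi"
      unfolding vol Gamma_eq using 1 by (simp add: power_divide)
    ultimately show ?thesis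
      using 1 by (simp add: n_def)
  next
    case 2
    define B where "B = 2 * real n / (2 * real n - 1)"
    have c: "0 \<le> c_EHZ X" "c_EHZ X \<le> 2 * B"
      using c_EHZ_square_sum_ball_bounds[OF _ assms] 2 by (auto simp: n_def B_def)
    have "c_EHZ X ^ n \<le> (2 * B) ^ n"
      using c by (rule power_mono[rotated])
    also have "\<dots> = 2 ^ n * B ^ n"
      by (rule power_mult_distrib)
    also have "\<dots> \<le> 2 ^ n * 2"
      using Bernoulli_power_le_2[of n] 2 unfolding B_def by (intro mult_left_mono) auto
    finally have "c_EHZ X ^ n / fact n \<le> 2 ^ n * 2 / fact n"
      by (rule divide_right_mono) simp
    also have "\<dots> = 2 ^ n * (2 * fact n) / (fact n)\<^sup>2"
      by (simp add: power2_eq_square)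
    also have "\<dots> \<le> 2 ^ n * (2 ^ n * \<Gamma>\<^sup>2) / (fact n)\<^sup>2"
      using Gamma_square_bound[OF 2] unfolding \<Gamma>_def by (intro divide_right_mono mult_left_mono) auto
    also have "\<dots> = measure lebesgue X"
      unfolding vol by (simp flip: mult.assoc power_mult_distrib)
    finally show ?thesis
      by (simp add: n_def)
  qed
qed

end
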